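(* Let $\mathbf s$ be a sequence in $\widehat{\mathcal S}$ such that $\widehat{\mathcal G}_{J(\mathbf s)}$ satisfies the GKM-property, let $x\in\widehat{\mathcal W}$, and let $\pi^{(1)},\dots,\pi^{(n)}$ be the maximal paths in the tree $T(\mathbf s,x)$ listed according to their starting leaves from left to right. Then there exists a homogeneous $S$-basis $v_1,\dots,v_n$ of $\mathcal X(\mathbf s)^x$ such that $(v_i)_{[\pi^{(j)}]}=(\pi^{(i)},\pi^{(j)})$ for all $i,j=1,\dots,n$.
   Context: Affine setting. $R$ is an irreducible reduced finite root system in a finite-dimensional $\mathbb Q$-vector space $V$, with weight lattice $X=\{\lambda\in V:\langle\lambda,\alpha^\vee\rangle\in\mathbb Z\ \forall\alpha\in R\}$, positive roots $R^+$, simple roots $\Pi$, highest root $\tilde\alpha$. The affine Weyl group $\widehat{\mathcal W}$ is the group of transformations of $V^*$ generated by $s_{\alpha,n}(v)=v-(\langle\alpha,v\rangle-n)\alpha^\vee$ ($\alpha\in R,n\in\mathbb Z$). Affine roots: $\widehat R=R\times\mathbb Z\subset\widehat X:=X\oplus\mathbb Z\subset\widehat V:=V\oplus\mathbb Q$, with $s_{(\alpha,-n)}:=s_{\alpha,n}$; $\widehat R^+=\{(\alpha,n):n>0\}\cup\{(\alpha,0):\alpha\in R^+\}$; $\widehat\Pi=\{(\alpha,0):\alpha\in\Pi\}\cup\{(-\tilde\alpha,1)\}$; $\widehat{\mathcal S}=\{s_\gamma:\gamma\in\widehat\Pi\}$. $(\widehat{\mathcal W},\widehat{\mathcal S})$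 is a Coxeter system with length $\ell$, Bruhat order $\le$, unit $e$. $\widehat{\mathcal W}$ acts linearly on $\widehat V$ by $s_\alpha(\beta)=\beta-\langle\{\beta\},\{\alpha\}^\vee\rangle\alpha$, where $\{(\lambda,n)\}=\lambda$. $\mathbb F$ is a field of characteristic $\neq2$, $\mathsf V=\widehat X\otimes_{\mathbb Z}\mathbb F$, $S$ is the symmetric algebra of $\mathsf V$, $\mathbb Z$-graded with $\mathsf V$ in degree $2$; $\bar\lambda:=\lambda\otimes1$ for $\lambda\in\widehat X$. The moment graph $\widehat{\mathcal G}$ has vertex poset $(\widehat{\mathcal W},\le)$ and an edge $x\to y$ labelled $\bar\alpha$ iff $x<y$ and $y=s_\alpha x$, $\alpha\in\widehat R^+$. $\widehat{\mathcal G}_\Omega$ is the full subgraph on $\Omega\subset\widehat{\mathcal W}$. GKM-property: labels of any two distinct edges with a common vertex are not proportional over $\mathbb F$. Sequences. A subsequence of $\mathbf s=(s_1,\dots,s_l)$ is obtained by replacing some entries by the blank symbol $\ast$; $I(\mathbf s)$ is the set of all $2^l$ subsequences; $\operatorname{ev}(\sigma)\in\widehat{\mathcal W}$ is the ordered product of the non-blank entries of $\sigma$; $I(\mathbf s)_x=\{\sigma\in I(\mathbf s):\operatorname{ev}(\sigma)=x\}$; $J(\mathbf s)=\{\operatorname{ev}(\sigma):\sigma\in I(\mathbf s)\}$; $\mathbf s'=(s_1,\dots,s_{l-1})$; $\alpha_i\in\widehat\Pi$ is such that $s_i=s_{\alpha_i}$. The module $\mathcal X(\mathbf s)$. For $\lambda\in\widehat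 X$, $c^\lambda$ acts on $f\in\bigoplus_{\sigma\in I(\mathbf s)}S$ by $(c^\lambda f)_\sigma=\overline{\operatorname{ev}(\sigma)(\lambda)}\,f_\sigma$. $\Delta:\bigoplus_{\sigma\in I(\mathbf s')}S\to\bigoplus_{\sigma\in I(\mathbf s)}S$ is $\Delta(f)_{\sigma\ast}=\Delta(f)_{\sigma s_l}=f_\sigma$. $\mathcal X(\emptyset)=\bigoplus_{\sigma\in I(\emptyset)}S\cong S$, and $\mathcal X(\mathbf s)=\Delta(\mathcal X(\mathbf s'))+c^{\alpha_l}\Delta(\mathcal X(\mathbf s'))$ for $\mathbf s\neq\emptyset$. $\mathcal X(\mathbf s)^x:=\{f|_{I(\mathbf s)_x}:f\in\mathcal X(\mathbf s)\}\subset\bigoplus_{\sigma\in I(\mathbf s)_x}S$. Trees. $T(\mathbf s,x)$ is a planar rooted tree, edges oriented towards the root, each edge $\gamma$ having a colour $\mathbf c(\gamma)\in\{-1,0,1\}$ and a root label $\mathbf r(\gamma)\in\widehat\Pi$, defined inductively. $T(\emptyset,x)$ is a single vertex if $x=e$ and empty otherwise. For $l>0$ write $\{x,xs_l\}=\{y,z\}$ with $y<z$. If $I(\mathbf s')_y=I(\mathbf s')_z=\emptyset$, $T(\mathbf s,x)$ is empty. If both are nonempty, $T(\mathbf s,x)$ has a new root vertex with two edges ending at it: one from the root of $T(\mathbf s',y)$, placed on the left (this edge is called right tilted), and one from the root of $T(\mathbf s',z)$, placed on the right (called left tilted); both have root label $\alpha_l$; their colours are $1$ and $0$ respectively if $x=z$,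 and $0$ and $-1$ respectively if $x=y$. If exactly one is nonempty, then it is $I(\mathbf s')_y$, and $T(\mathbf s,x)$ has a new root vertex with a single (vertical) edge ending at it, from the root of $T(\mathbf s',y)$, with root label $\alpha_l$ and colour $0$ if $x=y$, $1$ if $x=z$. New edges have level $l$; an edge of level $i$ has root label $\alpha_i$. Leaves are the vertices at which no edge ends. A path starting at a leaf is $\pi=\pi_1\cdots\pi_i$ with $\pi_j$ of level $j$; $[\pi]$ is the sequence of length $i$ whose $j$-th entry is $s_j$ if $\mathbf c(\pi_j)\ne0$ and $\ast$ if $\mathbf c(\pi_j)=0$; $\operatorname{ev}(\pi):=\operatorname{ev}([\pi])$. Maximal paths are those from a leaf to the root; $\pi\mapsto[\pi]$ is a bijection from maximal paths of $T(\mathbf s,x)$ to $I(\mathbf s)_x$. Product of paths. For a path $\pi=\pi_1\cdots\pi_i$ starting at a leaf, $\mathbf b_\pi\in\mathcal X((s_1,\dots,s_i))$ is defined by $\mathbf b_\emptyset=1$ and, with $\pi'=\pi_1\cdots\pi_{i-1}$, $\mathbf b_\pi=\Delta(\mathbf b_{\pi'})$ if $\pi_i$ is vertical or right tilted, $\mathbf b_\pi=\Delta\bigl(\tfrac12(c^{\alpha_i}+\overline{\operatorname{ev}(\pi')(\alpha_i)})\mathbf b_{\pi'}\bigr)$ if $\pi_i$ is left tilted. For two paths $\pi,\rho$ of equal length starting at leaves, $(\pi,\rho):=(\mathbf b_\pi)_{[\rho]}\in S$. *)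

theory Defs
  imports
    Complex_Main
    "HOL-Algebra.Bij"
    "HOL-Algebra.Generated_Groups"
    "HOL-Library.Poly_Mapping"
    "HOL-Library.Function_Algebras"
    "HOL-Library.Product_Plus"
begin

section \<open>Length and Bruhat order of a group with a set of generating involutions\<close>

definition group_prod :: "('g, 'm) monoid_scheme \<Rightarrow> 'g list \<Rightarrow> 'g" where
  "group_prod G ws = foldr (\<otimes>\<^bsub>G\<^esub>) ws \<one>\<^bsub>G\<^esub>"

definition cox_length :: "('g, 'm) monoid_scheme \<Rightarrow> 'g set \<Rightarrow> 'g \<Rightarrow> nat" where
  "cox_length G A w = (LEAST n. \<exists>ws \<in> lists A. length ws = n \<and> group_prod G ws = w)"

definition cox_reflections :: "('g, 'm) monoid_scheme \<Rightarrow> 'g set \<Rightarrow> 'g set" where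
  "cox_reflections G A = {w \<otimes>\<^bsub>G\<^esub> a \<otimes>\<^bsub>G\<^esub> inv\<^bsub>G\<^esub> w | w a. w \<in> carrier G \<and> a \<in> A}"

definition bruhat_step :: "('g, 'm) monoid_scheme \<Rightarrow> 'g set \<Rightarrow> 'g \<Rightarrow> 'g \<Rightarrow> bool" where
  "bruhat_step G A x y \<longleftrightarrow> x \<in> carrier G \<and> cox_length G A x < cox_length G A y
     \<and> (\<exists>t \<in> cox_reflections G A. y = t \<otimes>\<^bsub>G\<^esub> x)"

definition bruhat_le :: "('g, 'm) monoid_scheme \<Rightarrow> 'g set \<Rightarrow> 'g \<Rightarrow> 'g \<Rightarrow> bool" where
  "bruhat_le G A = (bruhat_step G A)\<^sup>*\<^sup>*"

definition bruhat_less :: "('g, 'm) monoid_scheme \<Rightarrow> 'g set \<Rightarrow> 'g \<Rightarrow> 'g \<Rightarrow> bool" where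
  "bruhat_less G A x y \<longleftrightarrow> bruhat_le G A x y \<and> x \<noteq> y"


section \<open>Root systems over the rationals\<close>

text \<open>The coroot of a root \<open>\<alpha>\<close> is the linear form \<open>cr \<alpha>\<close>, so that the pairing of
  \<open>\<mu>\<close> with the coroot of \<open>\<alpha>\<close> is \<open>cr \<alpha> \<mu>\<close>. The values of \<open>cr\<close> outside \<open>R\<close> are irrelevant,
  those on \<open>R\<close> are determined by \<open>R\<close>. Finite dimensionality follows from \<open>R\<close> being finite and
  spanning.\<close>

definition root_system ::
    "(rat \<Rightarrow> 'v \<Rightarrow> 'v::ab_group_add) \<Rightarrow> 'v set \<Rightarrow> ('v \<Rightarrow> 'v \<Rightarrow> rat) \<Rightarrow> bool" where
  "root_system scl R cr \<longleftrightarrow> vector_space scl \<and> finite R \<and> 0 \<notin> R \<and> module.span scl R = UNIV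
     \<and> (\<forall>\<alpha>\<in>R. Vector_Spaces.linear scl (*) (cr \<alpha>) \<and> cr \<alpha> \<alpha> = 2
          \<and> (\<forall>\<beta>\<in>R. cr \<alpha> \<beta> \<in> \<int> \<and> \<beta> - scl (cr \<alpha> \<beta>) \<alpha> \<in> R))"

definition reduced :: "(rat \<Rightarrow> 'v \<Rightarrow> 'v::ab_group_add) \<Rightarrow> 'v set \<Rightarrow> bool" where
  "reduced scl R \<longleftrightarrow> (\<forall>\<alpha>\<in>R. \<forall>c. scl c \<alpha> \<in> R \<longrightarrow> c = 1 \<or> c = - 1)"

definition irreducible_roots :: "'v set \<Rightarrow> ('v \<Rightarrow> 'v \<Rightarrow> rat) \<Rightarrow> bool" where
  "irreducible_roots R cr \<longleftrightarrow> R \<noteq> {} \<and>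
     \<not> (\<exists>R1 R2. R1 \<noteq> {} \<and> R2 \<noteq> {} \<and> R1 \<inter> R2 = {} \<and> R1 \<union> R2 = R
            \<and> (\<forall>\<alpha>\<in>R1. \<forall>\<beta>\<in>R2. cr \<beta> \<alpha> = 0))"

definition nonneg_comb :: "(rat \<Rightarrow> 'v \<Rightarrow> 'v::ab_group_add) \<Rightarrow> 'v set \<Rightarrow> 'v set" where
  "nonneg_comb scl P = {\<Sum>\<alpha>\<in>P. scl (of_nat (c \<alpha>)) \<alpha> | c :: 'v \<Rightarrow> nat. True}"

definition simple_system :: "(rat \<Rightarrow> 'v \<Rightarrow> 'v::ab_group_add) \<Rightarrow> 'v set \<Rightarrow> 'v set \<Rightarrow> bool" where
  "simple_system scl R P \<longleftrightarrow> P \<subseteq> R \<and> \<not> module.dependent scl P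
     \<and> (\<forall>\<beta>\<in>R. \<beta> \<in> nonneg_comb scl P \<or> - \<beta> \<in> nonneg_comb scl P)"

definition highest_root :: "(rat \<Rightarrow> 'v \<Rightarrow> 'v::ab_group_add) \<Rightarrow> 'v set \<Rightarrow> 'v set \<Rightarrow> 'v \<Rightarrow> bool" where
  "highest_root scl R P \<theta> \<longleftrightarrow> \<theta> \<in> R \<and> (\<forall>\<beta>\<in>R. \<theta> - \<beta> \<in> nonneg_comb scl P)"


section \<open>The affine setting\<close>

text \<open>The space \<open>V \<oplus> \<rat>\<close> is \<open>'v \<times> rat\<close>; affine roots and affine weights are elements of it
  with integral second component. The field \<open>latbasis\<close> is an arbitrary
  \<open>\<int>\<close>-basis, indexed by the finite type \<open>'i\<close>, of the affine weight lattice; it is used only to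
  write the symmetric algebra as a polynomial ring.\<close>

record ('v, 'i) affine_datum =
  scl :: "rat \<Rightarrow> 'v \<Rightarrow> 'v"
  roots :: "'v set"
  coroot :: "'v \<Rightarrow> 'v \<Rightarrow> rat"
  simple :: "'v set"
  highest :: "'v"
  latbasis :: "'i \<Rightarrow> 'v \<times> rat"

definition pos_roots :: "('v::ab_group_add, 'i) affine_datum \<Rightarrow> 'v set" where
  "pos_roots D = roots D \<inter> nonneg_comb (scl D) (simple D)"

definition weight_lattice :: "('v, 'i) affine_datum \<Rightarrow> 'v set" where
  "weight_lattice D = {\<mu>. \<forall>\<alpha>\<in>roots D. coroot D \<alpha> \<mu> \<in> \<int>}"

definition aff_weights :: "('v, 'i) affine_datum \<Rightarrow> ('v \<times> rat) set" where
  "aff_weights D = weight_lattice D \<times> \<int>"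

definition aff_roots :: "('v, 'i) affine_datum \<Rightarrow> ('v \<times> rat) set" where
  "aff_roots D = roots D \<times> \<int>"

definition aff_pos_roots :: "('v::ab_group_add, 'i) affine_datum \<Rightarrow> ('v \<times> rat) set" where
  "aff_pos_roots D = {(\<alpha>, n) \<in> aff_roots D. n > 0} \<union> pos_roots D \<times> {0}"

definition aff_simple :: "('v::ab_group_add, 'i) affine_datum \<Rightarrow> ('v \<times> rat) set" where
  "aff_simple D = simple D \<times> {0} \<union> {(- highest D, 1)}"

definition aff_scale :: "('v, 'i) affine_datum \<Rightarrow> rat \<Rightarrow> 'v \<times> rat \<Rightarrow> 'v \<times> rat" where
  "aff_scale D c \<beta> = (scl D c (fst \<beta>), c * snd \<beta>)"

locale affine_setting =
  fixes D :: "('v::ab_group_add, 'i::finite) affine_datum"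
  assumes root_system: "root_system (scl D) (roots D) (coroot D)"
    and reduced: "reduced (scl D) (roots D)"
    and irreducible: "irreducible_roots (roots D) (coroot D)"
    and simple_system: "simple_system (scl D) (roots D) (simple D)"
    and highest_root: "highest_root (scl D) (roots D) (simple D) (highest D)"
    and latbasis_in: "\<And>i. latbasis D i \<in> aff_weights D"
    and latbasis_unique: "\<And>\<mu>. \<mu> \<in> aff_weights D \<Longrightarrow>
        \<exists>!c :: 'i \<Rightarrow> int. \<mu> = (\<Sum>i\<in>UNIV. aff_scale D (of_int (c i)) (latbasis D i))"

subsection \<open>The affine Weyl group\<close>

text \<open>The affine Weyl group acts on \<open>V\<^sup>*\<close>, which is a proper subset of the type
  \<open>'v \<Rightarrow> rat\<close>. Its elements are therefore extensional functions, as in \<^const>\<open>BijGroup\<close>.\<close>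

type_synonym 'v aff = "('v \<Rightarrow> rat) \<Rightarrow> ('v \<Rightarrow> rat)"

definition dual_space :: "('v::ab_group_add, 'i) affine_datum \<Rightarrow> ('v \<Rightarrow> rat) set" where
  "dual_space D = {f. Vector_Spaces.linear (scl D) (*) f}"

definition aff_refl :: "('v::ab_group_add, 'i) affine_datum \<Rightarrow> 'v \<Rightarrow> rat \<Rightarrow> 'v aff" where
  "aff_refl D \<alpha> n = (\<lambda>f \<in> dual_space D. \<lambda>\<mu>. f \<mu> - (f \<alpha> - n) * coroot D \<alpha> \<mu>)"

definition aff_weyl :: "('v::ab_group_add, 'i) affine_datum \<Rightarrow> 'v aff monoid" where
  "aff_weyl D = subgroup_generated (BijGroup (dual_space D))
                  {aff_refl D \<alpha> n | \<alpha> n. \<alpha> \<in> roots D \<and> n \<in> \<int>}"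

text \<open>Note the sign: the affine root \<open>(\<alpha>, -n)\<close> gives the reflection \<open>s\<^sub>\<alpha>\<^sub>,\<^sub>n\<close>.\<close>

definition refl_of :: "('v::ab_group_add, 'i) affine_datum \<Rightarrow> 'v \<times> rat \<Rightarrow> 'v aff" where
  "refl_of D \<gamma> = aff_refl D (fst \<gamma>) (- snd \<gamma>)"

definition simple_refls :: "('v::ab_group_add, 'i) affine_datum \<Rightarrow> 'v aff set" where
  "simple_refls D = refl_of D ` aff_simple D"

definition root_of :: "('v::ab_group_add, 'i) affine_datum \<Rightarrow> 'v aff \<Rightarrow> 'v \<times> rat" where
  "root_of D a = (THE \<gamma>. \<gamma> \<in> aff_simple D \<and> a = refl_of D \<gamma>)"

definition aff_less :: "('v::ab_group_add, 'i) affine_datum \<Rightarrow> 'v aff \<Rightarrow> 'v aff \<Rightarrow> bool" where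
  "aff_less D = bruhat_less (aff_weyl D) (simple_refls D)"

text \<open>The linear action on \<open>V \<oplus> \<rat>\<close> is prescribed on reflections. An element \<open>w\<close> acts by the
  composite of the linear reflections belonging to any expression of \<open>w\<close> as a product of
  reflections in affine roots.\<close>

definition lin_refl :: "('v::ab_group_add, 'i) affine_datum \<Rightarrow> 'v \<times> rat \<Rightarrow> 'v \<times> rat \<Rightarrow> 'v \<times> rat" where
  "lin_refl D \<gamma> \<beta> = \<beta> - aff_scale D (coroot D (fst \<gamma>) (fst \<beta>)) \<gamma>"

definition act :: "('v::ab_group_add, 'i) affine_datum \<Rightarrow> 'v aff \<Rightarrow> 'v \<times> rat \<Rightarrow> 'v \<times> rat" where
  "act D w = (THE A. \<exists>\<gamma>s \<in> lists (aff_roots D).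
      w = group_prod (aff_weyl D) (map (refl_of D) \<gamma>s) \<and> A = foldr (\<lambda>\<gamma> B. lin_refl D \<gamma> \<circ> B) \<gamma>s id)"

subsection \<open>The symmetric algebra\<close>

text \<open>The elements \<open>latbasis i \<otimes> 1\<close> form an \<open>\<F>\<close>-basis of the scalar extension of the affine
  weight lattice to the field, so the symmetric algebra is the polynomial ring over the field in
  variables indexed by \<open>'i\<close>. The scalar extension itself is the space of linear forms in it.\<close>

type_synonym ('i, 'f) sym_alg = "('i \<Rightarrow>\<^sub>0 nat) \<Rightarrow>\<^sub>0 'f"

definition const :: "'f \<Rightarrow> ('i, 'f::zero) sym_alg" where
  "const c = Poly_Mapping.single 0 c"

definition var :: "'i \<Rightarrow> ('i, 'f::zero_neq_one) sym_alg" where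
  "var i = Poly_Mapping.single (Poly_Mapping.single i 1) 1"

definition coords :: "('v::ab_group_add, 'i::finite) affine_datum \<Rightarrow> 'v \<times> rat \<Rightarrow> 'i \<Rightarrow> int" where
  "coords D \<mu> = (THE c. \<mu> = (\<Sum>i\<in>UNIV. aff_scale D (of_int (c i)) (latbasis D i)))"

definition bar :: "('v::ab_group_add, 'i::finite) affine_datum \<Rightarrow> 'v \<times> rat \<Rightarrow> ('i, 'f::field) sym_alg" where
  "bar D \<mu> = (\<Sum>i\<in>UNIV. const (of_int (coords D \<mu> i)) * var i)"

definition homogeneous :: "int \<Rightarrow> ('i::finite, 'f::zero) sym_alg \<Rightarrow> bool" where
  "homogeneous d p \<longleftrightarrow> (\<forall>m \<in> Poly_Mapping.keys p. 2 * (\<Sum>i\<in>UNIV. int (Poly_Mapping.lookup m i)) = d)"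

subsection \<open>The moment graph\<close>

text \<open>An edge of the full subgraph on \<open>\<Omega>\<close> is a triple consisting of source, target and the
  positive affine root whose bar is the label.\<close>

definition mg_edges :: "('v::ab_group_add, 'i) affine_datum \<Rightarrow> 'v aff set \<Rightarrow> ('v aff \<times> 'v aff \<times> 'v \<times> rat) set" where
  "mg_edges D \<Omega> = {(x, y, \<gamma>). x \<in> \<Omega> \<and> y \<in> \<Omega> \<and> aff_less D x y
      \<and> \<gamma> \<in> aff_pos_roots D \<and> y = refl_of D \<gamma> \<otimes>\<^bsub>aff_weyl D\<^esub> x}"

definition proportional :: "('i, 'f::field) sym_alg \<Rightarrow> ('i, 'f) sym_alg \<Rightarrow> bool" where
  "proportional p q \<longleftrightarrow> (\<exists>c. p = const c * q \<or> q = const c * p)"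

definition gkm :: "'f::field itself \<Rightarrow> ('v::ab_group_add, 'i::finite) affine_datum \<Rightarrow> 'v aff set \<Rightarrow> bool" where
  "gkm F D \<Omega> \<longleftrightarrow> (\<forall>(x, y, \<gamma>) \<in> mg_edges D \<Omega>. \<forall>(x', y', \<gamma>') \<in> mg_edges D \<Omega>.
      (x, y, \<gamma>) \<noteq> (x', y', \<gamma>') \<and> {x, y} \<inter> {x', y'} \<noteq> {} \<longrightarrow>
      \<not> proportional (bar D \<gamma> :: ('i, 'f) sym_alg) (bar D \<gamma>'))"


section \<open>Subsequences\<close>

text \<open>The blank symbol is \<^const>\<open>None\<close>.\<close>

type_synonym 'v subseq = "'v aff option list"

definition subseqs_of :: "'v aff list \<Rightarrow> 'v subseq set" where
  "subseqs_of s = {\<sigma>. list_all2 (\<lambda>entry a. entry = None \<or> entry = Some a) \<sigma> s}"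

definition ev :: "('v::ab_group_add, 'i) affine_datum \<Rightarrow> 'v subseq \<Rightarrow> 'v aff" where
  "ev D \<sigma> = group_prod (aff_weyl D) (map the (filter (\<lambda>entry. entry \<noteq> None) \<sigma>))"

definition subseqs_at :: "('v::ab_group_add, 'i) affine_datum \<Rightarrow> 'v aff list \<Rightarrow> 'v aff \<Rightarrow> 'v subseq set" where
  "subseqs_at D s x = {\<sigma> \<in> subseqs_of s. ev D \<sigma> = x}"

definition evals :: "('v::ab_group_add, 'i) affine_datum \<Rightarrow> 'v aff list \<Rightarrow> 'v aff set" where
  "evals D s = ev D ` subseqs_of s"


section \<open>The module \<open>\<X>(s)\<close>\<close>

text \<open>An element of a direct sum of copies of \<open>S\<close> indexed by a set of subsequences is a function
  on all option lists that vanishes outside that set.\<close>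

type_synonym ('v, 'i, 'f) vec = "'v subseq \<Rightarrow> ('i, 'f) sym_alg"

definition vscale :: "('i, 'f::field) sym_alg \<Rightarrow> ('v, 'i, 'f) vec \<Rightarrow> ('v, 'i, 'f) vec" where
  "vscale p f = (\<lambda>\<sigma>. p * f \<sigma>)"

definition cmul :: "('v::ab_group_add, 'i::finite) affine_datum \<Rightarrow> 'v \<times> rat
    \<Rightarrow> ('v, 'i, 'f::field) vec \<Rightarrow> ('v, 'i, 'f) vec" where
  "cmul D \<mu> f = (\<lambda>\<sigma>. bar D (act D (ev D \<sigma>) \<mu>) * f \<sigma>)"

definition diag :: "'v aff list \<Rightarrow> ('v, 'i, 'f::field) vec \<Rightarrow> ('v, 'i, 'f) vec" where
  "diag s f = (\<lambda>\<tau>. if \<tau> \<in> subseqs_of s then f (butlast \<tau>) else 0)"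

function Xmod :: "('v::ab_group_add, 'i::finite) affine_datum \<Rightarrow> 'v aff list \<Rightarrow> ('v, 'i, 'f::field) vec set" where
  "Xmod D s =
     (if s = [] then {f. \<forall>\<sigma>. \<sigma> \<notin> subseqs_of [] \<longrightarrow> f \<sigma> = 0}
      else {diag s f + cmul D (root_of D (last s)) (diag s g) | f g.
              f \<in> Xmod D (butlast s) \<and> g \<in> Xmod D (butlast s)})"
  by pat_completeness auto
termination by (relation "measure (\<lambda>(D, s). length s)") auto
declare Xmod.simps [simp del]

definition Xmod_at :: "('v::ab_group_add, 'i::finite) affine_datum \<Rightarrow> 'v aff list \<Rightarrow> 'v aff
    \<Rightarrow> ('v, 'i, 'f::field) vec set" where
  "Xmod_at D s x = (\<lambda>f \<sigma>. if \<sigma> \<in> subseqs_at D s x then f \<sigma> else 0) ` Xmod D s"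

definition homogeneous_vec :: "('v, 'i::finite, 'f::field) vec \<Rightarrow> bool" where
  "homogeneous_vec f \<longleftrightarrow> (\<exists>d. \<forall>\<sigma>. homogeneous d (f \<sigma>))"

definition homogeneous_basis :: "nat \<Rightarrow> (nat \<Rightarrow> ('v, 'i::finite, 'f::field) vec) \<Rightarrow> ('v, 'i, 'f) vec set \<Rightarrow> bool" where
  "homogeneous_basis n v M \<longleftrightarrow> inj_on v {..<n} \<and> \<not> module.dependent vscale (v ` {..<n})
     \<and> module.span vscale (v ` {..<n}) = M \<and> (\<forall>i<n. homogeneous_vec (v i))"


section \<open>Trees and paths\<close>

datatype tilt = Left_Tilted | Right_Tilted | Vertical

datatype 'r edge = Edge (tilt: tilt) (colour: int) (root_label: 'r)

text \<open>A vertex is given by the list, from left to right, of the edges ending at it together with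
  the subtrees they come from. A leaf is a vertex with an empty list.\<close>

datatype 'r ptree = Vertex "('r edge \<times> 'r ptree) list"

text \<open>The empty tree is \<^const>\<open>None\<close>. The case that \<open>I(s')\<^sub>y\<close> is empty and \<open>I(s')\<^sub>z\<close>
  is not does not occur, so the last branch amounts to both being empty.\<close>

function tree :: "('v::ab_group_add, 'i) affine_datum \<Rightarrow> 'v aff list \<Rightarrow> 'v aff \<Rightarrow> ('v \<times> rat) ptree option" where
  "tree D s x =
     (if s = [] then (if x = \<one>\<^bsub>aff_weyl D\<^esub> then Some (Vertex []) else None)
      else let s' = butlast s;
               \<alpha> = root_of D (last s);
               xs = x \<otimes>\<^bsub>aff_weyl D\<^esub> last s;
               (y, z) = (if aff_less D x xs then (x, xs) else (xs, x))
           in if subseqs_at D s' y \<noteq> {} \<and> subseqs_at D s' z \<noteq> {} then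
                Some (Vertex
                  [(Edge Right_Tilted (if x = z then 1 else 0) \<alpha>, the (tree D s' y)),
                   (Edge Left_Tilted (if x = z then 0 else - 1) \<alpha>, the (tree D s' z))])
              else if subseqs_at D s' y \<noteq> {} then
                Some (Vertex [(Edge Vertical (if x = y then 0 else 1) \<alpha>, the (tree D s' y))])
              else None)"
  by pat_completeness auto
termination by (relation "measure (\<lambda>(D, s, x). length s)") auto
declare tree.simps [simp del]

text \<open>A path is listed from its starting leaf towards the root; its \<open>j\<close>-th edge has level \<open>j\<close>.\<close>

type_synonym 'r path = "'r edge list"

fun leaf_paths :: "'r ptree \<Rightarrow> 'r path list" where
  "leaf_paths (Vertex es) =
     (if es = [] then [[]] else concat (map (\<lambda>(e, t). map (\<lambda>\<pi>. \<pi> @ [e]) (leaf_paths t)) es))"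

definition max_paths :: "'r ptree option \<Rightarrow> 'r path list" where
  "max_paths T = (case T of None \<Rightarrow> [] | Some t \<Rightarrow> leaf_paths t)"

definition path_seq :: "'v aff list \<Rightarrow> ('v \<times> rat) path \<Rightarrow> 'v subseq" where
  "path_seq s \<pi> = map2 (\<lambda>a e. if colour e \<noteq> 0 then Some a else None) (take (length \<pi>) s) \<pi>"

text \<open>The vector of a path of length \<open>i\<close> lies in the module of \<open>take i s\<close>.\<close>

function path_vec :: "('v::ab_group_add, 'i::finite) affine_datum \<Rightarrow> 'v aff list \<Rightarrow> ('v \<times> rat) path
    \<Rightarrow> ('v, 'i, 'f::field) vec" where
  "path_vec D s \<pi> =
     (if \<pi> = [] then (\<lambda>\<sigma>. if \<sigma> = [] then 1 else 0)
      else let \<pi>' = butlast \<pi>;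
               \<alpha> = root_label (last \<pi>);
               b = path_vec D s \<pi>'
           in diag (take (length \<pi>) s)
                (if tilt (last \<pi>) = Left_Tilted
                 then vscale (const (1 / 2))
                        (cmul D \<alpha> b + vscale (bar D (act D (ev D (path_seq s \<pi>')) \<alpha>)) b)
                 else b))"
  by pat_completeness auto
termination by (relation "measure (\<lambda>(D, s, \<pi>). length \<pi>)") auto
declare path_vec.simps [simp del]

definition path_prod :: "('v::ab_group_add, 'i::finite) affine_datum \<Rightarrow> 'v aff list
    \<Rightarrow> ('v \<times> rat) path \<Rightarrow> ('v \<times> rat) path \<Rightarrow> ('i, 'f::field) sym_alg" where
  "path_prod D s \<pi> \<rho> = path_vec D s \<pi> (path_seq s \<rho>)"

end

theory Submission
  imports Defs
begin

text \<open>The vectors \<open>v\<^sub>i\<close> are the restrictions to \<open>I(s)\<^sub>x\<close> of the path vectors. On \<open>I(s)\<^sub>x\<close>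
  the operator \<open>c\<^sup>\<alpha>\<close> (with \<open>\<alpha> = \<alpha>\<^sub>l\<close>) is a scalar, so \<open>\<X>(s)\<^sup>x\<close> is the restriction of \<open>\<X>(s')\<close> to
  \<open>I(s')\<^sub>y \<union> I(s')\<^sub>z\<close> with \<open>{y < z} = {x, xs\<^sub>l}\<close>. A basis of the latter consists of a basis over \<open>y\<close>
  and of the images of a basis over \<open>z\<close> under \<open>(c\<^sup>\<alpha> + z(\<alpha>)) / 2\<close>, which vanishes over \<open>y\<close> and is
  multiplication by \<open>z(\<alpha>)\<close> over \<open>z\<close>, provided that every \<open>f\<close> in \<open>\<X>(s')\<close> vanishing over \<open>y\<close> is
  divisible by \<open>z(\<alpha>)\<close> over \<open>z\<close>.

  This divisibility is proved by induction on \<open>s\<close>, for all edges \<open>s\<^sub>\<beta>z < z\<close> at once. Modulo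
  \<open>\<beta>\<X>(s)\<close>, an element vanishing over \<open>s\<^sub>\<beta>z\<close> comes from some \<open>g\<close> in \<open>\<X>(s')\<close> vanishing over
  \<open>s\<^sub>\<beta>z\<close> and \<open>s\<^sub>\<beta>zs\<^sub>l\<close>. Let \<open>{u < w} = {z, zs\<^sub>l}\<close> and \<open>\<delta> = w(\<alpha>)\<close>. By induction \<open>g\<close> is \<open>\<beta>h\<close>
  over \<open>u\<close>, then \<open>g - \<beta>h\<close> is divisible over \<open>w\<close> by \<open>\<delta>\<close> and by \<open>\<beta>\<close>, hence by their product
  because the GKM-property makes these linear forms coprime. On the way one needs that \<open>\<beta>\<close> behaves
  like a prime on \<open>\<X>(s)\<^sup>x\<close>; this is part of the same induction.

  The order-theoretic input (strong exchange for arbitrary words, lifting property) follows from the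
  fact that a simple affine reflection permutes the positive affine roots other than its own.\<close>

section \<open>Roots and coroots\<close>

text \<open>Divisibility is meant inside the module: the quotient must be the restriction of an
  element of \<open>Xmod D s\<close>, and a componentwise quotient need not be one. For this reason
  coprimality of linear forms in the polynomial ring is not enough; it has to be lifted to the
  module, which uses divisibility for the shorter word. The basis construction only divides along
  edges between w and ws with s simple, but the induction cannot be closed on these. A reflection
  acts from the left and the last letter from the right, so an edge at z leads to edges with the
  same \<beta> at z and at zs for the shorter word. The lifting property makes both of them descend,
  except when the edge is the one joining z and zs. The GKM-property can be used for \<beta> and
  \<delta> together because J(s) contains the lower ends of all edges descending from its elements.
  Characteristic different from 2 enters through the factor 1/2 and through the nonvanishing of the
  labels, which comes from the value 2 of a coroot on its root.\<close>

lemma list_all2_snoc2: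
  "list_all2 P xs (ys @ [y]) \<longleftrightarrow> (\<exists>xs' x. xs = xs' @ [x] \<and> list_all2 P xs' ys \<and> P x y)"
proof
  assume "list_all2 P xs (ys @ [y])"
  then show "\<exists>xs' x. xs = xs' @ [x] \<and> list_all2 P xs' ys \<and> P x y"
    by (auto simp: list_all2_append2 list_all2_Cons2)
qed (auto intro: list_all2_appendI)

context affine_setting
begin

abbreviation W where "W \<equiv> aff_weyl D"
abbreviation R where "R \<equiv> aff_roots D"
abbreviation S where "S \<equiv> simple_refls D"
abbreviation pos where "pos \<equiv> aff_pos_roots D"
abbreviation E where "E \<equiv> dual_space D"

sublocale V: vector_space "scl D"
  using root_system by (auto simp: root_system_def)

lemma finite_roots: "finite (roots D)"
  and zero_notin_roots: "0 \<notin> roots D"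
  and span_roots: "V.span (roots D) = UNIV"
  using root_system by (auto simp: root_system_def)

lemma linear_coroot: "\<alpha> \<in> roots D \<Longrightarrow> Vector_Spaces.linear (scl D) (*) (coroot D \<alpha>)"
  and coroot_self: "\<alpha> \<in> roots D \<Longrightarrow> coroot D \<alpha> \<alpha> = 2"
  and coroot_int: "\<alpha> \<in> roots D \<Longrightarrow> \<beta> \<in> roots D \<Longrightarrow> coroot D \<alpha> \<beta> \<in> \<int>"
  and refl_roots: "\<alpha> \<in> roots D \<Longrightarrow> \<beta> \<in> roots D \<Longrightarrow> \<beta> - scl D (coroot D \<alpha> \<beta>) \<alpha> \<in> roots D"
  using root_system by (auto simp: root_system_def)

lemma linear_form_simps:
  assumes "Vector_Spaces.linear (scl D) (*) f"
  shows "f (x + y) = f x + f y" "f (x - y) = f x - f y" "f (scl D c x) = c * f x" "f 0 = 0" "f (- x) = - f x"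
proof -
  interpret f: Vector_Spaces.linear "scl D" "(*)" f by fact
  show "f (x + y) = f x + f y" "f (x - y) = f x - f y" "f (scl D c x) = c * f x" "f 0 = 0" "f (- x) = - f x"
    by (simp_all add: f.add f.diff f.scale f.zero f.neg)
qed

lemma linear_formI:
  assumes "\<And>x y. f (x + y) = f x + f y" "\<And>c x. f (scl D c x) = c * f x"
  shows "Vector_Spaces.linear (scl D) (*) f"
proof -
  interpret Q: vector_space "(*) :: rat \<Rightarrow> rat \<Rightarrow> rat"
    by unfold_locales (simp_all add: algebra_simps)
  show ?thesis
    by unfold_locales (simp_all add: assms)
qed

lemmas coroot_simps = linear_form_simps [OF linear_coroot]

lemma uminus_roots: "\<alpha> \<in> roots D \<Longrightarrow> - \<alpha> \<in> roots D"
proof -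
  assume a: "\<alpha> \<in> roots D"
  have "\<alpha> - scl D 2 \<alpha> = - \<alpha>"
    using V.scale_left_distrib [of 1 1 \<alpha>] by simp
  then show ?thesis using refl_roots [OF a a] by (simp add: coroot_self [OF a])
qed

text \<open>The product of two reflections in \<open>\<alpha>\<close> preserving \<open>R\<close> is unipotent and permutes the finite set \<open>R\<close>.\<close>

lemma coroot_unique:
  assumes \<alpha>: "\<alpha> \<in> roots D" and lin: "Vector_Spaces.linear (scl D) (*) c" and c2: "c \<alpha> = 2"
    and refl: "\<And>\<beta>. \<beta> \<in> roots D \<Longrightarrow> \<beta> - scl D (c \<beta>) \<alpha> \<in> roots D"
  shows "c = coroot D \<alpha>"
proof -
  define f where "f \<beta> = c \<beta> - coroot D \<alpha> \<beta>" for \<beta>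
  note csimps = linear_form_simps [OF lin]
  have linf: "Vector_Spaces.linear (scl D) (*) f"
    by (rule linear_formI) (simp_all add: f_def csimps coroot_simps \<alpha> algebra_simps)
  note fsimps = linear_form_simps [OF linf]
  have f\<alpha>: "f \<alpha> = 0" by (simp add: f_def c2 coroot_self \<alpha>)
  have "f \<beta> = 0" if \<beta>: "\<beta> \<in> roots D" for \<beta>
  proof (rule ccontr)
    assume nz: "f \<beta> \<noteq> 0"
    have step: "\<gamma> + scl D (f \<gamma>) \<alpha> \<in> roots D" if \<gamma>: "\<gamma> \<in> roots D" for \<gamma>
    proof -
      let ?\<delta> = "\<gamma> - scl D (c \<gamma>) \<alpha>"
      have "?\<delta> - scl D (coroot D \<alpha> ?\<delta>) \<alpha> \<in> roots D"
        using refl [OF \<gamma>] by (rule refl_roots [OF \<alpha>])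
      moreover have "?\<delta> - scl D (coroot D \<alpha> ?\<delta>) \<alpha> = \<gamma> + scl D (f \<gamma>) \<alpha>"
        by (simp add: f_def coroot_simps \<alpha> coroot_self algebra_simps
            flip: V.scale_left_distrib V.scale_left_diff_distrib V.scale_minus_left)
      ultimately show ?thesis by simp
    qed
    have mem: "\<beta> + scl D (of_nat k * f \<beta>) \<alpha> \<in> roots D" for k
    proof (induction k)
      case (Suc k)
      from step [OF this] show ?case
        by (simp add: fsimps f\<alpha> algebra_simps flip: V.scale_left_distrib)
    qed (simp add: \<beta>)
    have "inj (\<lambda>k::nat. \<beta> + scl D (of_nat k * f \<beta>) \<alpha>)"
      using nz \<alpha> zero_notin_roots by (auto intro!: injI simp: V.scale_right_imp_eq)
    then have "infinite (roots D)"
      using mem by (meson finite_subset image_subsetI infinite_UNIV_nat finite_imageD)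
    then show False using finite_roots by simp
  qed
  moreover have "V.subspace {x. f x = 0}"
    by (auto simp: V.subspace_def fsimps)
  ultimately have "V.span (roots D) \<subseteq> {x. f x = 0}"
    by (intro V.span_minimal) auto
  then show ?thesis using span_roots by (auto simp: f_def)
qed

lemma coroot_uminus:
  assumes "\<alpha> \<in> roots D" shows "coroot D (- \<alpha>) x = - coroot D \<alpha> x"
proof -
  have "(\<lambda>x. - coroot D \<alpha> x) = coroot D (- \<alpha>)"
    using assms refl_roots [OF assms]
    by (intro coroot_unique)
      (auto simp: uminus_roots coroot_simps coroot_self intro!: linear_formI)
  then show ?thesis by metis
qed

text \<open>\<open>coroot\<close> is a mere parameter of the datum, so its equivariance has to be
  derived: composing the coroot of \<beta> with the involution \<open>r\<close> gives a form with
  the defining properties of the coroot of \<open>r \<beta>\<close>, and these determine it.\<close>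

lemma coroot_refl:
  assumes \<alpha>: "\<alpha> \<in> roots D" and \<beta>: "\<beta> \<in> roots D"
  shows "coroot D (\<beta> - scl D (coroot D \<alpha> \<beta>) \<alpha>) (x - scl D (coroot D \<alpha> x) \<alpha>) = coroot D \<beta> x"
proof -
  define r where "r y = y - scl D (coroot D \<alpha> y) \<alpha>" for y
  have r_add: "r (x + y) = r x + r y" and r_diff: "r (x - y) = r x - r y"
    and r_scl: "r (scl D c x) = scl D c (r x)" for x y c
    by (simp_all add: r_def coroot_simps \<alpha> V.scale_left_distrib V.scale_left_diff_distrib
        V.scale_right_diff_distrib algebra_simps)
  have r_inv: "r (r y) = y" for y
    using V.scale_left_distrib [of "coroot D \<alpha> y" "coroot D \<alpha> y" \<alpha>]
    by (simp add: r_def coroot_simps \<alpha> coroot_self algebra_simps)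
  have r_roots: "r y \<in> roots D" if "y \<in> roots D" for y
    using refl_roots [OF \<alpha> that] by (simp add: r_def)
  have "(\<lambda>x. coroot D \<beta> (r x)) = coroot D (r \<beta>)"
  proof (rule coroot_unique)
    show "r \<beta> \<in> roots D" by (simp add: r_roots \<beta>)
    show "Vector_Spaces.linear (scl D) (*) (\<lambda>x. coroot D \<beta> (r x))"
      by (rule linear_formI) (simp_all add: r_add r_scl coroot_simps \<beta>)
    show "coroot D \<beta> (r (r \<beta>)) = 2" by (simp add: r_inv coroot_self \<beta>)
    fix y assume y: "y \<in> roots D"
    have "r (r y - scl D (coroot D \<beta> (r y)) \<beta>) \<in> roots D"
      by (intro r_roots refl_roots \<beta> y)
    then show "y - scl D (coroot D \<beta> (r y)) (r \<beta>) \<in> roots D"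
      by (simp add: r_diff r_inv r_scl)
  qed
  then have "coroot D (r \<beta>) (r x) = coroot D \<beta> (r (r x))" by metis
  then show ?thesis by (simp add: r_inv) (simp add: r_def)
qed

section \<open>The affine Weyl group and its linear action\<close>

text \<open>An element \<open>(\<mu>, n)\<close> of \<open>V \<oplus> \<rat>\<close> is viewed as the affine function \<open>f \<mapsto> f(\<mu>) + n\<close> on \<open>V\<^sup>*\<close>;
  this makes the linear action dual to the affine one and shows that it is well defined.\<close>

definition pairing :: "('v \<Rightarrow> rat) \<Rightarrow> 'v \<times> rat \<Rightarrow> rat" where
  "pairing f \<beta> = f (fst \<beta>) + snd \<beta>"

lemma aff_refl_dual:
  assumes "\<alpha> \<in> roots D" "f \<in> E" shows "aff_refl D \<alpha> n f \<in> E"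
  using assms linear_form_simps [of f] coroot_simps [OF assms(1)]
  by (auto simp: aff_refl_def dual_space_def algebra_simps intro!: linear_formI)

lemma aff_refl_involution:
  assumes "\<alpha> \<in> roots D" "f \<in> E" shows "aff_refl D \<alpha> n (aff_refl D \<alpha> n f) = f"
proof -
  have "aff_refl D \<alpha> n (aff_refl D \<alpha> n f) \<mu> = f \<mu>" for \<mu>
    using assms aff_refl_dual [OF assms, of n] by (simp add: aff_refl_def coroot_self algebra_simps)
  then show ?thesis by blast
qed

lemma refl_of_Bij: "\<gamma> \<in> R \<Longrightarrow> refl_of D \<gamma> \<in> Bij E"
  unfolding Bij_def refl_of_def
proof (intro IntI CollectI)
  assume "\<gamma> \<in> R"
  then have "fst \<gamma> \<in> roots D" by (auto simp: aff_roots_def)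
  then show "bij_betw (aff_refl D (fst \<gamma>) (- snd \<gamma>)) E E"
    by (intro bij_betw_byWitness [where f' = "aff_refl D (fst \<gamma>) (- snd \<gamma>)"])
      (auto simp: aff_refl_involution aff_refl_dual)
  show "aff_refl D (fst \<gamma>) (- snd \<gamma>) \<in> extensional E"
    by (simp add: aff_refl_def)
qed

lemma aff_weyl_eq: "W = subgroup_generated (BijGroup E) (refl_of D ` R)"
proof -
  have "{aff_refl D \<alpha> n | \<alpha> n. \<alpha> \<in> roots D \<and> n \<in> \<int>} = refl_of D ` R"
  proof (intro equalityI subsetI)
    fix x assume "x \<in> {aff_refl D \<alpha> n | \<alpha> n. \<alpha> \<in> roots D \<and> n \<in> \<int>}"
    then obtain \<alpha> n where "\<alpha> \<in> roots D" "n \<in> \<int>" "x = refl_of D (\<alpha>, - n)" by (auto simp: refl_of_def)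
    then show "x \<in> refl_of D ` R" by (auto simp: aff_roots_def)
  next
    fix x assume "x \<in> refl_of D ` R"
    then obtain \<alpha> n where "\<alpha> \<in> roots D" "n \<in> \<int>" "x = aff_refl D \<alpha> (- n)"
      by (auto simp: refl_of_def aff_roots_def)
    then show "x \<in> {aff_refl D \<alpha> n | \<alpha> n. \<alpha> \<in> roots D \<and> n \<in> \<int>}" by (auto intro!: exI [of _ "- n"] exI [of _ \<alpha>])
  qed
  then show ?thesis by (simp add: aff_weyl_def)
qed

sublocale W: group W
  unfolding aff_weyl_def by (intro group.group_subgroup_generated group_BijGroup)

lemma carrier_Bij: "x \<in> carrier W \<Longrightarrow> x \<in> Bij E"
  using group.carrier_subgroup_generated_subset [OF group_BijGroup]
  unfolding aff_weyl_eq by (fastforce simp: BijGroup_def)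

lemma mult_eq: "x \<in> carrier W \<Longrightarrow> y \<in> carrier W \<Longrightarrow> x \<otimes>\<^bsub>W\<^esub> y = compose E x y"
  using carrier_Bij [of x] carrier_Bij [of y]
  by (simp add: aff_weyl_def subgroup_generated_def BijGroup_def)

lemma one_eq: "\<one>\<^bsub>W\<^esub> = (\<lambda>f\<in>E. f)"
  by (simp add: aff_weyl_eq subgroup_generated_def BijGroup_def)

lemma refl_carrier [simp, intro]: "\<gamma> \<in> R \<Longrightarrow> refl_of D \<gamma> \<in> carrier W"
  using refl_of_Bij [of \<gamma>]
  by (auto simp: aff_weyl_eq carrier_subgroup_generated BijGroup_def intro!: generate.incl)

lemma carrier_dual [simp]: "x \<in> carrier W \<Longrightarrow> f \<in> E \<Longrightarrow> x f \<in> E"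
  using carrier_Bij Bij_imp_funcset by blast

lemma carrier_eqI:
  assumes "x \<in> carrier W" "y \<in> carrier W" "\<And>f. f \<in> E \<Longrightarrow> x f = y f"
  shows "x = y"
  using assms(3) Bij_imp_extensional [OF carrier_Bij [OF assms(1)]] Bij_imp_extensional [OF carrier_Bij [OF assms(2)]]
  by (metis extensionalityI)

lemma mult_app: "x \<in> carrier W \<Longrightarrow> y \<in> carrier W \<Longrightarrow> f \<in> E \<Longrightarrow> (x \<otimes>\<^bsub>W\<^esub> y) f = x (y f)"
  by (simp add: mult_eq compose_def)

lemma refl_refl: "\<gamma> \<in> R \<Longrightarrow> refl_of D \<gamma> \<otimes>\<^bsub>W\<^esub> refl_of D \<gamma> = \<one>\<^bsub>W\<^esub>"
  by (rule carrier_eqI)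
    (simp_all add: mult_app, auto simp: one_eq refl_of_def aff_roots_def aff_refl_involution)

lemma inv_refl: "\<gamma> \<in> R \<Longrightarrow> inv\<^bsub>W\<^esub> (refl_of D \<gamma>) = refl_of D \<gamma>"
  by (simp add: W.inv_equality refl_refl)

lemma group_prod_Nil [simp]: "group_prod W [] = \<one>\<^bsub>W\<^esub>"
  and group_prod_Cons [simp]: "group_prod W (w # ws) = w \<otimes>\<^bsub>W\<^esub> group_prod W ws"
  by (simp_all add: group_prod_def)

lemma group_prod_closed [simp]: "set ws \<subseteq> carrier W \<Longrightarrow> group_prod W ws \<in> carrier W"
  by (induction ws) auto

lemma group_prod_append:
  "set ws \<subseteq> carrier W \<Longrightarrow> set ws' \<subseteq> carrier W \<Longrightarrow> group_prod W (ws @ ws') = group_prod W ws \<otimes>\<^bsub>W\<^esub> group_prod W ws'"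
  by (induction ws) (auto simp: W.m_assoc)

lemma refl_word: "x \<in> carrier W \<Longrightarrow> \<exists>\<gamma>s\<in>lists R. x = group_prod W (map (refl_of D) \<gamma>s)"
proof -
  assume "x \<in> carrier W"
  then have "x \<in> generate (BijGroup E) (carrier (BijGroup E) \<inter> refl_of D ` R)"
    by (simp add: aff_weyl_eq carrier_subgroup_generated)
  then show ?thesis
  proof induction
    case one
    show ?case by (rule bexI [of _ "[]"]) (auto simp: aff_weyl_def group_prod_def)
  next
    case (incl h)
    then obtain \<gamma> where "\<gamma> \<in> R" "h = refl_of D \<gamma>" by auto
    then show ?case by (intro bexI [of _ "[\<gamma>]"]) auto
  next
    case (inv h)
    then obtain \<gamma> where \<gamma>: "\<gamma> \<in> R" "h = refl_of D \<gamma>" by auto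
    have "inv\<^bsub>BijGroup E\<^esub> h = inv\<^bsub>W\<^esub> h"
      using refl_carrier [OF \<gamma>(1)] unfolding aff_weyl_eq \<gamma>(2)
      by (subst group.inv_subgroup_generated) (auto simp: group_BijGroup)
    then show ?case using \<gamma> by (intro bexI [of _ "[\<gamma>]"]) (auto simp: inv_refl)
  next
    case (eng h1 h2)
    then obtain \<gamma>s \<delta>s where "\<gamma>s \<in> lists R" "\<delta>s \<in> lists R"
      "h1 = group_prod W (map (refl_of D) \<gamma>s)" "h2 = group_prod W (map (refl_of D) \<delta>s)" by auto
    moreover have "h1 \<otimes>\<^bsub>BijGroup E\<^esub> h2 = h1 \<otimes>\<^bsub>W\<^esub> h2"
      by (simp add: aff_weyl_eq)
    ultimately show ?case
      by (intro bexI [of _ "\<gamma>s @ \<delta>s"]) (auto simp: group_prod_append in_lists_conv_set subset_eq)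
  qed
qed

section \<open>Duality between the affine action and the linear action\<close>

lemma pairing_refl:
  assumes "\<gamma> \<in> R" "f \<in> E"
  shows "pairing (refl_of D \<gamma> f) \<beta> = pairing f (lin_refl D \<gamma> \<beta>)"
proof -
  have "Vector_Spaces.linear (scl D) (*) f" using assms by (simp add: dual_space_def)
  note fsimps = linear_form_simps [OF this]
  show ?thesis
    using assms(2) by (simp add: pairing_def refl_of_def aff_refl_def lin_refl_def aff_scale_def fsimps)
      (simp add: algebra_simps)
qed

lemma lin_refl_refl:
  assumes "\<gamma> \<in> R" shows "lin_refl D \<gamma> (lin_refl D \<gamma> \<beta>) = \<beta>"
proof -
  have "fst \<gamma> \<in> roots D" using assms by (auto simp: aff_roots_def)
  then show ?thesis
    using V.scale_left_distrib [of "coroot D (fst \<gamma>) (fst \<beta>)" "coroot D (fst \<gamma>) (fst \<beta>)" "fst \<gamma>"]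
    by (simp add: lin_refl_def aff_scale_def coroot_simps coroot_self prod_eq_iff algebra_simps)
qed

lemma exists_form:
  assumes "\<not> V.dependent B" shows "\<exists>f\<in>E. \<forall>x\<in>B. f x = g x"
proof -
  interpret Q: vector_space "(*) :: rat \<Rightarrow> rat \<Rightarrow> rat"
    by unfold_locales (simp_all add: algebra_simps)
  interpret VQ: vector_space_pair "scl D" "(*) :: rat \<Rightarrow> rat \<Rightarrow> rat" ..
  from VQ.linear_independent_extend [OF assms, of g] show ?thesis
    by (auto simp: dual_space_def)
qed

lemma pairing_separates:
  assumes "\<And>f. f \<in> E \<Longrightarrow> pairing f \<beta> = pairing f \<beta>'"
  shows "\<beta> = \<beta>'"
proof -
  let ?d = "fst \<beta> - fst \<beta>'"
  have "fst \<beta> = fst \<beta>'"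
  proof (rule ccontr)
    assume "fst \<beta> \<noteq> fst \<beta>'"
    then have "\<not> V.dependent {?d}" by (simp add: V.dependent_single)
    \<comment> \<open>With this value on the difference, the two pairings differ by exactly
      1.\<close>
    from exists_form [OF this, of "\<lambda>_. 1 + snd \<beta>' - snd \<beta>"] obtain f where
      "f \<in> E" "f ?d = 1 + snd \<beta>' - snd \<beta>" by auto
    with assms [of f] show False
      using linear_form_simps [of f] by (auto simp: pairing_def dual_space_def)
  qed
  moreover have "(\<lambda>_. 0) \<in> E" by (auto simp: dual_space_def intro!: linear_formI)
  from assms [OF this] have "snd \<beta> = snd \<beta>'" by (simp add: pairing_def)
  ultimately show ?thesis by (simp add: prod_eq_iff)
qed

abbreviation lin_word where
  "lin_word \<gamma>s \<equiv> foldr (\<lambda>\<gamma> B. lin_refl D \<gamma> \<circ> B) \<gamma>s id"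

lemma pairing_word:
  "\<gamma>s \<in> lists R \<Longrightarrow> f \<in> E \<Longrightarrow> pairing (group_prod W (map (refl_of D) \<gamma>s) f) (lin_word \<gamma>s \<beta>) = pairing f \<beta>"
proof (induction \<gamma>s)
  case Nil
  then show ?case by (simp add: one_eq)
next
  case (Cons \<gamma> \<gamma>s)
  then have "group_prod W (map (refl_of D) \<gamma>s) \<in> carrier W"
    by (intro group_prod_closed) (auto simp: in_lists_conv_set)
  with Cons show ?case by (simp add: mult_app pairing_refl lin_refl_refl)
qed

lemma carrier_surj: "x \<in> carrier W \<Longrightarrow> f \<in> E \<Longrightarrow> \<exists>g\<in>E. x g = f"
proof -
  assume "x \<in> carrier W" "f \<in> E"
  with carrier_Bij have "f \<in> x ` E" by (auto simp: Bij_def bij_betw_def)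
  then show ?thesis by blast
qed

text \<open>The description in \<open>act_def\<close> is unique: the operator of any word for w is
  dual to w under \<open>pairing\<close>, and since w maps onto \<open>E\<close>,
  \<open>pairing_separates\<close> leaves only one such operator.\<close>

lemma act_word:
  assumes \<gamma>s: "\<gamma>s \<in> lists R"
  shows "act D (group_prod W (map (refl_of D) \<gamma>s)) = lin_word \<gamma>s"
  unfolding act_def
proof (rule the_equality)
  let ?w = "\<lambda>\<gamma>s. group_prod W (map (refl_of D) \<gamma>s)"
  show "\<exists>\<gamma>s'\<in>lists R. ?w \<gamma>s = ?w \<gamma>s' \<and> lin_word \<gamma>s = lin_word \<gamma>s'" using \<gamma>s by blast
  fix A assume "\<exists>\<gamma>s'\<in>lists R. ?w \<gamma>s = ?w \<gamma>s' \<and> A = lin_word \<gamma>s'"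
  then obtain \<gamma>s' where \<gamma>s': "\<gamma>s' \<in> lists R" "?w \<gamma>s = ?w \<gamma>s'" "A = lin_word \<gamma>s'" by blast
  have "A \<beta> = lin_word \<gamma>s \<beta>" for \<beta>
  proof (rule pairing_separates)
    fix f assume "f \<in> E"
    moreover have "?w \<gamma>s \<in> carrier W" using \<gamma>s by (intro group_prod_closed) (auto simp: in_lists_conv_set)
    ultimately obtain g where "g \<in> E" "f = ?w \<gamma>s g" using carrier_surj by metis
    then show "pairing f (A \<beta>) = pairing f (lin_word \<gamma>s \<beta>)"
      using pairing_word [OF \<gamma>s, of g \<beta>] pairing_word [OF \<gamma>s'(1), of g \<beta>] \<gamma>s' by simp
  qed
  then show "A = lin_word \<gamma>s" by blast
qed

lemma carrier_induct [consumes 1, case_names one refl]: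
  assumes "x \<in> carrier W" and "P \<one>\<^bsub>W\<^esub>"
    and "\<And>\<gamma> y. \<gamma> \<in> R \<Longrightarrow> y \<in> carrier W \<Longrightarrow> P y \<Longrightarrow> P (refl_of D \<gamma> \<otimes>\<^bsub>W\<^esub> y)"
  shows "P x"
proof -
  obtain \<gamma>s where "\<gamma>s \<in> lists R" "x = group_prod W (map (refl_of D) \<gamma>s)"
    using refl_word assms(1) by blast
  moreover have "\<gamma>s \<in> lists R \<Longrightarrow> P (group_prod W (map (refl_of D) \<gamma>s))" for \<gamma>s
    by (induction \<gamma>s)
      (auto simp: assms in_lists_conv_set subset_eq intro!: assms(3) group_prod_closed)
  ultimately show ?thesis by simp
qed

lemma act_refl: "\<gamma> \<in> R \<Longrightarrow> act D (refl_of D \<gamma>) = lin_refl D \<gamma>"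
  using act_word [of "[\<gamma>]"] by simp

lemma act_one: "act D \<one>\<^bsub>W\<^esub> = id"
  using act_word [of "[]"] by simp

lemma act_mult:
  assumes "x \<in> carrier W" "y \<in> carrier W"
  shows "act D (x \<otimes>\<^bsub>W\<^esub> y) \<beta> = act D x (act D y \<beta>)"
proof -
  obtain \<gamma>s \<delta>s where *: "\<gamma>s \<in> lists R" "x = group_prod W (map (refl_of D) \<gamma>s)"
    "\<delta>s \<in> lists R" "y = group_prod W (map (refl_of D) \<delta>s)"
    using refl_word assms by metis
  then have "act D (x \<otimes>\<^bsub>W\<^esub> y) = lin_word (\<gamma>s @ \<delta>s)"
    by (subst act_word [symmetric]) (auto simp: group_prod_append in_lists_conv_set subset_eq)
  moreover have "lin_word (\<gamma>s @ \<delta>s) = lin_word \<gamma>s \<circ> lin_word \<delta>s"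
    by (induction \<gamma>s) auto
  ultimately show ?thesis using * by (simp add: act_word)
qed

lemma pairing_act: "x \<in> carrier W \<Longrightarrow> f \<in> E \<Longrightarrow> pairing (x f) (act D x \<beta>) = pairing f \<beta>"
  using refl_word act_word pairing_word by metis

lemma act_inv: "x \<in> carrier W \<Longrightarrow> act D x (act D (inv\<^bsub>W\<^esub> x) \<beta>) = \<beta>"
  by (simp add: act_one flip: act_mult)

text \<open>The values of x f are its pairings with the vectors (\<mu>, 0), so the linear action is
  faithful. Identities in the group can therefore be checked on linear operators.\<close>

lemma act_inject:
  assumes "x \<in> carrier W" "y \<in> carrier W" "act D x = act D y"
  shows "x = y"
proof (rule carrier_eqI [OF assms(1,2)])
  fix f assume f: "f \<in> E"
  have p: "pairing (x f) \<beta> = pairing (y f) \<beta>" for \<beta>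
    using pairing_act [OF assms(1) f] pairing_act [OF assms(2) f] act_inv assms by metis
  show "x f = y f"
  proof
    show "x f \<mu> = y f \<mu>" for \<mu> using p [of "(\<mu>, 0)"] by (simp add: pairing_def)
  qed
qed

lemma lin_refl_linear:
  assumes "\<gamma> \<in> R"
  shows "lin_refl D \<gamma> (\<mu> + \<nu>) = lin_refl D \<gamma> \<mu> + lin_refl D \<gamma> \<nu>"
    and "lin_refl D \<gamma> (aff_scale D c \<mu>) = aff_scale D c (lin_refl D \<gamma> \<mu>)"
    and "lin_refl D \<gamma> (- \<mu>) = - lin_refl D \<gamma> \<mu>"
  using assms
  by (auto simp: lin_refl_def aff_scale_def coroot_simps aff_roots_def V.scale_left_distrib
      V.scale_right_diff_distrib prod_eq_iff algebra_simps)

lemma act_add: "x \<in> carrier W \<Longrightarrow> act D x (\<mu> + \<nu>) = act D x \<mu> + act D x \<nu>"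
  and act_scale: "x \<in> carrier W \<Longrightarrow> act D x (aff_scale D c \<mu>) = aff_scale D c (act D x \<mu>)"
  and act_uminus: "x \<in> carrier W \<Longrightarrow> act D x (- \<mu>) = - act D x \<mu>"
  by (induction x rule: carrier_induct; simp add: act_one act_mult act_refl lin_refl_linear)+

lemma lin_refl_roots:
  assumes "\<gamma> \<in> R" "\<beta> \<in> R"
  shows "lin_refl D \<gamma> \<beta> \<in> R"
  using assms refl_roots [of "fst \<gamma>" "fst \<beta>"] coroot_int [of "fst \<gamma>" "fst \<beta>"]
  by (auto simp: aff_roots_def lin_refl_def aff_scale_def)

lemma act_roots [simp, intro]: "x \<in> carrier W \<Longrightarrow> \<beta> \<in> R \<Longrightarrow> act D x \<beta> \<in> R"
  by (induction x rule: carrier_induct; simp add: act_one act_mult act_refl lin_refl_roots)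

lemma R_subset_aff_weights: "\<beta> \<in> R \<Longrightarrow> \<beta> \<in> aff_weights D"
  by (auto simp: aff_roots_def aff_weights_def weight_lattice_def coroot_int)

lemma lin_refl_weights:
  assumes "\<gamma> \<in> R" "\<mu> \<in> aff_weights D"
  shows "lin_refl D \<gamma> \<mu> \<in> aff_weights D"
  using assms coroot_int
  by (auto simp: aff_roots_def aff_weights_def lin_refl_def aff_scale_def weight_lattice_def coroot_simps)

lemma act_weights [simp, intro]: "x \<in> carrier W \<Longrightarrow> \<mu> \<in> aff_weights D \<Longrightarrow> act D x \<mu> \<in> aff_weights D"
  by (induction x rule: carrier_induct; simp add: act_one act_mult act_refl lin_refl_weights)

lemma coroot_lin_refl:
  assumes "\<gamma> \<in> R" "\<beta> \<in> R"
  shows "coroot D (fst (lin_refl D \<gamma> \<beta>)) (fst (lin_refl D \<gamma> \<mu>)) = coroot D (fst \<beta>) (fst \<mu>)"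
  using assms coroot_refl by (auto simp: lin_refl_def aff_scale_def aff_roots_def)

lemma coroot_act: "x \<in> carrier W \<Longrightarrow> \<beta> \<in> R \<Longrightarrow>
    coroot D (fst (act D x \<beta>)) (fst (act D x \<mu>)) = coroot D (fst \<beta>) (fst \<mu>)"
  by (induction x rule: carrier_induct; simp add: act_one act_mult act_refl coroot_lin_refl)

lemma act_lin_refl:
  assumes "x \<in> carrier W" "\<beta> \<in> R"
  shows "act D x (lin_refl D \<beta> \<mu>) = lin_refl D (act D x \<beta>) (act D x \<mu>)"
  using assms
  by (simp add: lin_refl_def act_add act_scale act_uminus coroot_act diff_conv_add_uminus del: add_uminus_conv_diff)

text \<open>The commutation rule behind all exchange arguments; by faithfulness it reduces to
  \<open>act_lin_refl\<close>.\<close>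

lemma refl_conj:
  assumes "x \<in> carrier W" "\<beta> \<in> R"
  shows "refl_of D (act D x \<beta>) \<otimes>\<^bsub>W\<^esub> x = x \<otimes>\<^bsub>W\<^esub> refl_of D \<beta>"
  using assms by (intro act_inject ext) (auto simp: act_mult act_refl act_lin_refl)

lemma lin_refl_self: "\<gamma> \<in> R \<Longrightarrow> lin_refl D \<gamma> \<gamma> = - \<gamma>"
  using V.scale_left_distrib [of 1 1 "fst \<gamma>"]
  by (auto simp: lin_refl_def aff_scale_def aff_roots_def coroot_self prod_eq_iff)

lemma uminus_R: "\<gamma> \<in> R \<Longrightarrow> - \<gamma> \<in> R"
  by (auto simp: aff_roots_def uminus_roots)

lemma refl_of_uminus:
  assumes "\<gamma> \<in> R" shows "refl_of D (- \<gamma>) = refl_of D \<gamma>"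
proof (rule act_inject)
  have "fst \<gamma> \<in> roots D" using assms by (auto simp: aff_roots_def)
  then show "act D (refl_of D (- \<gamma>)) = act D (refl_of D \<gamma>)"
    using assms by (intro ext) (simp add: act_refl uminus_R lin_refl_def aff_scale_def coroot_uminus prod_eq_iff)
qed (simp_all add: assms uminus_R)

section \<open>Positive affine roots\<close>

abbreviation NN where "NN \<equiv> nonneg_comb (scl D) (simple D)"

lemma simple_roots: "\<alpha> \<in> simple D \<Longrightarrow> \<alpha> \<in> roots D"
  and independent_simple: "\<not> V.dependent (simple D)"
  and root_cases: "\<beta> \<in> roots D \<Longrightarrow> \<beta> \<in> NN \<or> - \<beta> \<in> NN"
  using simple_system by (auto simp: simple_system_def)

lemma finite_simple: "finite (simple D)"
  using simple_roots finite_roots by (meson finite_subset subsetI)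

lemma highest_in: "highest D \<in> roots D"
  and highest_diff: "\<beta> \<in> roots D \<Longrightarrow> highest D - \<beta> \<in> NN"
  using highest_root by (auto simp: highest_root_def)

lemma form_sum:
  assumes "f \<in> E" shows "f (\<Sum>\<alpha>\<in>A. scl D (c \<alpha>) \<alpha>) = (\<Sum>\<alpha>\<in>A. c \<alpha> * f \<alpha>)"
proof -
  have "Vector_Spaces.linear (scl D) (*) f" using assms by (simp add: dual_space_def)
  note fsimps = linear_form_simps [OF this]
  show ?thesis by (induction A rule: infinite_finite_induct) (auto simp: fsimps)
qed

lemma form_simps:
  assumes "f \<in> E"
  shows "f (x + y) = f x + f y" "f (x - y) = f x - f y" "f (scl D c x) = c * f x" "f 0 = 0" "f (- x) = - f x"
  using assms linear_form_simps by (auto simp: dual_space_def)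

lemma NN_add: "x \<in> NN \<Longrightarrow> y \<in> NN \<Longrightarrow> x + y \<in> NN"
proof -
  assume "x \<in> NN" "y \<in> NN"
  then obtain c d :: "'v \<Rightarrow> nat" where "x = (\<Sum>\<alpha>\<in>simple D. scl D (of_nat (c \<alpha>)) \<alpha>)"
    "y = (\<Sum>\<alpha>\<in>simple D. scl D (of_nat (d \<alpha>)) \<alpha>)" by (auto simp: nonneg_comb_def)
  then have "x + y = (\<Sum>\<alpha>\<in>simple D. scl D (of_nat (c \<alpha> + d \<alpha>)) \<alpha>)"
    by (simp add: V.scale_left_distrib sum.distrib)
  then show ?thesis unfolding nonneg_comb_def by (intro CollectI exI [of _ "\<lambda>\<alpha>. c \<alpha> + d \<alpha>"]) simp
qed

lemma NN_zero: "0 \<in> NN"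
  unfolding nonneg_comb_def by (intro CollectI exI [of _ "\<lambda>_. 0"]) simp

lemma NN_scale: "x \<in> NN \<Longrightarrow> scl D (of_nat n) x \<in> NN"
  by (induction n) (auto simp: NN_zero V.scale_left_distrib NN_add)

lemma simple_NN: "\<alpha> \<in> simple D \<Longrightarrow> \<alpha> \<in> NN"
proof -
  assume "\<alpha> \<in> simple D"
  then have "\<alpha> = (\<Sum>\<beta>\<in>simple D. if \<beta> = \<alpha> then \<beta> else 0)"
    by (simp add: finite_simple sum.delta)
  also have "\<dots> = (\<Sum>\<beta>\<in>simple D. scl D (of_nat (if \<beta> = \<alpha> then 1 else 0)) \<beta>)"
    by (intro sum.cong) auto
  finally show ?thesis unfolding nonneg_comb_def by (intro CollectI exI [of _ "\<lambda>\<beta>. if \<beta> = \<alpha> then 1 else 0"]) simp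
qed

lemma NN_form:
  assumes "v \<in> NN" "f \<in> E" "\<And>\<alpha>. \<alpha> \<in> simple D \<Longrightarrow> 0 \<le> f \<alpha>"
  shows "0 \<le> f v"
  using assms(1,3) by (auto simp: nonneg_comb_def form_sum [OF assms(2)] intro!: sum_nonneg)

text \<open>The form with value 1 on every simple root computes the sum of the coefficients, which
  vanishes only for the zero combination.\<close>

lemma exists_height: "\<exists>h\<in>E. \<forall>v\<in>NN. 0 \<le> h v \<and> (h v = 0 \<longrightarrow> v = 0)"
proof -
  obtain h where h: "h \<in> E" "\<forall>\<alpha>\<in>simple D. h \<alpha> = 1"
    using exists_form [OF independent_simple, of "\<lambda>_. 1"] by auto
  have "v = 0" if "v \<in> NN" "h v = 0" for v
  proof -
    obtain c :: "'v \<Rightarrow> nat" where c: "v = (\<Sum>\<alpha>\<in>simple D. scl D (of_nat (c \<alpha>)) \<alpha>)"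
      using \<open>v \<in> NN\<close> by (auto simp: nonneg_comb_def)
    have "(\<Sum>\<alpha>\<in>simple D. of_nat (c \<alpha>) :: rat) = 0"
      using that(2) h by (simp add: c form_sum [OF h(1)])
    then have "c \<alpha> = 0" if "\<alpha> \<in> simple D" for \<alpha>
      using that by (simp add: finite_simple sum_nonneg_eq_0_iff)
    then show "v = 0" by (simp add: c)
  qed
  moreover have "0 \<le> h v" if "v \<in> NN" for v using NN_form [OF that h(1)] h(2) by simp
  ultimately show ?thesis using h(1) by blast
qed

lemma NN_antisym: "v \<in> NN \<Longrightarrow> - v \<in> NN \<Longrightarrow> v = 0"
proof -
  obtain h where "h \<in> E" "\<forall>v\<in>NN. 0 \<le> h v \<and> (h v = 0 \<longrightarrow> v = 0)" using exists_height by blast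
  then show "v \<in> NN \<Longrightarrow> - v \<in> NN \<Longrightarrow> v = 0"
    by (metis form_simps(5) neg_0_le_iff_le order_antisym)
qed

lemma root_NN_iff: "\<beta> \<in> roots D \<Longrightarrow> - \<beta> \<in> NN \<longleftrightarrow> \<beta> \<notin> NN"
  using root_cases NN_antisym zero_notin_roots by blast

lemma pos_iff: "\<gamma> \<in> pos \<longleftrightarrow> \<gamma> \<in> R \<and> (snd \<gamma> > 0 \<or> snd \<gamma> = 0 \<and> fst \<gamma> \<in> NN)"
  by (auto simp: aff_pos_roots_def aff_roots_def pos_roots_def split: prod.splits)

lemma pos_R [simp]: "\<gamma> \<in> pos \<Longrightarrow> \<gamma> \<in> R"
  by (simp add: pos_iff)

lemma neg_pos_iff: "\<gamma> \<in> R \<Longrightarrow> - \<gamma> \<in> pos \<longleftrightarrow> \<gamma> \<notin> pos"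
  using root_NN_iff [of "fst \<gamma>"] by (auto simp: pos_iff uminus_R) (auto simp: aff_roots_def)

lemma highest_NN: "highest D \<in> NN"
proof (rule ccontr)
  assume "highest D \<notin> NN"
  then have "- highest D \<in> NN" using root_cases highest_in by blast
  \<comment> \<open>Twice the highest root lies in \<open>NN\<close>; adding its negative gives back
    the highest root.\<close>
  moreover have "highest D - (- highest D) \<in> NN"
    by (intro highest_diff uminus_roots highest_in)
  ultimately have "(highest D - (- highest D)) + - highest D \<in> NN" by (intro NN_add)
  then show False using \<open>highest D \<notin> NN\<close> by simp
qed

lemma simple_subset_R [simp]: "a \<in> aff_simple D \<Longrightarrow> a \<in> R"
  by (auto simp: aff_simple_def aff_roots_def simple_roots uminus_roots highest_in)

lemma simple_pos [simp]: "a \<in> aff_simple D \<Longrightarrow> a \<in> pos"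
  using simple_NN by (auto simp: pos_iff) (auto simp: aff_simple_def)

text \<open>The reflection changes only the coefficient at \<alpha>. If the image were negative, all
  other coefficients of \<beta> would vanish, and reducedness would leave only \<beta> =
  \<alpha>.\<close>

lemma simple_refl_permutes:
  assumes \<alpha>: "\<alpha> \<in> simple D" and \<beta>: "\<beta> \<in> roots D" "\<beta> \<in> NN" "\<beta> \<noteq> \<alpha>"
  shows "\<beta> - scl D (coroot D \<alpha> \<beta>) \<alpha> \<in> NN"
proof (rule ccontr)
  let ?b = "\<beta> - scl D (coroot D \<alpha> \<beta>) \<alpha>"
  assume n: "?b \<notin> NN"
  obtain c :: "'v \<Rightarrow> nat" where c: "\<beta> = (\<Sum>\<alpha>\<in>simple D. scl D (of_nat (c \<alpha>)) \<alpha>)"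
    using \<beta>(2) by (auto simp: nonneg_comb_def)
  have "- ?b \<in> NN" using root_cases refl_roots [OF simple_roots [OF \<alpha>] \<beta>(1)] n by blast
  have "c \<gamma> = 0" if \<gamma>: "\<gamma> \<in> simple D" "\<gamma> \<noteq> \<alpha>" for \<gamma>
  proof -
    obtain f where f: "f \<in> E" "\<forall>x\<in>simple D. f x = (if x = \<gamma> then 1 else 0)"
      using exists_form [OF independent_simple, of "\<lambda>x. if x = \<gamma> then 1 else 0"] by blast
    have "f \<beta> = (\<Sum>x\<in>simple D. if x = \<gamma> then of_nat (c x) else 0)"
      using f by (auto simp: c form_sum [OF f(1)] intro!: sum.cong)
    then have fb: "f \<beta> = of_nat (c \<gamma>)" using \<gamma> finite_simple by (simp add: sum.delta)
    have "0 \<le> f (- ?b)" using NN_form [OF \<open>- ?b \<in> NN\<close> f(1)] f(2) by simp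
    then show ?thesis using f \<alpha> \<gamma> fb by (simp add: form_simps)
  qed
  then have "\<beta> = (\<Sum>x\<in>simple D. if x = \<alpha> then scl D (of_nat (c x)) x else 0)"
    unfolding c by (intro sum.cong) auto
  then have ca: "\<beta> = scl D (of_nat (c \<alpha>)) \<alpha>" using \<alpha> finite_simple by (simp add: sum.delta)
  with \<beta>(1) simple_roots [OF \<alpha>] reduced have "(of_nat (c \<alpha>) :: rat) = 1 \<or> (of_nat (c \<alpha>) :: rat) = - 1"
    unfolding reduced_def by metis
  then have "(of_nat (c \<alpha>) :: rat) = 1"
    using of_nat_0_le_iff [of "c \<alpha>", where ?'a = rat] by auto
  then show False using ca \<beta>(3) by simp
qed

lemma highest_coroot_nonneg:
  assumes "\<beta> \<in> roots D" "\<beta> \<in> NN" shows "0 \<le> coroot D (highest D) \<beta>"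
proof (rule ccontr)
  let ?\<theta> = "highest D"
  assume "\<not> ?thesis"
  moreover obtain m where m: "coroot D ?\<theta> \<beta> = of_int m"
    using coroot_int [OF highest_in assms(1)] by (auto elim: Ints_cases)
  ultimately have "m < 0" by simp
  \<comment> \<open>This k >= 0 is the number with \<theta> - s(\<beta>) = -(\<beta> + k\<theta>),
    where s is the reflection in \<theta>; so a member of \<open>NN\<close> equals the negative of
    another one.\<close>
  define k where "k = nat (- m - 1)"
  have k: "(of_nat k :: rat) = - of_int m - 1" using \<open>m < 0\<close> by (simp add: k_def)
  have "?\<theta> - (\<beta> - scl D (coroot D ?\<theta> \<beta>) ?\<theta>) \<in> NN"
    by (intro highest_diff refl_roots highest_in assms)
  moreover have "?\<theta> - (\<beta> - scl D (coroot D ?\<theta> \<beta>) ?\<theta>) = - (\<beta> + scl D (of_nat k) ?\<theta>)"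
    by (simp add: m k V.scale_left_diff_distrib)
  moreover have *: "\<beta> + scl D (of_nat k) ?\<theta> \<in> NN"
    by (intro NN_add NN_scale assms highest_NN)
  ultimately have "\<beta> + scl D (of_nat k) ?\<theta> = 0" using NN_antisym by metis
  then have "- \<beta> \<in> NN" using NN_scale [OF highest_NN, of k] by (metis minus_unique)
  then show False using root_NN_iff assms by blast
qed

lemma highest_coroot_le:
  assumes "\<beta> \<in> roots D" "\<beta> \<noteq> highest D" shows "coroot D (highest D) \<beta> \<le> 1"
proof (rule ccontr)
  let ?\<theta> = "highest D"
  assume "\<not> ?thesis"
  moreover obtain m where m: "coroot D ?\<theta> \<beta> = of_int m"
    using coroot_int [OF highest_in assms(1)] by (auto elim: Ints_cases)
  ultimately have "m \<ge> 2" by (simp add: not_le)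
  \<comment> \<open>With s the reflection in \<theta>, \<theta> + s(\<beta>) = \<beta> - (m -
    1)\<theta>. Adding k = m - 2 copies of \<theta> leaves -(\<theta> - \<beta>), which thus lies in
    \<open>NN\<close> together with its negative.\<close>
  define k where "k = nat (m - 2)"
  have k: "(of_nat k :: rat) = of_int m - 2" using \<open>m \<ge> 2\<close> by (simp add: k_def)
  have "?\<theta> - (- (\<beta> - scl D (coroot D ?\<theta> \<beta>) ?\<theta>)) \<in> NN"
    by (intro highest_diff uminus_roots refl_roots highest_in assms)
  then have "(?\<theta> - (- (\<beta> - scl D (coroot D ?\<theta> \<beta>) ?\<theta>))) + scl D (of_nat k) ?\<theta> \<in> NN"
    by (intro NN_add NN_scale highest_NN)
  moreover have "(?\<theta> - (- (\<beta> - scl D (coroot D ?\<theta> \<beta>) ?\<theta>))) + scl D (of_nat k) ?\<theta> = - (?\<theta> - \<beta>)"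
    using V.scale_left_distrib [of 1 1 ?\<theta>] by (simp add: m k V.scale_left_diff_distrib)
  ultimately have "?\<theta> - \<beta> = 0" using NN_antisym highest_diff [OF assms(1)] by metis
  then show False using assms by simp
qed

text \<open>For the simple root (-\<theta>, 1) the reflection adds m to the integral part, where m
  is the value of the coroot of \<theta> on \<beta>; the bounds on m leave few cases in which this
  part does not stay positive.\<close>

lemma lin_refl_simple_pos:
  assumes a: "a \<in> aff_simple D" and \<gamma>: "\<gamma> \<in> pos" "\<gamma> \<noteq> a"
  shows "lin_refl D a \<gamma> \<in> pos"
proof -
  have mem: "lin_refl D a \<gamma> \<in> R" using a \<gamma> by (simp add: lin_refl_roots)
  obtain \<beta> n where g: "\<gamma> = (\<beta>, of_int n)" "\<beta> \<in> roots D"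
    using \<gamma>(1) pos_R by (cases \<gamma>) (auto simp: aff_roots_def elim!: Ints_cases)
  show ?thesis
  proof (cases "a = (- highest D, 1)")
    case False
    then obtain \<alpha> where \<alpha>: "a = (\<alpha>, 0)" "\<alpha> \<in> simple D" using a by (auto simp: aff_simple_def)
    show ?thesis using \<gamma> simple_refl_permutes [OF \<alpha>(2) g(2)] mem
      unfolding pos_iff by (auto simp: \<alpha> g lin_refl_def aff_scale_def)
  next
    case True
    let ?\<theta> = "highest D"
    obtain m where m: "coroot D ?\<theta> \<beta> = of_int m"
      using coroot_int [OF highest_in g(2)] by (auto elim: Ints_cases)
    have l: "lin_refl D a \<gamma> = (\<beta> - scl D (of_int m) ?\<theta>, of_int (n + m))"
      by (simp add: True g lin_refl_def aff_scale_def coroot_uminus highest_in m)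
    have n: "n > 0 \<or> n = 0 \<and> \<beta> \<in> NN" using \<gamma>(1) by (auto simp: pos_iff g)
    have neg: "m \<ge> -1" if "\<beta> \<noteq> - ?\<theta>"
    proof -
      have "coroot D ?\<theta> (- \<beta>) \<le> 1" using that g(2) by (intro highest_coroot_le uminus_roots) (auto simp: minus_equation_iff [of \<beta>])
      then show ?thesis using coroot_simps(5) [OF highest_in] m by simp
    qed
    have nonneg: "m \<ge> 0" if "\<beta> \<in> NN" using highest_coroot_nonneg [OF g(2) that] m by simp
    \<comment> \<open>Unless \<beta> = -\<theta>, where m = -2, one has m >= -1, so n + m fails to
      be positive only for small n. For \<beta> = -\<theta> the value n = 1 would mean \<gamma> = a,
      and n = 0 contradicts positivity.\<close>
    consider "n + m > 0" | "n = 0" "m = 0" "\<beta> \<in> NN" | "\<beta> = - ?\<theta>" "n = 2" | "n = 1" "m = -1"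
    proof (cases "\<beta> = - ?\<theta>")
      case True
      then have "m = -2" using m coroot_simps(5) [OF highest_in] coroot_self [OF highest_in]
        by (metis of_int_eq_iff of_int_minus of_int_numeral)
      moreover have "n \<noteq> 1" using \<gamma>(2) \<open>a = _\<close> g True by simp
      moreover have "n \<noteq> 0" using n True root_NN_iff highest_NN highest_in uminus_roots by blast
      ultimately show ?thesis using n that True by fastforce
    next
      case False
      show ?thesis
      proof (cases "n = 0")
        case True
        then show ?thesis using n nonneg that by (metis add_0 order_le_less less_irrefl)
      next
        assume "n \<noteq> 0"
        then show ?thesis using n neg [OF False] that(1,4) by fastforce
      qed
    qed
    then show ?thesis
    proof cases
      case 3
      then have "m = -2" using m coroot_simps(5) [OF highest_in] coroot_self [OF highest_in]
        by (metis of_int_eq_iff of_int_minus of_int_numeral)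
      then have "lin_refl D a \<gamma> = (?\<theta>, 0)"
        using 3 l V.scale_left_distrib [of 1 1 ?\<theta>] by simp
      then show ?thesis using highest_NN highest_in by (simp add: pos_iff aff_roots_def)
    next
      case 4
      have "?\<theta> - - \<beta> \<in> NN" by (intro highest_diff uminus_roots g)
      then show ?thesis using mem 4 l by (simp add: pos_iff add.commute)
    qed (use mem l in \<open>auto simp: pos_iff\<close>)
  qed
qed

section \<open>Simple reflections\<close>

lemma S_cases: "a \<in> S \<Longrightarrow> \<exists>\<alpha>\<in>aff_simple D. a = refl_of D \<alpha>"
  by (auto simp: simple_refls_def)

lemma S_carrier [simp]: "a \<in> S \<Longrightarrow> a \<in> carrier W"
  using S_cases by fastforce

lemma S_lists_carrier [simp]: "ws \<in> lists S \<Longrightarrow> set ws \<subseteq> carrier W"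
  by auto

lemma S_invol: "a \<in> S \<Longrightarrow> a \<otimes>\<^bsub>W\<^esub> a = \<one>\<^bsub>W\<^esub>"
  using S_cases refl_refl by fastforce

text \<open>If the reflections agree, \<alpha> is sent to -\<alpha>, but a simple root different
  from \<beta> is sent to a positive root. Hence \<open>root_of\<close> recovers a simple root from
  its reflection.\<close>

lemma refl_of_inj_simple:
  assumes "\<alpha> \<in> aff_simple D" "\<beta> \<in> aff_simple D" "refl_of D \<alpha> = refl_of D \<beta>"
  shows "\<alpha> = \<beta>"
proof (rule ccontr)
  assume "\<alpha> \<noteq> \<beta>"
  then have "lin_refl D \<beta> \<alpha> \<in> pos" using assms by (intro lin_refl_simple_pos) auto
  moreover have "lin_refl D \<beta> \<alpha> = - \<alpha>"
    using assms act_refl lin_refl_self by (metis simple_subset_R)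
  ultimately show False using neg_pos_iff [of \<alpha>] assms by simp
qed

lemma root_of_refl: "\<alpha> \<in> aff_simple D \<Longrightarrow> root_of D (refl_of D \<alpha>) = \<alpha>"
  unfolding root_of_def by (rule the_equality) (auto dest: refl_of_inj_simple)

lemma root_of_simple [simp]: "a \<in> S \<Longrightarrow> root_of D a \<in> aff_simple D"
  and refl_root_of [simp]: "a \<in> S \<Longrightarrow> refl_of D (root_of D a) = a"
  using S_cases root_of_refl by fastforce+

lemma act_S: "a \<in> S \<Longrightarrow> act D a = lin_refl D (root_of D a)"
  using act_refl refl_root_of root_of_simple simple_subset_R by metis

lemma group_prod_rev:
  "ws \<in> lists S \<Longrightarrow> group_prod W (rev ws) = inv\<^bsub>W\<^esub> (group_prod W ws)"
proof (induction ws)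
  case (Cons a ws)
  then have "inv\<^bsub>W\<^esub> a = a" by (simp add: W.inv_equality S_invol)
  with Cons show ?case
    by (subst rev.simps, subst group_prod_append) (auto simp: W.inv_mult_group subset_eq)
qed simp

lemma inv_simple_mult:
  assumes "a \<in> S" "y \<in> carrier W"
  shows "act D (inv\<^bsub>W\<^esub> (a \<otimes>\<^bsub>W\<^esub> y)) \<beta> = act D (inv\<^bsub>W\<^esub> y) (lin_refl D (root_of D a) \<beta>)"
proof -
  have "inv\<^bsub>W\<^esub> a = a" using assms by (simp add: W.inv_equality S_invol)
  then show ?thesis using assms by (simp add: W.inv_mult_group act_mult act_S)
qed

text \<open>Every point can be moved into the closed fundamental alcove: while some simple root is
  negative at q, reflecting in it lowers the number of positive roots that are negative at
  q.\<close>

lemma exists_dominant: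
  assumes "q \<in> E"
  shows "\<exists>ws\<in>lists S. \<forall>a\<in>aff_simple D. 0 \<le> pairing ((inv\<^bsub>W\<^esub> (group_prod W ws)) q) a"
  using assms
proof (induction "card {\<delta>\<in>pos. pairing q \<delta> < 0}" arbitrary: q rule: less_induct)
  case less
  show ?case
  proof (cases "\<forall>a\<in>aff_simple D. 0 \<le> pairing q a")
    case True
    moreover have "\<one>\<^bsub>W\<^esub> q = q" using less.prems by (simp add: one_eq)
    ultimately show ?thesis by (intro bexI [of _ "[]"]) auto
  next
    case False
    then obtain a where a: "a \<in> aff_simple D" "pairing q a < 0" by auto
    let ?s = "refl_of D a" and ?N = "\<lambda>q. {\<delta>\<in>pos. pairing q \<delta> < 0}"
    \<comment> \<open>For each of the finitely many \<beta> the integral part is bounded below by 0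
      and above in terms of -q(\<beta>).\<close>
    have fin: "finite (?N q)"
    proof (rule finite_subset)
      show "?N q \<subseteq> (\<Union>\<beta>\<in>roots D. {\<beta>} \<times> of_int ` {0..\<lceil>- q \<beta>\<rceil>})"
      proof
        fix \<delta> assume d: "\<delta> \<in> ?N q"
        then obtain \<beta> n where \<delta>: "\<delta> = (\<beta>, of_int n)" "\<beta> \<in> roots D"
          using pos_R by (cases \<delta>) (auto simp: aff_roots_def elim!: Ints_cases)
        have "0 \<le> n" using d by (auto simp: pos_iff \<delta>)
        moreover have "n \<le> \<lceil>- q \<beta>\<rceil>" using d unfolding \<delta> pairing_def by simp linarith
        ultimately show "\<delta> \<in> (\<Union>\<beta>\<in>roots D. {\<beta>} \<times> of_int ` {0..\<lceil>- q \<beta>\<rceil>})" using \<delta> by auto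
      qed
    qed (use finite_roots in auto)
    have p: "pairing (?s q) \<delta> = pairing q (lin_refl D a \<delta>)" for \<delta>
      using a less.prems by (simp add: pairing_refl)
    have neg: "pairing q (- a) = - pairing q a" using less.prems by (simp add: pairing_def form_simps)
    \<comment> \<open>The root a has a positive value at the reflected point and is not counted
      there; all roots counted there go to positive roots that are negative at q and different from
      a.\<close>
    have "lin_refl D a ` ?N (?s q) \<subseteq> ?N q - {a}"
    proof
      fix \<epsilon> assume "\<epsilon> \<in> lin_refl D a ` ?N (?s q)"
      then obtain \<delta> where \<delta>: "\<delta> \<in> pos" "pairing q \<epsilon> < 0" "\<epsilon> = lin_refl D a \<delta>" by (auto simp: p)
      have "\<delta> \<noteq> a" using \<delta>(2,3) a neg by (auto simp: lin_refl_self)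
      then have "\<epsilon> \<in> pos" using lin_refl_simple_pos [OF a(1) \<delta>(1)] \<delta>(3) by simp
      moreover have "\<epsilon> \<noteq> a"
        using \<delta>(1,3) a lin_refl_refl [of a \<delta>] neg_pos_iff [of a] by (auto simp: lin_refl_self)
      ultimately show "\<epsilon> \<in> ?N q - {a}" using \<delta> by simp
    qed
    then have "lin_refl D a ` ?N (?s q) \<subset> ?N q" using a simple_pos [OF a(1)] by blast
    then have "card (lin_refl D a ` ?N (?s q)) < card (?N q)" using fin psubset_card_mono by blast
    moreover have "inj_on (lin_refl D a) (?N (?s q))"
      using a by (intro inj_on_inverseI [of _ "lin_refl D a"]) (simp add: lin_refl_refl)
    ultimately have "card (?N (?s q)) < card (?N q)" by (simp add: card_image)
    then obtain ws where ws: "ws \<in> lists S"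
      "\<forall>a\<in>aff_simple D. 0 \<le> pairing ((inv\<^bsub>W\<^esub> (group_prod W ws)) (?s q)) a"
      using less.hyps [of "?s q"] less.prems a by auto
    have sS: "?s \<in> S" using a by (auto simp: simple_refls_def)
    have "(inv\<^bsub>W\<^esub> (group_prod W (?s # ws))) q = (inv\<^bsub>W\<^esub> (group_prod W ws)) (?s q)"
      using ws(1) a less.prems sS by (simp add: W.inv_mult_group mult_app inv_refl)
    then show ?thesis using ws sS by (intro bexI [of _ "?s # ws"]) auto
  qed
qed

text \<open>For integral part at least 1 it suffices that q(\<beta>) >= -1. This holds because
  \<beta> is bounded below by -\<theta>, and nonnegativity of (-\<theta>, 1) says q(\<theta>) <=
  1.\<close>

lemma dominant_pos:
  assumes "q \<in> E" "\<forall>a\<in>aff_simple D. 0 \<le> pairing q a" "\<delta> \<in> pos"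
  shows "0 \<le> pairing q \<delta>"
proof -
  have simple: "0 \<le> q \<alpha>" if "\<alpha> \<in> simple D" for \<alpha>
    using assms(2) that by (force simp: aff_simple_def pairing_def)
  have th: "q (highest D) \<le> 1"
    using assms(1,2) by (auto simp: aff_simple_def pairing_def form_simps)
  obtain \<beta> n where \<delta>: "\<delta> = (\<beta>, of_int n)" "\<beta> \<in> roots D"
    using pos_R [OF assms(3)] by (cases \<delta>) (auto simp: aff_roots_def elim!: Ints_cases)
  show ?thesis
  proof (cases "n > 0")
    case False
    then show ?thesis using assms \<delta> NN_form [OF _ assms(1) simple] by (auto simp: pos_iff pairing_def)
  next
    case True
    have "0 \<le> q (highest D - - \<beta>)"
      by (rule NN_form [OF highest_diff [OF uminus_roots [OF \<delta>(2)]] assms(1) simple])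
    then have "q \<beta> \<ge> -1" using th assms(1) by (simp add: form_simps)
    moreover have "(of_int n :: rat) \<ge> 1" using True by simp
    ultimately show ?thesis by (simp add: \<delta> pairing_def)
  qed
qed

lemma exists_generic: "\<exists>p\<in>E. \<forall>\<delta>\<in>pos. 0 < pairing p \<delta>"
proof -
  obtain h where h: "h \<in> E" "\<And>v. v \<in> NN \<Longrightarrow> 0 \<le> h v" "\<And>v. v \<in> NN \<Longrightarrow> h v = 0 \<Longrightarrow> v = 0"
    using exists_height by blast
  \<comment> \<open>Dividing the height by more than its value at \<theta> brings its values on all
    roots strictly between -1 and 1, which gives a point in the interior of the fundamental
    alcove.\<close>
  let ?c = "h (highest D) + 1"
  have c: "?c > 0" using h(2) [OF highest_NN] by simp
  let ?p = "\<lambda>v. h v / ?c"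
  have "?p \<in> E" using form_simps [OF h(1)]
    by (auto simp: dual_space_def add_divide_distrib intro!: linear_formI)
  moreover have "0 < pairing ?p \<delta>" if d: "\<delta> \<in> pos" for \<delta>
  proof -
    obtain \<beta> n where \<delta>: "\<delta> = (\<beta>, of_int n)" "\<beta> \<in> roots D"
      using pos_R [OF d] by (cases \<delta>) (auto simp: aff_roots_def elim!: Ints_cases)
    show ?thesis
    proof (cases "n > 0")
      case False
      then have "n = 0" "\<beta> \<in> NN" using that by (auto simp: pos_iff \<delta>)
      moreover have "h \<beta> \<noteq> 0" using h(3) \<open>\<beta> \<in> NN\<close> \<delta>(2) zero_notin_roots by blast
      ultimately show ?thesis using h(2) [of \<beta>] c by (simp add: pairing_def \<delta>)
    next
      case True
      have "0 \<le> h (highest D - - \<beta>)" by (intro h highest_diff uminus_roots \<delta>)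
      then have "h \<beta> > - ?c" using h(1) by (simp add: form_simps)
      then have "?p \<beta> > -1" using c by (simp add: field_simps)
      moreover have "(of_int n :: rat) \<ge> 1" using True by simp
      ultimately show ?thesis by (simp add: \<delta> pairing_def)
    qed
  qed
  ultimately show ?thesis by blast
qed

text \<open>For \<open>p\<close> in the fundamental alcove, \<open>\<gamma>\<close> is negative at \<open>s\<^sub>\<gamma>p\<close>. An element moving \<open>s\<^sub>\<gamma>p\<close>
  back to the closed alcove, where positive roots are nonnegative, makes \<open>\<gamma>\<close> negative.\<close>

lemma exists_negative_word:
  assumes "\<gamma> \<in> pos"
  shows "\<exists>ws\<in>lists S. act D (inv\<^bsub>W\<^esub> (group_prod W ws)) \<gamma> \<notin> pos"
proof -
  obtain p where p: "p \<in> E" "\<And>\<delta>. \<delta> \<in> pos \<Longrightarrow> 0 < pairing p \<delta>" using exists_generic by blast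
  let ?q = "refl_of D \<gamma> p"
  have q: "?q \<in> E" using assms p by simp
  then obtain ws where ws: "ws \<in> lists S"
    "\<forall>a\<in>aff_simple D. 0 \<le> pairing ((inv\<^bsub>W\<^esub> (group_prod W ws)) ?q) a" using exists_dominant by blast
  let ?w = "inv\<^bsub>W\<^esub> (group_prod W ws)"
  have w: "?w \<in> carrier W" using ws by simp
  have "pairing (?w ?q) (act D ?w \<gamma>) = pairing p (- \<gamma>)"
    using w q p assms by (simp add: pairing_act pairing_refl lin_refl_self)
  also have "\<dots> = - pairing p \<gamma>" using p(1) by (simp add: pairing_def form_simps)
  also have "\<dots> < 0" using p(2) [OF assms] by simp
  finally have "act D ?w \<gamma> \<notin> pos" using dominant_pos [OF _ ws(2), of "act D ?w \<gamma>"] w q by auto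
  then show ?thesis using ws by blast
qed

text \<open>As the letters act one after another, the root can turn negative only at a letter whose
  simple root it has become. The letters before it conjugate that simple reflection into the
  reflection in \<gamma>.\<close>

lemma negative_word_conj:
  assumes "ws \<in> lists S" "\<gamma> \<in> pos" "act D (inv\<^bsub>W\<^esub> (group_prod W ws)) \<gamma> \<notin> pos"
  shows "\<exists>us\<in>lists S. \<exists>a\<in>S. refl_of D \<gamma> = group_prod W us \<otimes>\<^bsub>W\<^esub> a \<otimes>\<^bsub>W\<^esub> inv\<^bsub>W\<^esub> (group_prod W us)"
  using assms
proof (induction ws arbitrary: \<gamma> rule: list.induct)
  case Nil
  then show ?case by (simp add: act_one)
next
  case (Cons a ws)
  let ?\<alpha> = "root_of D a"
  show ?case
  proof (cases "\<gamma> = ?\<alpha>")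
    case True
    moreover have "a \<in> S" using Cons.prems by simp
    ultimately show ?thesis by (intro bexI [of _ "[]"] bexI [of _ a]) auto
  next
    case False
    let ?\<delta> = "lin_refl D ?\<alpha> \<gamma>"
    have \<delta>: "?\<delta> \<in> pos" using Cons.prems False by (intro lin_refl_simple_pos) auto
    moreover have "act D (inv\<^bsub>W\<^esub> (group_prod W ws)) ?\<delta> \<notin> pos"
      using Cons.prems by (simp add: inv_simple_mult)
    ultimately obtain us b where us: "us \<in> lists S" "b \<in> S"
      "refl_of D ?\<delta> = group_prod W us \<otimes>\<^bsub>W\<^esub> b \<otimes>\<^bsub>W\<^esub> inv\<^bsub>W\<^esub> (group_prod W us)"
      using Cons.IH [of ?\<delta>] Cons.prems(1) by (auto simp del: split_paired_All)
    have a: "a \<in> S" using Cons.prems by simp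
    have u: "group_prod W us \<in> carrier W" using us by simp
    have ia: "inv\<^bsub>W\<^esub> a = a" using a by (simp add: W.inv_equality S_invol)
    have "refl_of D (act D a ?\<delta>) \<otimes>\<^bsub>W\<^esub> a = a \<otimes>\<^bsub>W\<^esub> refl_of D ?\<delta>"
      using a \<delta> by (intro refl_conj) auto
    moreover have "act D a ?\<delta> = \<gamma>" using a by (simp add: act_S lin_refl_refl)
    ultimately have "refl_of D \<gamma> = a \<otimes>\<^bsub>W\<^esub> refl_of D ?\<delta> \<otimes>\<^bsub>W\<^esub> a"
      using a \<delta> Cons.prems(2) by (metis W.inv_solve_right' W.m_closed ia S_carrier pos_R refl_carrier)
    also have "\<dots> = group_prod W (a # us) \<otimes>\<^bsub>W\<^esub> b \<otimes>\<^bsub>W\<^esub> inv\<^bsub>W\<^esub> (group_prod W (a # us))"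
      using a u us by (simp add: W.inv_mult_group ia W.m_assoc)
    finally show ?thesis using us a by (intro bexI [of _ "a # us"] bexI [of _ b]) auto
  qed
qed

lemma refl_conj_simple:
  assumes "\<gamma> \<in> R"
  shows "\<exists>us\<in>lists S. \<exists>a\<in>S. refl_of D \<gamma> = group_prod W us \<otimes>\<^bsub>W\<^esub> a \<otimes>\<^bsub>W\<^esub> inv\<^bsub>W\<^esub> (group_prod W us)"
proof (cases "\<gamma> \<in> pos")
  case True
  then show ?thesis using exists_negative_word negative_word_conj by metis
next
  case False
  then have "- \<gamma> \<in> pos" using assms neg_pos_iff by blast
  then show ?thesis using exists_negative_word negative_word_conj refl_of_uminus [OF assms] by metis
qed

lemma refl_cox_reflection:
  assumes "\<gamma> \<in> R" shows "refl_of D \<gamma> \<in> cox_reflections W S"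
proof -
  obtain us a where us: "us \<in> lists S" "a \<in> S"
    "refl_of D \<gamma> = group_prod W us \<otimes>\<^bsub>W\<^esub> a \<otimes>\<^bsub>W\<^esub> inv\<^bsub>W\<^esub> (group_prod W us)"
    using refl_conj_simple [OF assms] by blast
  moreover have "group_prod W us \<in> carrier W" using us by simp
  ultimately show ?thesis unfolding cox_reflections_def by blast
qed

text \<open>The group is generated by all affine reflections, and each of these is a palindromic
  word in simple ones.\<close>

lemma simple_word: "x \<in> carrier W \<Longrightarrow> \<exists>ws\<in>lists S. group_prod W ws = x"
proof (induction x rule: carrier_induct)
  case one
  show ?case by (rule bexI [of _ "[]"]) auto
next
  case (refl \<gamma> y)
  then obtain ws where ws: "ws \<in> lists S" "group_prod W ws = y" by blast
  obtain us a where us: "us \<in> lists S" "a \<in> S"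
    "refl_of D \<gamma> = group_prod W us \<otimes>\<^bsub>W\<^esub> a \<otimes>\<^bsub>W\<^esub> inv\<^bsub>W\<^esub> (group_prod W us)"
    using refl_conj_simple refl.hyps by blast
  have "group_prod W (us @ [a] @ rev us @ ws) = refl_of D \<gamma> \<otimes>\<^bsub>W\<^esub> y"
  proof -
    have c: "set us \<subseteq> carrier W" "set (rev us) \<subseteq> carrier W" "set ws \<subseteq> carrier W" "a \<in> carrier W"
      "group_prod W us \<in> carrier W" "y \<in> carrier W"
      using us ws refl.hyps by auto
    then have "group_prod W (us @ [a] @ rev us @ ws) = group_prod W us \<otimes>\<^bsub>W\<^esub> (a \<otimes>\<^bsub>W\<^esub> (inv\<^bsub>W\<^esub> (group_prod W us) \<otimes>\<^bsub>W\<^esub> y))"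
      using us ws by (simp add: group_prod_append group_prod_rev)
    then show ?thesis using c by (simp add: us(3) W.m_assoc)
  qed
  then show ?case using us ws by (intro bexI [of _ "us @ [a] @ rev us @ ws"]) auto
qed

section \<open>Length and Bruhat order\<close>

abbreviation len where "len \<equiv> cox_length W S"

lemma len_le: "ws \<in> lists S \<Longrightarrow> len (group_prod W ws) \<le> length ws"
  unfolding cox_length_def by (rule Least_le) auto

lemma reduced_word: "x \<in> carrier W \<Longrightarrow> \<exists>ws\<in>lists S. length ws = len x \<and> group_prod W ws = x"
proof -
  assume "x \<in> carrier W"
  then obtain ws where "ws \<in> lists S" "group_prod W ws = x" using simple_word by blast
  then show ?thesis unfolding cox_length_def
    by (intro LeastI [of "\<lambda>n. \<exists>ws\<in>lists S. length ws = n \<and> group_prod W ws = x" "length ws"]) auto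
qed

lemma refl_simple_mult:
  assumes "a \<in> S" "\<beta> \<in> R" "y \<in> carrier W"
  shows "refl_of D \<beta> \<otimes>\<^bsub>W\<^esub> (a \<otimes>\<^bsub>W\<^esub> y) = a \<otimes>\<^bsub>W\<^esub> (refl_of D (lin_refl D (root_of D a) \<beta>) \<otimes>\<^bsub>W\<^esub> y)"
proof -
  let ?\<delta> = "lin_refl D (root_of D a) \<beta>"
  have \<delta>: "?\<delta> \<in> R" using assms by (simp add: lin_refl_roots)
  then have "refl_of D (act D a ?\<delta>) \<otimes>\<^bsub>W\<^esub> a = a \<otimes>\<^bsub>W\<^esub> refl_of D ?\<delta>"
    using assms by (intro refl_conj) auto
  then show ?thesis using assms \<delta> by (simp add: act_S lin_refl_refl flip: W.m_assoc)
qed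

lemma simple_root_mult:
  assumes "a \<in> S" "y \<in> carrier W"
  shows "refl_of D (root_of D a) \<otimes>\<^bsub>W\<^esub> (a \<otimes>\<^bsub>W\<^esub> y) = y"
  using assms by (simp add: S_invol flip: W.m_assoc)

text \<open>The reflection is moved through the word, each letter transforming its root. Where the
  root has become the simple root of the next letter, the reflection cancels that letter.\<close>

lemma exchange:
  assumes "ws \<in> lists S" "\<beta> \<in> pos" "act D (inv\<^bsub>W\<^esub> (group_prod W ws)) \<beta> \<notin> pos"
  shows "\<exists>ws'\<in>lists S. length ws' < length ws \<and> group_prod W ws' = refl_of D \<beta> \<otimes>\<^bsub>W\<^esub> group_prod W ws"
  using assms
proof (induction ws arbitrary: \<beta> rule: list.induct)
  case Nil
  then show ?case by (simp add: act_one)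
next
  case (Cons a ws)
  let ?\<alpha> = "root_of D a"
  have a: "a \<in> S" "ws \<in> lists S" using Cons.prems by auto
  show ?case
  proof (cases "\<beta> = ?\<alpha>")
    case True
    then show ?thesis using a simple_root_mult by (intro bexI [of _ ws]) auto
  next
    case False
    let ?\<delta> = "lin_refl D ?\<alpha> \<beta>"
    have \<delta>: "?\<delta> \<in> pos" using Cons.prems False by (intro lin_refl_simple_pos) auto
    moreover have "act D (inv\<^bsub>W\<^esub> (group_prod W ws)) ?\<delta> \<notin> pos"
      using Cons.prems by (simp add: inv_simple_mult)
    ultimately obtain ws' where ws': "ws' \<in> lists S" "length ws' < length ws"
      "group_prod W ws' = refl_of D ?\<delta> \<otimes>\<^bsub>W\<^esub> group_prod W ws"
      using Cons.IH a by blast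
    then show ?thesis using a Cons.prems(2) refl_simple_mult
      by (intro bexI [of _ "a # ws'"]) auto
  qed
qed

lemma len_refl_less:
  assumes "\<beta> \<in> pos" "w \<in> carrier W" "act D (inv\<^bsub>W\<^esub> w) \<beta> \<notin> pos"
  shows "len (refl_of D \<beta> \<otimes>\<^bsub>W\<^esub> w) < len w"
proof -
  obtain ws where "ws \<in> lists S" "length ws = len w" "group_prod W ws = w"
    using reduced_word assms by blast
  with exchange [of ws \<beta>] assms obtain ws' where "ws' \<in> lists S" "length ws' < len w"
    "group_prod W ws' = refl_of D \<beta> \<otimes>\<^bsub>W\<^esub> w" by auto
  then show ?thesis using len_le by (metis le_less_trans)
qed

lemma refl_mult_cancel: "\<beta> \<in> R \<Longrightarrow> w \<in> carrier W \<Longrightarrow> refl_of D \<beta> \<otimes>\<^bsub>W\<^esub> (refl_of D \<beta> \<otimes>\<^bsub>W\<^esub> w) = w"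
  by (simp add: refl_refl flip: W.m_assoc)

text \<open>The inverse of the reflected element sends \<beta> to the opposite root, so
  \<open>len_refl_less\<close> applies to that element.\<close>

lemma len_refl_greater:
  assumes "\<beta> \<in> pos" "w \<in> carrier W" "act D (inv\<^bsub>W\<^esub> w) \<beta> \<in> pos"
  shows "len w < len (refl_of D \<beta> \<otimes>\<^bsub>W\<^esub> w)"
proof -
  let ?w = "refl_of D \<beta> \<otimes>\<^bsub>W\<^esub> w"
  have "act D (inv\<^bsub>W\<^esub> ?w) \<beta> = - act D (inv\<^bsub>W\<^esub> w) \<beta>"
    using assms by (simp add: W.inv_mult_group act_mult inv_refl act_refl lin_refl_self act_uminus)
  then have "act D (inv\<^bsub>W\<^esub> ?w) \<beta> \<notin> pos"
    using assms neg_pos_iff by simp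
  then have "len (refl_of D \<beta> \<otimes>\<^bsub>W\<^esub> ?w) < len ?w" using assms by (intro len_refl_less) auto
  then show ?thesis using assms by (simp add: refl_mult_cancel)
qed

lemma len_less_iff: "\<beta> \<in> pos \<Longrightarrow> w \<in> carrier W \<Longrightarrow>
    len (refl_of D \<beta> \<otimes>\<^bsub>W\<^esub> w) < len w \<longleftrightarrow> act D (inv\<^bsub>W\<^esub> w) \<beta> \<notin> pos"
  using len_refl_less len_refl_greater by (meson less_asym)

lemma pos_representative: "\<beta> \<in> R \<Longrightarrow> \<exists>\<beta>'\<in>pos. (\<beta>' = \<beta> \<or> \<beta>' = - \<beta>) \<and> refl_of D \<beta>' = refl_of D \<beta>"
  using neg_pos_iff refl_of_uminus by metis

lemma len_refl_neq:
  assumes "\<beta> \<in> R" "w \<in> carrier W"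
  shows "len (refl_of D \<beta> \<otimes>\<^bsub>W\<^esub> w) \<noteq> len w"
  using pos_representative [OF assms(1)] len_refl_less len_refl_greater assms(2) by (metis less_irrefl)

text \<open>The inequality at y says that the inverse of y keeps the positive one of \<beta>,
  -\<beta> positive. A simple reflection preserves this positivity unless the resulting root is that
  of a, and then the left reflection would be right multiplication by a, contrary to
  \<open>neq\<close>.\<close>

lemma len_lift:
  assumes "\<beta> \<in> R" "y \<in> carrier W" "a \<in> S"
    and less: "len y < len (refl_of D \<beta> \<otimes>\<^bsub>W\<^esub> y)"
    and neq: "refl_of D \<beta> \<otimes>\<^bsub>W\<^esub> y \<noteq> y \<otimes>\<^bsub>W\<^esub> a"
  shows "len (y \<otimes>\<^bsub>W\<^esub> a) < len (refl_of D \<beta> \<otimes>\<^bsub>W\<^esub> (y \<otimes>\<^bsub>W\<^esub> a))"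
proof -
  obtain \<beta>' where \<beta>': "\<beta>' \<in> pos" "refl_of D \<beta>' = refl_of D \<beta>" using pos_representative assms by blast
  have pos: "act D (inv\<^bsub>W\<^esub> y) \<beta>' \<in> pos"
    using len_less_iff [OF \<beta>'(1) assms(2)] less \<beta>' by (metis less_asym)
  have "act D (inv\<^bsub>W\<^esub> y) \<beta>' \<noteq> root_of D a"
  proof
    assume "act D (inv\<^bsub>W\<^esub> y) \<beta>' = root_of D a"
    then have "act D y (root_of D a) = \<beta>'" using assms act_inv by metis
    then have "refl_of D \<beta> \<otimes>\<^bsub>W\<^esub> y = y \<otimes>\<^bsub>W\<^esub> a"
      using refl_conj [OF assms(2), of "root_of D a"] \<beta>' assms(3) by simp
    then show False using neq by simp
  qed
  with pos have "lin_refl D (root_of D a) (act D (inv\<^bsub>W\<^esub> y) \<beta>') \<in> pos"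
    using assms(3) by (intro lin_refl_simple_pos) auto
  moreover have "inv\<^bsub>W\<^esub> a = a" using assms by (simp add: W.inv_equality S_invol)
  ultimately have "act D (inv\<^bsub>W\<^esub> (y \<otimes>\<^bsub>W\<^esub> a)) \<beta>' \<in> pos"
    using assms by (simp add: W.inv_mult_group act_mult act_S)
  then show ?thesis using len_refl_greater [OF \<beta>'(1)] assms \<beta>'(2) by simp
qed

lemma bruhat_le_len: "bruhat_le W S x y \<Longrightarrow> x = y \<or> len x < len y"
  unfolding bruhat_le_def
  by (induction rule: rtranclp_induct) (auto simp: bruhat_step_def)

text \<open>From here on the Bruhat order enters only through lengths, since it is only used to
  compare elements that differ by an affine reflection.\<close>

lemma aff_less_iff:
  assumes "x \<in> carrier W" "\<beta> \<in> R"
  shows "aff_less D x (refl_of D \<beta> \<otimes>\<^bsub>W\<^esub> x) \<longleftrightarrow> len x < len (refl_of D \<beta> \<otimes>\<^bsub>W\<^esub> x)"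
proof
  assume "aff_less D x (refl_of D \<beta> \<otimes>\<^bsub>W\<^esub> x)"
  then show "len x < len (refl_of D \<beta> \<otimes>\<^bsub>W\<^esub> x)"
    using bruhat_le_len by (auto simp: aff_less_def bruhat_less_def)
next
  assume *: "len x < len (refl_of D \<beta> \<otimes>\<^bsub>W\<^esub> x)"
  then have "bruhat_step W S x (refl_of D \<beta> \<otimes>\<^bsub>W\<^esub> x)"
    using assms refl_cox_reflection [OF assms(2)] by (auto simp: bruhat_step_def)
  then show "aff_less D x (refl_of D \<beta> \<otimes>\<^bsub>W\<^esub> x)"
    using * by (auto simp: aff_less_def bruhat_less_def bruhat_le_def)
qed

lemma mult_simple_eq:
  assumes "x \<in> carrier W" "a \<in> S"
  shows "x \<otimes>\<^bsub>W\<^esub> a = refl_of D (act D x (root_of D a)) \<otimes>\<^bsub>W\<^esub> x"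
  using refl_conj [OF assms(1), of "root_of D a"] assms by simp

section \<open>Subsequences\<close>

lemma ev_Nil [simp]: "ev D [] = \<one>\<^bsub>W\<^esub>"
  and ev_None [simp]: "ev D (None # \<sigma>) = ev D \<sigma>"
  and ev_Some [simp]: "ev D (Some a # \<sigma>) = a \<otimes>\<^bsub>W\<^esub> ev D \<sigma>"
  by (simp_all add: ev_def)

lemma subseqs_of_Nil [simp]: "subseqs_of [] = {[]}"
  by (auto simp: subseqs_of_def)

lemma subseqs_of_Cons: "\<sigma> \<in> subseqs_of (a # s) \<longleftrightarrow>
    (\<exists>\<tau>\<in>subseqs_of s. \<sigma> = None # \<tau> \<or> \<sigma> = Some a # \<tau>)"
  by (auto simp: subseqs_of_def list_all2_Cons2)

lemma subseqs_of_snoc: "\<sigma> \<in> subseqs_of (s @ [a]) \<longleftrightarrow>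
    (\<exists>\<tau>\<in>subseqs_of s. \<sigma> = \<tau> @ [None] \<or> \<sigma> = \<tau> @ [Some a])"
  by (auto simp: subseqs_of_def list_all2_snoc2)

lemma ev_closed [simp]: "s \<in> lists S \<Longrightarrow> \<sigma> \<in> subseqs_of s \<Longrightarrow> ev D \<sigma> \<in> carrier W"
  by (induction s arbitrary: \<sigma>) (auto simp: subseqs_of_Cons)

lemma ev_snoc_None [simp]: "ev D (\<sigma> @ [None]) = ev D \<sigma>"
  by (simp add: ev_def)

lemma ev_snoc_Some:
  "s \<in> lists S \<Longrightarrow> \<sigma> \<in> subseqs_of s \<Longrightarrow> a \<in> S \<Longrightarrow> ev D (\<sigma> @ [Some a]) = ev D \<sigma> \<otimes>\<^bsub>W\<^esub> a"
  by (induction s arbitrary: \<sigma>) (auto simp: subseqs_of_Cons W.m_assoc in_lists_conv_set [symmetric])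

text \<open>Same transport as in \<open>exchange\<close>, but the cancelled letter is replaced by
  the blank, so that the result is again a subsequence of s.\<close>

lemma exchange_subseq:
  assumes "s \<in> lists S" "\<sigma> \<in> subseqs_of s" "\<beta> \<in> pos" "act D (inv\<^bsub>W\<^esub> (ev D \<sigma>)) \<beta> \<notin> pos"
  shows "\<exists>\<tau>\<in>subseqs_of s. ev D \<tau> = refl_of D \<beta> \<otimes>\<^bsub>W\<^esub> ev D \<sigma>"
  using assms
proof (induction s arbitrary: \<sigma> \<beta> rule: list.induct)
  case Nil
  then show ?case by (simp add: act_one)
next
  case (Cons a s)
  let ?\<alpha> = "root_of D a"
  have a: "a \<in> S" "s \<in> lists S" using Cons.prems by auto
  obtain \<sigma>' where \<sigma>': "\<sigma>' \<in> subseqs_of s" and cases: "\<sigma> = None # \<sigma>' \<or> \<sigma> = Some a # \<sigma>'"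
    using Cons.prems by (auto simp: subseqs_of_Cons)
  from cases show ?case
  proof
    assume \<sigma>: "\<sigma> = None # \<sigma>'"
    then obtain \<tau> where "\<tau> \<in> subseqs_of s" "ev D \<tau> = refl_of D \<beta> \<otimes>\<^bsub>W\<^esub> ev D \<sigma>'"
      using Cons.IH [OF a(2) \<sigma>' Cons.prems(3)] Cons.prems(4) by auto
    then show ?thesis using \<sigma> by (intro bexI [of _ "None # \<tau>"]) (auto simp: subseqs_of_Cons)
  next
    assume \<sigma>: "\<sigma> = Some a # \<sigma>'"
    show ?thesis
    proof (cases "\<beta> = ?\<alpha>")
      case True
      then show ?thesis using a \<sigma> \<sigma>' simple_root_mult
        by (intro bexI [of _ "None # \<sigma>'"]) (auto simp: subseqs_of_Cons)
    next
      case False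
      let ?\<delta> = "lin_refl D ?\<alpha> \<beta>"
      have \<delta>: "?\<delta> \<in> pos" using Cons.prems False by (intro lin_refl_simple_pos) auto
      moreover have "act D (inv\<^bsub>W\<^esub> (ev D \<sigma>')) ?\<delta> \<notin> pos"
        using Cons.prems a \<sigma>' by (simp add: inv_simple_mult \<sigma>)
      ultimately obtain \<tau> where "\<tau> \<in> subseqs_of s" "ev D \<tau> = refl_of D ?\<delta> \<otimes>\<^bsub>W\<^esub> ev D \<sigma>'"
        using Cons.IH a \<sigma>' by blast
      then show ?thesis using a Cons.prems(3) refl_simple_mult \<sigma> \<sigma>'
        by (intro bexI [of _ "Some a # \<tau>"]) (auto simp: subseqs_of_Cons)
    qed
  qed
qed

text \<open>Ensures that every edge descending from an element of J(s) belongs to the subgraph to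
  which the GKM-property refers.\<close>

lemma evals_downward:
  assumes "s \<in> lists S" "w \<in> evals D s" "\<beta> \<in> R" "len (refl_of D \<beta> \<otimes>\<^bsub>W\<^esub> w) < len w"
  shows "refl_of D \<beta> \<otimes>\<^bsub>W\<^esub> w \<in> evals D s"
proof -
  obtain \<sigma> where \<sigma>: "\<sigma> \<in> subseqs_of s" "w = ev D \<sigma>" using assms by (auto simp: evals_def)
  obtain \<beta>' where \<beta>': "\<beta>' \<in> pos" "refl_of D \<beta>' = refl_of D \<beta>" using pos_representative assms by blast
  then have "act D (inv\<^bsub>W\<^esub> w) \<beta>' \<notin> pos" using assms \<sigma> len_less_iff [OF \<beta>'(1), of w] by simp
  then show ?thesis using exchange_subseq [OF assms(1) \<sigma>(1) \<beta>'(1)] \<beta>' \<sigma>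
    unfolding evals_def by force
qed

end

section \<open>Linear forms in the symmetric algebra\<close>

lemma lookup_single_times:
  fixes q :: "('i, 'f::field) sym_alg"
  shows "Poly_Mapping.lookup (Poly_Mapping.single k c * q) m = Sum_any (\<lambda>x. c * Poly_Mapping.lookup q x when m = k + x)"
proof -
  let ?s = "\<lambda>l. Sum_any (\<lambda>x. Poly_Mapping.lookup q x when m = l + x)"
  have "Poly_Mapping.lookup (Poly_Mapping.single k c :: ('i, 'f) sym_alg) l * ?s l = (c * ?s l when l = k)" for l
    by (simp add: lookup_single when_def)
  then have "Poly_Mapping.lookup (Poly_Mapping.single k c * q) m = Sum_any (\<lambda>l. c * ?s l when l = k)"
    unfolding lookup_mult by presburger
  also have "\<dots> = c * ?s k" by (simp only: Sum_any_when_equal)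
  also have "\<dots> = Sum_any (\<lambda>x. c * (Poly_Mapping.lookup q x when m = k + x))"
    by (rule Sum_any_right_distrib) (rule finite_subset [of _ "Poly_Mapping.keys q"], auto simp: in_keys_iff)
  finally show ?thesis by (simp only: mult_when)
qed

lemma lookup_single_times_add:
  fixes q :: "('i, 'f::field) sym_alg"
  shows "Poly_Mapping.lookup (Poly_Mapping.single k c * q) (k + m) = c * Poly_Mapping.lookup q m"
  by (simp add: lookup_single_times)

lemma lookup_single_times_eq_0:
  fixes q :: "('i, 'f::field) sym_alg"
  assumes "\<And>x. m \<noteq> k + x"
  shows "Poly_Mapping.lookup (Poly_Mapping.single k c * q) m = 0"
  using assms by (simp add: lookup_single_times)

lemma lookup_const_times [simp]: "Poly_Mapping.lookup (const c * q) m = c * Poly_Mapping.lookup (q :: ('i, 'f::field) sym_alg) m"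
  using lookup_single_times_add [where k = 0] by (simp add: const_def)

lemma lookup_var_times:
  "Poly_Mapping.lookup (var i * q) m =
    (if Poly_Mapping.lookup m i > 0 then Poly_Mapping.lookup (q :: ('i, 'f::field) sym_alg) (m - Poly_Mapping.single i 1) else 0)"
proof (cases "Poly_Mapping.lookup m i > 0")
  case True
  then have "m = Poly_Mapping.single i 1 + (m - Poly_Mapping.single i 1)"
    by (intro poly_mapping_eqI) (auto simp: lookup_add lookup_minus lookup_single when_def)
  then have "Poly_Mapping.lookup (var i * q) m = Poly_Mapping.lookup (var i * q) (Poly_Mapping.single i 1 + (m - Poly_Mapping.single i 1))" by simp
  also have "\<dots> = Poly_Mapping.lookup q (m - Poly_Mapping.single i 1)"
    unfolding var_def by (subst lookup_single_times_add) simp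
  finally show ?thesis using True by simp
next
  case False
  then have "m \<noteq> Poly_Mapping.single i 1 + x" for x
    by (auto simp: lookup_add)
  then show ?thesis using False unfolding var_def by (simp add: lookup_single_times_eq_0)
qed

section \<open>Linear forms and division with remainder\<close>

definition lin :: "('i::finite \<Rightarrow> 'f::field) \<Rightarrow> ('i, 'f) sym_alg" where
  "lin b = (\<Sum>i\<in>UNIV. const (b i) * var i)"

lemma lookup_lin_times:
  "Poly_Mapping.lookup (lin b * q) m = (\<Sum>i\<in>UNIV. b i * (if Poly_Mapping.lookup m i > 0 then Poly_Mapping.lookup q (m - Poly_Mapping.single i 1) else 0))"
  by (simp add: lin_def sum_distrib_right mult.assoc lookup_sum lookup_var_times)

lemma lookup_lin_var [simp]: "Poly_Mapping.lookup (lin b) (Poly_Mapping.single j 1) = b j"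
proof -
  have "Poly_Mapping.lookup (lin b) (Poly_Mapping.single j 1) = Poly_Mapping.lookup (lin b * 1) (Poly_Mapping.single j 1)" by simp
  also have "\<dots> = (\<Sum>i\<in>UNIV. if i = j then b i else 0)"
    unfolding lookup_lin_times by (intro sum.cong) (auto simp: lookup_single lookup_one when_def)
  finally show ?thesis by (simp add: sum.delta)
qed

lemma const_add: "const (a + b) = const a + const b"
  and const_mult: "const (a * b) = const a * const (b :: 'f::field)"
  and const_uminus: "const (- b) = - const b"
  and const_zero [simp]: "const 0 = 0"
  and const_one [simp]: "const 1 = 1"
  by (simp_all add: const_def single_add mult_single single_uminus)

lemma lin_add: "lin (\<lambda>i. b i + c i) = lin b + lin c"
  by (simp add: lin_def const_add sum.distrib algebra_simps)

lemma lin_scale: "lin (\<lambda>i. a * b i) = const a * lin b"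
  by (simp add: lin_def const_mult sum_distrib_left algebra_simps)

text \<open>These polynomials serve as remainders on division by a linear form with nonzero
  coefficient at the variable j.\<close>

definition free_of :: "'i \<Rightarrow> ('i, 'f::zero) sym_alg \<Rightarrow> bool" where
  "free_of j p \<longleftrightarrow> (\<forall>m\<in>Poly_Mapping.keys p. Poly_Mapping.lookup m j = 0)"

lemma free_ofD: "free_of j p \<Longrightarrow> Poly_Mapping.lookup m j > 0 \<Longrightarrow> Poly_Mapping.lookup p m = 0"
  by (metis free_of_def in_keys_iff less_irrefl)

lemma free_ofI: "(\<And>m. Poly_Mapping.lookup m j > 0 \<Longrightarrow> Poly_Mapping.lookup p m = 0) \<Longrightarrow> free_of j p"
  by (force simp: free_of_def in_keys_iff)

text \<open>Compare coefficients at \<open>x\<^sub>j m\<close> for a monomial \<open>m\<close> of \<open>q\<close> with maximal exponent of \<open>x\<^sub>j\<close>.\<close>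

lemma lin_times_free_of:
  assumes b: "b j \<noteq> 0" and free: "free_of j (lin b * q)"
  shows "q = 0"
proof (rule ccontr)
  assume "q \<noteq> 0"
  then have ne: "Poly_Mapping.keys q \<noteq> {}" by (metis in_keys_iff equals0D lookup_zero poly_mapping_eqI)
  let ?M = "(\<lambda>m. Poly_Mapping.lookup m j) ` Poly_Mapping.keys q"
  have "Max ?M \<in> ?M" using ne by (intro Max_in) auto
  then obtain m where "m \<in> Poly_Mapping.keys q" "Poly_Mapping.lookup m j = Max ?M" by auto
  then have m: "m \<in> Poly_Mapping.keys q" "\<And>m'. m' \<in> Poly_Mapping.keys q \<Longrightarrow> Poly_Mapping.lookup m' j \<le> Poly_Mapping.lookup m j"
    by auto
  let ?e = "\<lambda>i. Poly_Mapping.single i (1::nat)"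
  have "b i * (if Poly_Mapping.lookup (m + ?e j) i > 0 then Poly_Mapping.lookup q (m + ?e j - ?e i) else 0) = (if i = j then b j * Poly_Mapping.lookup q m else 0)" for i
  proof (cases "i = j")
    case False
    then have "Poly_Mapping.lookup (m + ?e j - ?e i) j = Suc (Poly_Mapping.lookup m j)"
      by (simp add: lookup_add lookup_minus lookup_single when_def)
    then have "m + ?e j - ?e i \<notin> Poly_Mapping.keys q" using m(2) by fastforce
    then show ?thesis using False by (simp add: in_keys_iff)
  qed (simp add: lookup_add)
  then have "Poly_Mapping.lookup (lin b * q) (m + ?e j) = b j * Poly_Mapping.lookup q m"
    unfolding lookup_lin_times by (simp add: sum.delta)
  moreover have "Poly_Mapping.lookup (lin b * q) (m + ?e j) = 0"
    using free by (rule free_ofD) (simp add: lookup_add)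
  ultimately show False using b m(1) by (simp add: in_keys_iff)
qed

lemma free_of_lin_times:
  fixes r :: "('i::finite, 'f::field) sym_alg"
  assumes "c j = 0" "free_of j r" shows "free_of j (lin c * r)"
proof (rule free_ofI)
  fix m :: "'i \<Rightarrow>\<^sub>0 nat" assume m: "Poly_Mapping.lookup m j > 0"
  have "c i * (if Poly_Mapping.lookup m i > 0 then Poly_Mapping.lookup r (m - Poly_Mapping.single i 1) else 0) = 0" for i
  proof (cases "i = j")
    case False
    then have "Poly_Mapping.lookup (m - Poly_Mapping.single i 1) j > 0"
      using m by (simp add: lookup_minus lookup_single when_def)
    then show ?thesis using free_ofD [OF assms(2)] by simp
  qed (simp add: assms)
  then show "Poly_Mapping.lookup (lin c * r) m = 0" unfolding lookup_lin_times by (intro sum.neutral ballI)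
qed

lemma free_of_add: "free_of j p \<Longrightarrow> free_of j q \<Longrightarrow> free_of j (p + (q :: ('i, 'f::field) sym_alg))"
  by (rule free_ofI) (simp add: lookup_add free_ofD)

lemma free_of_const: "free_of j p \<Longrightarrow> free_of j (const c * (p :: ('i, 'f::field) sym_alg))"
  by (rule free_ofI) (simp add: free_ofD)

text \<open>Obtained by induction over the support twice: over the exponents of a monomial, and over
  the monomials of a polynomial.\<close>

lemma sym_alg_induct:
  fixes P :: "('i, 'f::field) sym_alg \<Rightarrow> bool"
  assumes zero: "P 0" and one: "P 1" and add: "\<And>p q. P p \<Longrightarrow> P q \<Longrightarrow> P (p + q)"
    and cst: "\<And>c p. P p \<Longrightarrow> P (const c * p)" and var: "\<And>i p. P p \<Longrightarrow> P (var i * p)"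
  shows "P p"
proof -
  have mono: "P (Poly_Mapping.single m c)" for m c
  proof (induction m rule: update_induct)
    case const
    show ?case using cst [OF one, of c] by (simp add: const_def)
  next
    case (update f k v)
    have "P (Poly_Mapping.single (f + Poly_Mapping.single k n) c)" for n
    proof (induction n)
      case (Suc n)
      have "Poly_Mapping.single (f + Poly_Mapping.single k (Suc n)) c
        = var k * Poly_Mapping.single (f + Poly_Mapping.single k n) c"
        by (simp add: var_def mult_single ac_simps flip: single_add)
      then show ?case using var [OF Suc] by simp
    qed (use update in simp)
    moreover have "Poly_Mapping.update k v f = f + Poly_Mapping.single k v"
      using update by (intro poly_mapping_eqI) (auto simp: lookup_update lookup_add lookup_single in_keys_iff when_def)
    ultimately show ?case by simp
  qed
  show ?thesis
  proof (induction p rule: update_induct)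
    case (update f k v)
    have "Poly_Mapping.update k v f = f + Poly_Mapping.single k v"
      using update by (intro poly_mapping_eqI) (auto simp: lookup_update lookup_add lookup_single in_keys_iff when_def)
    then show ?case using add [OF update.IH mono] by simp
  qed (fact zero)
qed

text \<open>Divisibility with remainder is stable under the algebra operations; only multiplication
  by the variable j destroys the form of the remainder.\<close>

lemma lin_division:
  fixes b :: "'i::finite \<Rightarrow> 'f::field"
  assumes b: "b j \<noteq> 0"
  shows "\<exists>q r. p = lin b * q + r \<and> free_of j r"
proof (induction p rule: sym_alg_induct)
  let ?T = "\<lambda>p. \<exists>q r. p = lin b * q + r \<and> free_of j r"
  show zero: "?T 0" by (intro exI [of _ 0]) (simp add: free_of_def)
  show "?T 1" by (intro exI [of _ 0] exI [of _ 1]) (simp add: free_of_def)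
  show add: "?T (p + p')" if T: "?T p" "?T p'" for p p'
  proof -
    from T obtain q r q' r' where "p = lin b * q + r" "free_of j r" "p' = lin b * q' + r'" "free_of j r'" by blast
    then show ?thesis
      by (intro exI [of _ "q + q'"] exI [of _ "r + r'"]) (simp add: free_of_add algebra_simps)
  qed
  show const: "?T (const c * p)" if T: "?T p" for c p
  proof -
    from T obtain q r where "p = lin b * q + r" "free_of j r" by blast
    then show ?thesis
      by (intro exI [of _ "const c * q"] exI [of _ "const c * r"]) (simp add: free_of_const distrib_left mult.left_commute)
  qed
  show "?T (var i * p)" if T: "?T p" for i p
  proof -
    have other: "?T (var i * p)" if "i \<noteq> j" for i
    proof -
      from T obtain q r where p: "p = lin b * q + r" and r: "free_of j r" by blast
      have "lin (\<lambda>k. if k = i then 1 else 0) = (\<Sum>k\<in>UNIV. if k = i then var k else 0 :: ('i, 'f) sym_alg)"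
        unfolding lin_def by (intro sum.cong) auto
      then have "var i * r = lin (\<lambda>k. if k = i then 1 else 0) * r" by (simp add: sum.delta)
      then have "free_of j (var i * r)" using free_of_lin_times [OF _ r] that by simp
      then show ?thesis
        by (intro exI [of _ "var i * q"] exI [of _ "var i * r"]) (simp add: p algebra_simps)
    qed
    show ?thesis
    proof (cases "i = j")
      case True
      have "lin b = const (b j) * var j + (\<Sum>i\<in>UNIV - {j}. const (b i) * var i)"
        unfolding lin_def by (rule sum.remove) auto
      then have "const (inverse (b j)) * (lin b * p)
          = const (inverse (b j)) * const (b j) * var j * p + const (inverse (b j)) * (\<Sum>i\<in>UNIV - {j}. const (b i) * (var i * p))"
        by (simp add: algebra_simps sum_distrib_left)
      \<comment> \<open>The linear form is solved for the variable j, which trades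
        \<open>var j * p\<close> for a multiple of the form plus products of p with the other
        variables.\<close>
      then have v: "var j * p = lin b * (const (inverse (b j)) * p) + const (- inverse (b j)) * (\<Sum>i\<in>UNIV - {j}. const (b i) * (var i * p))"
        using b by (simp add: const_uminus algebra_simps flip: const_mult)
      have "?T (\<Sum>i\<in>A. const (b i) * (var i * p))" if "finite A" "j \<notin> A" for A
        using that
      proof (induction A)
        case (insert i A)
        then have "?T (const (b i) * (var i * p))" by (intro const other) auto
        then show ?case using insert by (subst sum.insert) (auto intro!: add)
      qed (simp only: sum.empty zero)
      then have t1: "?T (\<Sum>i\<in>UNIV - {j}. const (b i) * (var i * p))" by simp
      have t2: "?T (lin b * (const (inverse (b j)) * p))"
        by (intro exI [of _ "const (inverse (b j)) * p"] exI [of _ 0]) (simp add: free_of_def)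
      show ?thesis unfolding True v by (rule add [OF t2 const [OF t1]])
    qed (rule other)
  qed
qed

lemma lin_nonzeroD: "lin b \<noteq> 0 \<Longrightarrow> \<exists>j. b j \<noteq> 0"
  by (rule ccontr) (simp add: lin_def)

lemma lin_cancel: "lin b * q = 0 \<Longrightarrow> lin b \<noteq> 0 \<Longrightarrow> q = 0"
proof -
  assume *: "lin b * q = 0" "lin b \<noteq> 0"
  then obtain j where "b j \<noteq> 0" using lin_nonzeroD by blast
  then show ?thesis by (rule lin_times_free_of) (simp add: * free_of_def)
qed

text \<open>Modulo \<open>lin b\<close> a polynomial is represented by a remainder free of the
  variable j. A linear form and a remainder both free of it have a product free of it, and if
  \<open>lin b\<close> divides that product, it vanishes by
  \<open>lin_times_free_of\<close>.\<close>

lemma lin_prime: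
  assumes eq: "lin c * p = lin b * q" and nz: "lin b \<noteq> 0" and nprop: "\<not> proportional (lin b) (lin c)"
  shows "\<exists>r. p = lin b * r"
proof -
  obtain j where j: "b j \<noteq> 0" using nz lin_nonzeroD by blast
  obtain q1 r where p: "p = lin b * q1 + r" and r: "free_of j r" using lin_division [of b j p] j by blast
  \<comment> \<open>Subtracting this multiple of b removes the variable j from c without changing c
    modulo \<open>lin b\<close>. The rest is nonzero because the forms are not proportional.\<close>
  define a where "a = c j / b j"
  define c' where "c' i = c i - a * b i" for i
  have "lin (\<lambda>i. c' i + a * b i) = lin c' + const a * lin b" by (simp only: lin_add lin_scale)
  then have c: "lin c = lin c' + const a * lin b" by (simp add: c'_def)
  have "lin c' \<noteq> 0" using nprop unfolding proportional_def by (auto simp: c)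
  have "lin c' * r = lin b * (q - lin c * q1 - const a * r)"
    using eq unfolding p c by (simp add: algebra_simps)
  moreover have "free_of j (lin c' * r)" by (rule free_of_lin_times [OF _ r]) (simp add: c'_def a_def j)
  ultimately have "lin c' * r = 0" using lin_times_free_of j by (metis mult_zero_right)
  then have "r = 0" using lin_cancel \<open>lin c' \<noteq> 0\<close> by blast
  then show ?thesis using p by auto
qed

section \<open>Degrees\<close>

lemma homogeneous_zero [simp]: "homogeneous d 0"
  by (simp add: homogeneous_def)

lemma homogeneous_add: "homogeneous d p \<Longrightarrow> homogeneous d q \<Longrightarrow> homogeneous d (p + q)"
  unfolding homogeneous_def using keys_add [of p q] by blast

lemma homogeneous_sum: "(\<And>i. i \<in> A \<Longrightarrow> homogeneous d (f i)) \<Longrightarrow> homogeneous d (sum f A)"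
  by (induction A rule: infinite_finite_induct) (auto intro: homogeneous_add)

lemma homogeneous_mult: "homogeneous d p \<Longrightarrow> homogeneous e q \<Longrightarrow> homogeneous (d + e) (p * (q :: ('i::finite, 'f::field) sym_alg))"
  unfolding homogeneous_def using keys_mult [of p q]
  by (fastforce simp: lookup_add sum.distrib distrib_left)

lemma homogeneous_const: "homogeneous 0 (const c)"
  by (auto simp: homogeneous_def const_def split: if_splits)

lemma homogeneous_one: "homogeneous 0 (1 :: ('i::finite, 'f::field) sym_alg)"
  by (metis const_one homogeneous_const)

lemma homogeneous_var: "homogeneous 2 (var i :: ('i::finite, 'f::field) sym_alg)"
  by (auto simp: homogeneous_def var_def lookup_single when_def if_distrib [of int] sum.delta' cong: if_cong)

lemma homogeneous_lin: "homogeneous 2 (lin b)"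
  unfolding lin_def using homogeneous_mult [OF homogeneous_const homogeneous_var]
  by (intro homogeneous_sum) simp

section \<open>Linear forms attached to affine weights\<close>

context affine_setting
begin

abbreviation L where "L \<equiv> latbasis D"

lemma aff_weights_add: "\<mu> \<in> aff_weights D \<Longrightarrow> \<nu> \<in> aff_weights D \<Longrightarrow> \<mu> + \<nu> \<in> aff_weights D"
  by (auto simp: aff_weights_def weight_lattice_def coroot_simps)

lemma aff_weights_scale: "\<mu> \<in> aff_weights D \<Longrightarrow> aff_scale D (of_int n) \<mu> \<in> aff_weights D"
  by (auto simp: aff_weights_def weight_lattice_def coroot_simps aff_scale_def)

lemma coords_eq:
  assumes "\<mu> \<in> aff_weights D"
  shows "(\<Sum>i\<in>UNIV. aff_scale D (of_int (coords D \<mu> i)) (L i)) = \<mu>"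
  using theI' [OF latbasis_unique [OF assms]] unfolding coords_def by simp

lemma coords_unique:
  assumes "\<mu> \<in> aff_weights D" "\<mu> = (\<Sum>i\<in>UNIV. aff_scale D (of_int (c i)) (L i))"
  shows "coords D \<mu> = c"
  using latbasis_unique [OF assms(1)] assms(2) coords_eq [OF assms(1)] by metis

lemma aff_scale_add: "aff_scale D (a + b) \<mu> = aff_scale D a \<mu> + aff_scale D b \<mu>"
  and aff_scale_scale: "aff_scale D a (aff_scale D b \<mu>) = aff_scale D (a * b) \<mu>"
  and aff_scale_right_add: "aff_scale D a (\<mu> + \<nu>) = aff_scale D a \<mu> + aff_scale D a \<nu>"
  and aff_scale_zero: "aff_scale D a 0 = 0"
  by (simp_all add: aff_scale_def V.scale_left_distrib V.scale_right_distrib algebra_simps zero_prod_def)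

lemma aff_scale_sum: "aff_scale D a (\<Sum>i\<in>A. f i) = (\<Sum>i\<in>A. aff_scale D a (f i))"
  by (induction A rule: infinite_finite_induct) (auto simp: aff_scale_right_add aff_scale_zero)

lemma bar_lin: "bar D \<mu> = lin (\<lambda>i. of_int (coords D \<mu> i))"
  by (simp add: bar_def lin_def)

lemma bar_add:
  assumes "\<mu> \<in> aff_weights D" "\<nu> \<in> aff_weights D"
  shows "bar D (\<mu> + \<nu>) = bar D \<mu> + bar D \<nu>"
proof -
  have "coords D (\<mu> + \<nu>) = (\<lambda>i. coords D \<mu> i + coords D \<nu> i)"
    using assms by (intro coords_unique) (simp_all add: aff_weights_add aff_scale_add sum.distrib coords_eq)
  then show ?thesis by (simp add: bar_lin lin_add)
qed

lemma bar_scale: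
  assumes "\<mu> \<in> aff_weights D"
  shows "bar D (aff_scale D (of_int n) \<mu>) = const (of_int n) * bar D \<mu>"
proof -
  have "coords D (aff_scale D (of_int n) \<mu>) = (\<lambda>i. n * coords D \<mu> i)"
    using assms
    by (intro coords_unique)
      (simp_all add: aff_weights_scale coords_eq flip: aff_scale_scale aff_scale_sum)
  then show ?thesis by (simp add: bar_lin lin_scale)
qed

lemma bar_uminus:
  assumes "\<mu> \<in> aff_weights D" shows "bar D (- \<mu>) = - bar D \<mu>"
proof -
  have "aff_scale D (of_int (- 1)) \<mu> = - \<mu>" by (simp add: aff_scale_def prod_eq_iff)
  then show ?thesis using bar_scale [OF assms, of "- 1"] by (simp add: const_uminus)
qed

text \<open>The value 2 of the coroot on its own root is an integral combination of the coordinates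
  of \<beta>, so these cannot all vanish in a field where 2 is nonzero.\<close>

lemma bar_nonzero:
  assumes "\<beta> \<in> R" "(2 :: 'f::field) \<noteq> 0"
  shows "bar D \<beta> \<noteq> (0 :: ('i, 'f) sym_alg)"
proof
  assume z: "bar D \<beta> = (0 :: ('i, 'f) sym_alg)"
  have "of_int (coords D \<beta> i) = (0 :: 'f)" for i
    using arg_cong [OF z, of "\<lambda>p. Poly_Mapping.lookup p (Poly_Mapping.single i 1)"]
    by (simp add: bar_lin del: One_nat_def)
  moreover have fb: "fst \<beta> \<in> roots D" using assms by (auto simp: aff_roots_def)
  have "\<exists>m. coroot D (fst \<beta>) (fst (L i)) = of_int m" for i
    using latbasis_in [of i] fb by (auto simp: aff_weights_def weight_lattice_def mem_Times_iff elim!: Ints_cases)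
  then obtain m where m: "\<And>i. coroot D (fst \<beta>) (fst (L i)) = of_int (m i)" by metis
  have "coroot D (fst \<beta>) (\<Sum>i\<in>A. scl D (of_int (c i)) (fst (L i))) = of_int (\<Sum>i\<in>A. c i * m i)" for A c
    by (induction A rule: infinite_finite_induct) (simp_all add: coroot_simps fb m)
  from this [of "coords D \<beta>" UNIV] have "2 = (of_int (\<Sum>i\<in>UNIV. coords D \<beta> i * m i) :: rat)"
    using arg_cong [OF coords_eq [OF R_subset_aff_weights [OF assms(1)]], of fst] coroot_self [OF fb]
    by (simp add: fst_sum aff_scale_def)
  then have "2 = (\<Sum>i\<in>UNIV. coords D \<beta> i * m i)" by (metis of_int_eq_iff of_int_numeral)
  then have "(2::'f) = (\<Sum>i\<in>UNIV. of_int (coords D \<beta> i) * of_int (m i))"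
    by (metis (no_types, lifting) of_int_mult of_int_numeral of_int_sum sum.cong)
  ultimately show False using assms(2) by simp
qed

lemma bar_cancel:
  assumes "\<beta> \<in> R" "(2 :: 'f::field) \<noteq> 0" "bar D \<beta> * q = (0 :: ('i, 'f) sym_alg)"
  shows "q = 0"
  using lin_cancel bar_nonzero [OF assms(1,2)] assms(3) unfolding bar_lin by blast

lemma bar_prime:
  assumes "\<beta> \<in> R" "(2 :: 'f::field) \<noteq> 0" "bar D \<gamma> * p = bar D \<beta> * (q :: ('i, 'f) sym_alg)"
    "\<not> proportional (bar D \<beta> :: ('i, 'f) sym_alg) (bar D \<gamma>)"
  shows "\<exists>r. p = bar D \<beta> * r"
  using assms bar_nonzero [OF assms(1,2)] unfolding bar_lin by (intro lin_prime)

lemma homogeneous_bar: "homogeneous 2 (bar D \<mu>)"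
  unfolding bar_lin by (rule homogeneous_lin)

lemma proportional_uminus: "proportional (- p) q \<longleftrightarrow> proportional p q" "proportional p (- q) \<longleftrightarrow> proportional p q"
proof -
  have *: "proportional (- p) q" if "proportional p q" for p q :: "('x, 'y::field) sym_alg"
  proof -
    from that obtain c where "p = const c * q \<or> q = const c * p" unfolding proportional_def by blast
    then have "- p = const (- c) * q \<or> q = const (- c) * (- p)" by (auto simp: const_uminus)
    then show ?thesis unfolding proportional_def by blast
  qed
  have sym: "proportional p q \<longleftrightarrow> proportional q p" for p q :: "('x, 'y::field) sym_alg"
    unfolding proportional_def by blast
  show "proportional (- p) q \<longleftrightarrow> proportional p q" "proportional p (- q) \<longleftrightarrow> proportional p q"
    using * sym by (metis minus_minus)+
qed

text \<open>Both roots give edges descending from v. Edges carry positive roots, but passing to the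
  negative of a root only changes the sign of its label.\<close>

lemma gkm_nonproportional:
  assumes gkm: "gkm TYPE('f::field) D (evals D s)" and s: "s \<in> lists S" and v: "v \<in> evals D s"
    and \<beta>: "\<beta> \<in> R" "len (refl_of D \<beta> \<otimes>\<^bsub>W\<^esub> v) < len v"
    and \<gamma>: "\<gamma> \<in> R" "len (refl_of D \<gamma> \<otimes>\<^bsub>W\<^esub> v) < len v"
    and neq: "refl_of D \<beta> \<otimes>\<^bsub>W\<^esub> v \<noteq> refl_of D \<gamma> \<otimes>\<^bsub>W\<^esub> v"
  shows "\<not> proportional (bar D \<beta> :: ('i, 'f) sym_alg) (bar D \<gamma>)"
proof -
  have vW: "v \<in> carrier W" using v ev_closed [OF s] by (auto simp: evals_def)
  have edge: "\<exists>\<beta>'. (refl_of D \<beta> \<otimes>\<^bsub>W\<^esub> v, v, \<beta>') \<in> mg_edges D (evals D s) \<and> (\<beta>' = \<beta> \<or> \<beta>' = - \<beta>)"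
    if h: "\<beta> \<in> R" "len (refl_of D \<beta> \<otimes>\<^bsub>W\<^esub> v) < len v" for \<beta>
  proof -
    obtain \<beta>' where \<beta>': "\<beta>' \<in> pos" "\<beta>' = \<beta> \<or> \<beta>' = - \<beta>" "refl_of D \<beta>' = refl_of D \<beta>"
      using pos_representative h by blast
    have "aff_less D (refl_of D \<beta> \<otimes>\<^bsub>W\<^esub> v) v"
      using aff_less_iff [OF W.m_closed [OF refl_carrier [OF h(1)] vW] h(1)] h(2)
      unfolding refl_mult_cancel [OF h(1) vW] by blast
    moreover have "v = refl_of D \<beta>' \<otimes>\<^bsub>W\<^esub> (refl_of D \<beta> \<otimes>\<^bsub>W\<^esub> v)"
      using \<beta>'(3) h vW by (simp add: refl_mult_cancel)
    ultimately show ?thesis using \<beta>'(1,2) v evals_downward [OF s v h]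
      unfolding mg_edges_def by blast
  qed
  obtain \<beta>' \<gamma>' where *: "(refl_of D \<beta> \<otimes>\<^bsub>W\<^esub> v, v, \<beta>') \<in> mg_edges D (evals D s)" "\<beta>' = \<beta> \<or> \<beta>' = - \<beta>"
    "(refl_of D \<gamma> \<otimes>\<^bsub>W\<^esub> v, v, \<gamma>') \<in> mg_edges D (evals D s)" "\<gamma>' = \<gamma> \<or> \<gamma>' = - \<gamma>"
    using edge [OF \<beta>] edge [OF \<gamma>] by blast
  then have "\<not> proportional (bar D \<beta>' :: ('i, 'f) sym_alg) (bar D \<gamma>')"
    using gkm neq unfolding gkm_def by fastforce
  then show ?thesis using * \<beta>(1) \<gamma>(1)
    by (auto simp: bar_uminus R_subset_aff_weights proportional_uminus)
qed

end

section \<open>The module \<open>\<X>(s)\<close>\<close>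

lemma gkm_mono:
  assumes "gkm F D \<Omega>" "\<Omega>' \<subseteq> \<Omega>" shows "gkm F D \<Omega>'"
proof -
  have *: "e \<in> mg_edges D \<Omega>' \<Longrightarrow> e \<in> mg_edges D \<Omega>" for e using assms(2) by (auto simp: mg_edges_def)
  show ?thesis using assms(1) unfolding gkm_def split_def by (intro ballI) (auto simp del: split_paired_All dest!: *)
qed

lemma diag_apply:
  "\<tau> \<in> subseqs_of s \<Longrightarrow> diag (s @ [a]) f (\<tau> @ [None]) = f \<tau>"
  "\<tau> \<in> subseqs_of s \<Longrightarrow> diag (s @ [a]) f (\<tau> @ [Some a]) = f \<tau>"
  by (auto simp: diag_def subseqs_of_def intro: list_all2_appendI)

lemma diag_outside: "\<sigma> \<notin> subseqs_of s \<Longrightarrow> diag s f \<sigma> = 0"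
  by (simp add: diag_def)

lemma diag_add: "diag s (f + g) = diag s f + diag s g"
  and diag_vscale: "diag s (vscale p f) = vscale p (diag s f)"
  by (auto simp: diag_def vscale_def fun_eq_iff)

lemma cmul_add: "cmul D \<mu> (f + g) = cmul D \<mu> f + cmul D \<mu> g"
  and cmul_vscale: "cmul D \<mu> (vscale p f) = vscale p (cmul D \<mu> f)"
  by (auto simp: cmul_def vscale_def fun_eq_iff algebra_simps)

lemma vscale_add: "vscale p (f + g) = vscale p f + vscale p g"
  by (auto simp: vscale_def fun_eq_iff algebra_simps)

lemma Xmod_Nil: "Xmod D [] = {f. \<forall>\<sigma>. \<sigma> \<noteq> [] \<longrightarrow> f \<sigma> = 0}"
  by (auto simp: Xmod.simps [of D "[]"] subseqs_of_def)

lemma Xmod_snoc: "Xmod D (s @ [a]) =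
    {diag (s @ [a]) f + cmul D (root_of D a) (diag (s @ [a]) g) | f g. f \<in> Xmod D s \<and> g \<in> Xmod D s}"
  by (subst Xmod.simps) simp

lemma Xmod_support: "f \<in> Xmod D s \<Longrightarrow> \<sigma> \<notin> subseqs_of s \<Longrightarrow> f \<sigma> = 0"
proof (induction s rule: rev_induct)
  case Nil
  then show ?case by (auto simp: Xmod_Nil subseqs_of_def)
next
  case (snoc a s)
  then show ?case by (auto simp: Xmod_snoc cmul_def diag_outside)
qed

lemma Xmod_add: "f \<in> Xmod D s \<Longrightarrow> g \<in> Xmod D s \<Longrightarrow> f + g \<in> Xmod D s"
proof (induction s arbitrary: f g rule: rev_induct)
  case Nil
  then show ?case by (auto simp: Xmod_Nil)
next
  case (snoc a s)
  let ?\<Delta> = "diag (s @ [a])" and ?c = "cmul D (root_of D a)"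
  from snoc.prems obtain p q p' q' where *: "p \<in> Xmod D s" "q \<in> Xmod D s" "p' \<in> Xmod D s" "q' \<in> Xmod D s"
    "f = ?\<Delta> p + ?c (?\<Delta> q)" "g = ?\<Delta> p' + ?c (?\<Delta> q')" unfolding Xmod_snoc by blast
  have "f + g = ?\<Delta> (p + p') + ?c (?\<Delta> (q + q'))"
    unfolding * diag_add cmul_add by (simp add: algebra_simps)
  then show ?case unfolding Xmod_snoc using * snoc.IH by blast
qed

lemma Xmod_vscale: "f \<in> Xmod D s \<Longrightarrow> vscale p f \<in> Xmod D s"
proof (induction s arbitrary: f rule: rev_induct)
  case Nil
  then show ?case by (auto simp: Xmod_Nil vscale_def)
next
  case (snoc a s)
  let ?\<Delta> = "diag (s @ [a])" and ?c = "cmul D (root_of D a)"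
  from snoc.prems obtain g h where *: "g \<in> Xmod D s" "h \<in> Xmod D s" "f = ?\<Delta> g + ?c (?\<Delta> h)"
    unfolding Xmod_snoc by blast
  have "vscale p f = ?\<Delta> (vscale p g) + ?c (?\<Delta> (vscale p h))"
    unfolding * vscale_add diag_vscale cmul_vscale ..
  then show ?case unfolding Xmod_snoc using * snoc.IH by blast
qed

lemma Xmod_zero: "0 \<in> Xmod D s"
proof (induction s rule: rev_induct)
  case (snoc a s)
  have "0 = diag (s @ [a]) 0 + cmul D (root_of D a) (diag (s @ [a]) 0)"
    by (simp add: diag_def cmul_def fun_eq_iff)
  then show ?case unfolding Xmod_snoc using snoc by blast
qed (simp add: Xmod_Nil)

lemma Xmod_diff: "f \<in> Xmod D s \<Longrightarrow> g \<in> Xmod D s \<Longrightarrow> f - g \<in> Xmod D s"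
proof -
  assume "f \<in> Xmod D s" "g \<in> Xmod D s"
  then have "f + vscale (- 1) g \<in> Xmod D s" by (intro Xmod_add Xmod_vscale)
  moreover have "f + vscale (- 1) g = f - g" by (simp add: vscale_def fun_eq_iff)
  ultimately show ?thesis by simp
qed

lemma Xmod_diag: "f \<in> Xmod D s \<Longrightarrow> diag (s @ [a]) f \<in> Xmod D (s @ [a])"
proof -
  assume "f \<in> Xmod D s"
  moreover have "diag (s @ [a]) f = diag (s @ [a]) f + cmul D (root_of D a) (diag (s @ [a]) 0)"
    by (simp add: diag_def cmul_def fun_eq_iff)
  ultimately show ?thesis unfolding Xmod_snoc using Xmod_zero by blast
qed

lemma const_half:
  fixes p :: "('i, 'f::field) sym_alg"
  assumes "(2 :: 'f) \<noteq> 0" shows "const (1 / 2) * (2 * p) = p"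
proof -
  have "const (1 / 2) * (2 * p) = (const (1 / 2) + const (1 / 2)) * p" by (simp add: algebra_simps)
  also have "const (1 / 2) + const (1 / 2) = (const 1 :: ('i, 'f) sym_alg)"
    unfolding const_add [symmetric] using assms by (simp add: field_simps)
  finally show ?thesis by simp
qed

context affine_setting
begin

lemma ev_snoc_act:
  assumes "s \<in> lists S" "\<tau> \<in> subseqs_of s" "a \<in> S"
  shows "act D (ev D (\<tau> @ [Some a])) \<mu> = act D (ev D \<tau>) (lin_refl D (root_of D a) \<mu>)"
  using assms by (simp add: ev_snoc_Some act_mult act_S)

text \<open>The extensions of a subsequence by the blank and by a carry the same scalar when \<mu>
  is fixed by the simple reflection.\<close>

lemma cmul_diag_invariant:
  assumes s: "s \<in> lists S" "a \<in> S" and inv: "lin_refl D (root_of D a) \<mu> = \<mu>"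
  shows "cmul D \<mu> (diag (s @ [a]) f) = diag (s @ [a]) (cmul D \<mu> f)"
proof
  fix \<sigma>
  show "cmul D \<mu> (diag (s @ [a]) f) \<sigma> = diag (s @ [a]) (cmul D \<mu> f) \<sigma>"
  proof (cases "\<sigma> \<in> subseqs_of (s @ [a])")
    case True
    then obtain \<tau> where \<tau>: "\<tau> \<in> subseqs_of s" "\<sigma> = \<tau> @ [None] \<or> \<sigma> = \<tau> @ [Some a]"
      by (auto simp: subseqs_of_snoc)
    then show ?thesis by (auto simp: cmul_def diag_apply ev_snoc_act [OF s(1) \<tau>(1) s(2)] inv)
  qed (simp add: cmul_def diag_outside)
qed

lemma lin_refl_root_of: "a \<in> S \<Longrightarrow> lin_refl D (root_of D a) (root_of D a) = - root_of D a"
  by (simp add: lin_refl_self)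

text \<open>Appending a only changes the sign of the scalar belonging to \<alpha>, and the sign
  disappears in the square.\<close>

lemma cmul_diag_square:
  fixes f :: "('v, 'i, 'f::field) vec"
  assumes s: "s \<in> lists S" "a \<in> S"
  defines "\<alpha> \<equiv> root_of D a"
  shows "cmul D \<alpha> (cmul D \<alpha> (diag (s @ [a]) f)) = diag (s @ [a]) (cmul D \<alpha> (cmul D \<alpha> f))"
proof
  fix \<sigma>
  have bu: "bar D (- act D (ev D \<tau>) \<alpha>) = - (bar D (act D (ev D \<tau>) \<alpha>) :: ('i, 'f) sym_alg)"
    if "\<tau> \<in> subseqs_of s" for \<tau>
    using that s by (intro bar_uminus R_subset_aff_weights) (auto simp: \<alpha>_def)
  show "cmul D \<alpha> (cmul D \<alpha> (diag (s @ [a]) f)) \<sigma> = diag (s @ [a]) (cmul D \<alpha> (cmul D \<alpha> f)) \<sigma>"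
  proof (cases "\<sigma> \<in> subseqs_of (s @ [a])")
    case True
    then obtain \<tau> where \<tau>: "\<tau> \<in> subseqs_of s" "\<sigma> = \<tau> @ [None] \<or> \<sigma> = \<tau> @ [Some a]"
      by (auto simp: subseqs_of_snoc)
    have "act D (ev D (\<tau> @ [Some a])) \<alpha> = - act D (ev D \<tau>) \<alpha>"
      using ev_snoc_act [OF s(1) \<tau>(1) s(2)] lin_refl_root_of [OF s(2)] act_uminus [OF ev_closed [OF s(1) \<tau>(1)]]
      by (simp add: \<alpha>_def)
    then show ?thesis using bu [OF \<tau>(1)] \<tau> by (auto simp: cmul_def diag_apply)
  qed (simp add: cmul_def diag_outside)
qed

text \<open>\<open>2\<mu> - \<langle>\<mu>, \<alpha>\<^sup>\<or>\<rangle>\<alpha>\<close> is fixed by \<open>s\<^sub>\<alpha>\<close>, so \<open>c\<^sup>\<mu>\<close> is a combination of \<open>c\<^sup>\<alpha>\<close> and an operator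
  commuting with the diagonal embedding.\<close>

lemma Xmod_cmul:
  fixes f :: "('v, 'i, 'f::field) vec"
  assumes two: "(2 :: 'f) \<noteq> 0" and "s \<in> lists S" "\<mu> \<in> aff_weights D" "f \<in> Xmod D s"
  shows "cmul D \<mu> f \<in> Xmod D s"
  using assms(2-)
proof (induction s arbitrary: f \<mu> rule: rev_induct)
  case Nil
  then show ?case by (auto simp: Xmod_Nil cmul_def)
next
  case (snoc a s)
  have s: "s \<in> lists S" "a \<in> S" using snoc.prems by auto
  let ?\<alpha> = "root_of D a"
  let ?\<Delta> = "diag (s @ [a]) :: ('v, 'i, 'f) vec \<Rightarrow> ('v, 'i, 'f) vec"
    and ?c = "\<lambda>\<mu>. cmul D \<mu> :: ('v, 'i, 'f) vec \<Rightarrow> ('v, 'i, 'f) vec"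
  have \<alpha>: "?\<alpha> \<in> R" "?\<alpha> \<in> aff_weights D" using s by (auto intro: R_subset_aff_weights)
  from snoc.prems(3) obtain p q where *: "p \<in> Xmod D s" "q \<in> Xmod D s" "f = ?\<Delta> p + ?c ?\<alpha> (?\<Delta> q)"
    unfolding Xmod_snoc by blast
  obtain m where m: "coroot D (fst ?\<alpha>) (fst \<mu>) = of_int m"
    using snoc.prems(2) \<alpha>(1) by (auto simp: aff_weights_def weight_lattice_def aff_roots_def mem_Times_iff elim: Ints_cases)
  define \<nu> where "\<nu> = (\<mu> + \<mu>) + aff_scale D (of_int (- m)) ?\<alpha>"
  have \<nu>: "\<nu> \<in> aff_weights D"
    unfolding \<nu>_def by (intro aff_weights_add aff_weights_scale snoc.prems \<alpha>)
  have sm: "aff_scale D (of_int (- m)) ?\<alpha> = - aff_scale D (of_int m) ?\<alpha>"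
    by (simp add: aff_scale_def)
  have l\<mu>: "lin_refl D ?\<alpha> \<mu> = \<mu> - aff_scale D (of_int m) ?\<alpha>" by (simp add: lin_refl_def m)
  have inv: "lin_refl D ?\<alpha> \<nu> = \<nu>"
    unfolding \<nu>_def by (simp only: lin_refl_linear \<alpha> l\<mu> lin_refl_self) (simp add: aff_scale_def)
  have b: "bar D (act D w \<mu>) + bar D (act D w \<mu>)
      = bar D (act D w \<nu>) + const (of_int m) * (bar D (act D w ?\<alpha>) :: ('i, 'f) sym_alg)" if "w \<in> carrier W" for w
  proof -
    have w: "act D w \<mu> \<in> aff_weights D" "act D w ?\<alpha> \<in> aff_weights D"
      using that snoc.prems(2) \<alpha> by auto
    have "act D w \<nu> = (act D w \<mu> + act D w \<mu>) + aff_scale D (of_int (- m)) (act D w ?\<alpha>)"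
      unfolding \<nu>_def by (simp only: act_add act_scale that)
    then have "(bar D (act D w \<nu>) :: ('i, 'f) sym_alg) = (bar D (act D w \<mu>) + bar D (act D w \<mu>)) + const (of_int (- m)) * bar D (act D w ?\<alpha>)"
      by (simp only: bar_add bar_scale aff_weights_add aff_weights_scale w)
    then show ?thesis by (simp add: const_uminus)
  qed
  let ?h = "vscale (const (1 / 2)) :: ('v, 'i, 'f) vec \<Rightarrow> ('v, 'i, 'f) vec"
    and ?m = "vscale (const (of_int m)) :: ('v, 'i, 'f) vec \<Rightarrow> ('v, 'i, 'f) vec"
  \<comment> \<open>In 2 c^\<mu> = c^\<nu> + m c^\<alpha>, applied to \<Delta>(p) + c^\<alpha>
    \<Delta>(q), these collect the terms without and with an outer c^\<alpha>.\<close>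
  let ?P = "?h (?c \<nu> p + ?m (?c ?\<alpha> (?c ?\<alpha> q)))" and ?Q = "?h (?c \<nu> q + ?m p)"
  have PQ: "?P \<in> Xmod D s" "?Q \<in> Xmod D s"
    by (intro Xmod_vscale Xmod_add snoc.IH s \<nu> \<alpha> *)+
  have "?\<Delta> ?P + ?c ?\<alpha> (?\<Delta> ?Q) = ?h ((?c \<nu> (?\<Delta> p) + ?m (?c ?\<alpha> (?c ?\<alpha> (?\<Delta> q)))) + ?c ?\<alpha> (?c \<nu> (?\<Delta> q) + ?m (?\<Delta> p)))"
    unfolding cmul_diag_invariant [OF s inv] cmul_diag_square [OF s]
    by (simp only: diag_vscale cmul_vscale diag_add vscale_add cmul_add)
  also have "\<dots> = ?h (?c \<nu> f + ?m (?c ?\<alpha> f))"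
    unfolding * by (simp add: fun_eq_iff cmul_def vscale_def algebra_simps)
  also have "\<dots> = ?c \<mu> f"
  proof
    fix \<sigma>
    show "?h (?c \<nu> f + ?m (?c ?\<alpha> f)) \<sigma> = ?c \<mu> f \<sigma>"
    proof (cases "\<sigma> \<in> subseqs_of (s @ [a])")
      case True
      then have w: "ev D \<sigma> \<in> carrier W" using ev_closed snoc.prems(1) by blast
      have "?h (?c \<nu> f + ?m (?c ?\<alpha> f)) \<sigma>
          = const (1 / 2) * ((bar D (act D (ev D \<sigma>) \<nu>) + const (of_int m) * bar D (act D (ev D \<sigma>) ?\<alpha>)) * f \<sigma>)"
        by (simp add: cmul_def vscale_def algebra_simps)
      also have "\<dots> = const (1 / 2) * (?c \<mu> f \<sigma> + ?c \<mu> f \<sigma>)"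
        unfolding b [OF w, symmetric] by (simp add: cmul_def algebra_simps)
      finally show ?thesis using const_half [OF two] by (simp flip: mult_2)
    next
      case False
      then have "f \<sigma> = 0" using Xmod_support snoc.prems(3) by blast
      then show ?thesis by (simp add: cmul_def vscale_def)
    qed
  qed
  finally have "?c \<mu> f = ?\<Delta> ?P + ?c ?\<alpha> (?\<Delta> ?Q)" by (rule sym)
  then show ?case unfolding Xmod_snoc using PQ by (intro CollectI exI conjI)
qed

section \<open>Restriction to fibres of the evaluation map\<close>

abbreviation fibre where "fibre \<equiv> subseqs_at D"

lemma fibreD: "\<sigma> \<in> fibre s x \<Longrightarrow> \<sigma> \<in> subseqs_of s" "\<sigma> \<in> fibre s x \<Longrightarrow> ev D \<sigma> = x"
  by (auto simp: subseqs_at_def)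

lemma fibre_nonempty: "\<sigma> \<in> fibre s x \<Longrightarrow> x \<in> evals D s"
  by (auto simp: subseqs_at_def evals_def)

lemma mult_S_S: "a \<in> S \<Longrightarrow> x \<in> carrier W \<Longrightarrow> x \<otimes>\<^bsub>W\<^esub> a \<otimes>\<^bsub>W\<^esub> a = x"
  by (simp add: W.m_assoc S_invol)

lemma fibre_snoc:
  assumes "s \<in> lists S" "a \<in> S" "x \<in> carrier W"
  shows "\<sigma> \<in> fibre (s @ [a]) x \<longleftrightarrow>
    (\<exists>\<tau>. \<tau> \<in> fibre s x \<and> \<sigma> = \<tau> @ [None] \<or> \<tau> \<in> fibre s (x \<otimes>\<^bsub>W\<^esub> a) \<and> \<sigma> = \<tau> @ [Some a])"
proof -
  have "ev D (\<tau> @ [Some a]) = x \<longleftrightarrow> ev D \<tau> = x \<otimes>\<^bsub>W\<^esub> a" if "\<tau> \<in> subseqs_of s" for \<tau>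
  proof -
    have "ev D \<tau> \<in> carrier W" using ev_closed assms that by blast
    then show ?thesis unfolding ev_snoc_Some [OF assms(1) that assms(2)] using mult_S_S assms by metis
  qed
  then show ?thesis
    using assms by (auto simp: subseqs_at_def subseqs_of_snoc)
qed

text \<open>On the fibre over \<open>x\<close> the operator \<open>c\<^sup>\<alpha>\<close> is multiplication by a scalar, so elements of
  \<open>\<X>(s)\<close> restrict there to diagonal images of elements of \<open>\<X>(s')\<close>.\<close>

lemma Xmod_fibre:
  fixes f :: "('v, 'i, 'f::field) vec"
  assumes "s \<in> lists S" "a \<in> S" "x \<in> carrier W"
    and p: "p \<in> Xmod D s" and q: "q \<in> Xmod D s"
    and f: "f = diag (s @ [a]) p + cmul D (root_of D a) (diag (s @ [a]) q)"
    and \<sigma>: "\<sigma> \<in> fibre (s @ [a]) x"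
  shows "f \<sigma> = p (butlast \<sigma>) + bar D (act D x (root_of D a)) * q (butlast \<sigma>)"
proof -
  have "ev D \<sigma> = x" "\<sigma> \<in> subseqs_of (s @ [a])" using \<sigma> by (auto simp: subseqs_at_def)
  then show ?thesis by (auto simp: f cmul_def diag_def)
qed

lemma butlast_fibre:
  assumes "s \<in> lists S" "a \<in> S" "x \<in> carrier W" "\<sigma> \<in> fibre (s @ [a]) x"
  shows "butlast \<sigma> \<in> fibre s x \<union> fibre s (x \<otimes>\<^bsub>W\<^esub> a)"
  using assms by (auto simp: fibre_snoc)

lemma fibre_butlast_surj:
  assumes "s \<in> lists S" "a \<in> S" "x \<in> carrier W" "\<tau> \<in> fibre s x \<union> fibre s (x \<otimes>\<^bsub>W\<^esub> a)"
  obtains \<sigma> where "\<sigma> \<in> fibre (s @ [a]) x" "butlast \<sigma> = \<tau>"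
  using assms fibre_snoc [OF assms(1-3)] by (metis Un_iff butlast_snoc)

lemma diag_fibre: "\<sigma> \<in> fibre s x \<Longrightarrow> diag s f \<sigma> = f (butlast \<sigma>)"
  by (simp add: diag_def subseqs_at_def)

lemma Xmod_fibre_exists:
  fixes f :: "('v, 'i, 'f::field) vec"
  assumes "s \<in> lists S" "a \<in> S" "x \<in> carrier W" "f \<in> Xmod D (s @ [a])"
  obtains g where "g \<in> Xmod D s" "\<And>\<sigma>. \<sigma> \<in> fibre (s @ [a]) x \<Longrightarrow> f \<sigma> = g (butlast \<sigma>)"
proof -
  obtain p q where pq: "p \<in> Xmod D s" "q \<in> Xmod D s"
    "f = diag (s @ [a]) p + cmul D (root_of D a) (diag (s @ [a]) q)"
    using assms(4) unfolding Xmod_snoc by blast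
  show ?thesis
  proof (rule that)
    show "p + vscale (bar D (act D x (root_of D a))) q \<in> Xmod D s"
      by (intro Xmod_add Xmod_vscale pq)
    show "f \<sigma> = (p + vscale (bar D (act D x (root_of D a))) q) (butlast \<sigma>)"
      if "\<sigma> \<in> fibre (s @ [a]) x" for \<sigma>
      using Xmod_fibre [OF assms(1-3) pq that] by (simp add: vscale_def)
  qed
qed

text \<open>For w = \<open>ev D (path_seq s \<pi>')\<close> this is the operator that
  \<open>path_vec\<close> applies at a left tilted edge following \<pi>'.\<close>

definition bump :: "'v aff \<Rightarrow> 'v aff \<Rightarrow> ('v, 'i, 'f::field) vec \<Rightarrow> ('v, 'i, 'f) vec" where
  "bump a w f = vscale (const (1 / 2))
     (cmul D (root_of D a) f + vscale (bar D (act D w (root_of D a))) f)"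

lemma Xmod_bump:
  fixes f :: "('v, 'i, 'f::field) vec"
  assumes "(2 :: 'f) \<noteq> 0" "s \<in> lists S" "a \<in> S" "f \<in> Xmod D s"
  shows "bump a w f \<in> Xmod D s"
  unfolding bump_def using assms
  by (intro Xmod_vscale Xmod_add Xmod_cmul R_subset_aff_weights) auto

lemma bump_upper:
  fixes f :: "('v, 'i, 'f::field) vec"
  assumes "(2 :: 'f) \<noteq> 0" "\<sigma> \<in> fibre s w"
  shows "bump a w f \<sigma> = bar D (act D w (root_of D a)) * f \<sigma>"
  using assms(2) by (simp add: bump_def cmul_def vscale_def subseqs_at_def const_half [OF assms(1)] flip: mult_2)

lemma bump_lower:
  fixes f :: "('v, 'i, 'f::field) vec"
  assumes "a \<in> S" "w \<in> carrier W" "\<sigma> \<in> fibre s (w \<otimes>\<^bsub>W\<^esub> a)"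
  shows "bump a w f \<sigma> = 0"
proof -
  have "act D (ev D \<sigma>) (root_of D a) = - act D w (root_of D a)"
    using assms by (simp add: subseqs_at_def act_mult act_S lin_refl_root_of act_uminus)
  moreover have "bar D (- act D w (root_of D a)) = - (bar D (act D w (root_of D a)) :: ('i, 'f) sym_alg)"
    using assms by (intro bar_uminus R_subset_aff_weights) auto
  ultimately show ?thesis by (simp add: bump_def cmul_def vscale_def)
qed

section \<open>Divisibility along the edges of the moment graph\<close>

text \<open>The quotient is required to lie in the module. The field is passed as a type because
  otherwise it would occur only in bound variables.\<close>

definition edge_divisible :: "'f::field itself \<Rightarrow> 'v aff list \<Rightarrow> bool" where
  "edge_divisible F s \<longleftrightarrow> (\<forall>\<beta> z (f :: ('v, 'i, 'f) vec). \<beta> \<in> R \<longrightarrow> z \<in> carrier W \<longrightarrow>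
     len (refl_of D \<beta> \<otimes>\<^bsub>W\<^esub> z) < len z \<longrightarrow> f \<in> Xmod D s \<longrightarrow>
     (\<forall>\<sigma>\<in>fibre s (refl_of D \<beta> \<otimes>\<^bsub>W\<^esub> z). f \<sigma> = 0) \<longrightarrow>
     (\<exists>h\<in>Xmod D s. \<forall>\<sigma>\<in>fibre s z. f \<sigma> = bar D \<beta> * h \<sigma>))"

text \<open>Multiplication by \<gamma> is injective modulo \<beta> on the module restricted to one
  fibre: coprimality of the two forms relative to the module.\<close>

definition root_prime :: "'f::field itself \<Rightarrow> 'v aff list \<Rightarrow> bool" where
  "root_prime F s \<longleftrightarrow> (\<forall>\<beta> \<gamma> v (h :: ('v, 'i, 'f) vec) k. \<beta> \<in> R \<longrightarrow> v \<in> carrier W \<longrightarrow>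
     \<not> proportional (bar D \<beta> :: ('i, 'f) sym_alg) (bar D \<gamma>) \<longrightarrow> h \<in> Xmod D s \<longrightarrow> k \<in> Xmod D s \<longrightarrow>
     (\<forall>\<sigma>\<in>fibre s v. bar D \<gamma> * h \<sigma> = bar D \<beta> * k \<sigma>) \<longrightarrow>
     (\<exists>m\<in>Xmod D s. \<forall>\<sigma>\<in>fibre s v. h \<sigma> = bar D \<beta> * m \<sigma>))"

lemma edge_divisibleD:
  fixes f :: "('v, 'i, 'f::field) vec"
  assumes "edge_divisible TYPE('f) s" "\<beta> \<in> R" "z \<in> carrier W"
    "len (refl_of D \<beta> \<otimes>\<^bsub>W\<^esub> z) < len z" "f \<in> Xmod D s"
    "\<And>\<sigma>. \<sigma> \<in> fibre s (refl_of D \<beta> \<otimes>\<^bsub>W\<^esub> z) \<Longrightarrow> f \<sigma> = 0"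
  obtains h where "h \<in> Xmod D s" "\<And>\<sigma>. \<sigma> \<in> fibre s z \<Longrightarrow> f \<sigma> = bar D \<beta> * h \<sigma>"
  using assms unfolding edge_divisible_def by metis

text \<open>The case \<beta> = w(\<alpha>), whose reflection takes w to wa by
  \<open>mult_simple_eq\<close>.\<close>

lemma edge_divisible_simple:
  fixes f :: "('v, 'i, 'f::field) vec"
  assumes "edge_divisible TYPE('f) s" "a \<in> S" "w \<in> carrier W"
    "len (w \<otimes>\<^bsub>W\<^esub> a) < len w" "f \<in> Xmod D s" "\<And>\<sigma>. \<sigma> \<in> fibre s (w \<otimes>\<^bsub>W\<^esub> a) \<Longrightarrow> f \<sigma> = 0"
  obtains h where "h \<in> Xmod D s" "\<And>\<sigma>. \<sigma> \<in> fibre s w \<Longrightarrow> f \<sigma> = bar D (act D w (root_of D a)) * h \<sigma>"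
  by (rule edge_divisibleD [OF assms(1), of "act D w (root_of D a)" w f])
    (use assms that mult_simple_eq [OF assms(3,2)] in auto)

lemma root_primeD:
  fixes h k :: "('v, 'i, 'f::field) vec"
  assumes "root_prime TYPE('f) s" "\<beta> \<in> R" "v \<in> carrier W"
    "\<not> proportional (bar D \<beta> :: ('i, 'f) sym_alg) (bar D \<gamma>)" "h \<in> Xmod D s" "k \<in> Xmod D s"
    "\<And>\<sigma>. \<sigma> \<in> fibre s v \<Longrightarrow> bar D \<gamma> * h \<sigma> = bar D \<beta> * k \<sigma>"
  obtains m where "m \<in> Xmod D s" "\<And>\<sigma>. \<sigma> \<in> fibre s v \<Longrightarrow> h \<sigma> = bar D \<beta> * m \<sigma>"
  using assms unfolding root_prime_def by metis

text \<open>Quotients over two adjacent fibres are glued: m1 is right over the lower one, and its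
  error over w is divisible by w(\<alpha>). The quotient of the error is again divisible by \<beta>,
  and \<open>bump\<close> adds the correction over w without disturbing the lower fibre.\<close>

lemma root_prime_pair:
  fixes h k :: "('v, 'i, 'f::field) vec"
  assumes two: "(2 :: 'f) \<noteq> 0" and s: "s \<in> lists S" "a \<in> S"
    and ed: "edge_divisible TYPE('f) s" and rp: "root_prime TYPE('f) s"
    and w: "w \<in> carrier W" "len (w \<otimes>\<^bsub>W\<^esub> a) < len w"
    and \<beta>: "\<beta> \<in> R" "\<not> proportional (bar D \<beta> :: ('i, 'f) sym_alg) (bar D \<gamma>)"
    and hk: "h \<in> Xmod D s" "k \<in> Xmod D s"
    and eq: "\<And>\<sigma>. \<sigma> \<in> fibre s w \<union> fibre s (w \<otimes>\<^bsub>W\<^esub> a) \<Longrightarrow> bar D \<gamma> * h \<sigma> = bar D \<beta> * k \<sigma>"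
  obtains m where "m \<in> Xmod D s"
    "\<And>\<sigma>. \<sigma> \<in> fibre s w \<union> fibre s (w \<otimes>\<^bsub>W\<^esub> a) \<Longrightarrow> h \<sigma> = bar D \<beta> * m \<sigma>"
proof -
  let ?u = "w \<otimes>\<^bsub>W\<^esub> a" and ?d = "bar D (act D w (root_of D a)) :: ('i, 'f) sym_alg"
    and ?b = "bar D \<beta> :: ('i, 'f) sym_alg" and ?g = "bar D \<gamma> :: ('i, 'f) sym_alg"
  have u: "?u \<in> carrier W" using w s by simp
  have \<delta>: "act D w (root_of D a) \<in> R" using w s by simp
  obtain m1 where m1: "m1 \<in> Xmod D s" "\<And>\<sigma>. \<sigma> \<in> fibre s ?u \<Longrightarrow> h \<sigma> = ?b * m1 \<sigma>"
    by (rule root_primeD [OF rp \<beta>(1) u \<beta>(2) hk]) (use eq in auto)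
  have h': "h - vscale ?b m1 \<in> Xmod D s" "k - vscale ?g m1 \<in> Xmod D s"
    by (intro Xmod_diff Xmod_vscale hk m1)+
  obtain n where n: "n \<in> Xmod D s" "\<And>\<sigma>. \<sigma> \<in> fibre s w \<Longrightarrow> (h - vscale ?b m1) \<sigma> = ?d * n \<sigma>"
    by (rule edge_divisible_simple [OF ed s(2) w h'(1)]) (use m1 in \<open>auto simp: vscale_def\<close>)
  obtain n' where n': "n' \<in> Xmod D s" "\<And>\<sigma>. \<sigma> \<in> fibre s w \<Longrightarrow> (k - vscale ?g m1) \<sigma> = ?d * n' \<sigma>"
  proof (rule edge_divisible_simple [OF ed s(2) w h'(2)])
    fix \<sigma> assume \<sigma>: "\<sigma> \<in> fibre s ?u"
    \<comment> \<open>Vanishing is checked after multiplication by \<beta>, where the relation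
      between h and k becomes available.\<close>
    have "?b * (k - vscale ?g m1) \<sigma> = ?b * k \<sigma> - ?g * (?b * m1 \<sigma>)"
      by (simp add: vscale_def algebra_simps)
    also have "\<dots> = 0" using eq [of \<sigma>] m1(2) [OF \<sigma>] \<sigma> by simp
    finally show "(k - vscale ?g m1) \<sigma> = 0" using bar_cancel [OF \<beta>(1) two] by blast
  qed (use that in blast)
  obtain m2 where m2: "m2 \<in> Xmod D s" "\<And>\<sigma>. \<sigma> \<in> fibre s w \<Longrightarrow> n \<sigma> = ?b * m2 \<sigma>"
  proof (rule root_primeD [OF rp \<beta>(1) w(1) \<beta>(2) n(1) n'(1)])
    fix \<sigma> assume \<sigma>: "\<sigma> \<in> fibre s w"
    have "?d * (?g * n \<sigma> - ?b * n' \<sigma>) = ?g * (?d * n \<sigma>) - ?b * (?d * n' \<sigma>)"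
      by (simp add: algebra_simps)
    also have "\<dots> = ?g * h \<sigma> - ?b * k \<sigma>"
      unfolding n(2) [OF \<sigma>, symmetric] n'(2) [OF \<sigma>, symmetric] by (simp add: vscale_def algebra_simps)
    also have "\<dots> = 0" using eq \<sigma> by simp
    finally have "?g * n \<sigma> - ?b * n' \<sigma> = 0" using bar_cancel [OF \<delta> two] by blast
    then show "?g * n \<sigma> = ?b * n' \<sigma>" by simp
  qed (use that in blast)
  show ?thesis
  proof (rule that)
    show "m1 + bump a w m2 \<in> Xmod D s" by (intro Xmod_add Xmod_bump two s m1 m2)
    fix \<sigma> assume "\<sigma> \<in> fibre s w \<union> fibre s ?u"
    then show "h \<sigma> = ?b * (m1 + bump a w m2) \<sigma>"
    proof
      assume \<sigma>: "\<sigma> \<in> fibre s w"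
      have "h \<sigma> = ?b * m1 \<sigma> + (h - vscale ?b m1) \<sigma>" by (simp add: vscale_def)
      then show ?thesis using n(2) [OF \<sigma>] m2(2) [OF \<sigma>] bump_upper [OF two \<sigma>, of a m2]
        by (simp add: algebra_simps)
    next
      assume \<sigma>: "\<sigma> \<in> fibre s ?u"
      then show ?thesis using m1(2) [OF \<sigma>] bump_lower [OF s(2) w(1) \<sigma>, of m2] by simp
    qed
  qed
qed

text \<open>Gluing as in \<open>root_prime_pair\<close>. With quotients h1 below and h2 over w, the
  error of h1 over w is w(\<alpha>) n = \<beta>(h2 - h1), so \<open>root_prime\<close> for \<beta>
  and w(\<alpha>) makes n divisible by \<beta>.\<close>

lemma edge_divisible_pair:
  fixes g :: "('v, 'i, 'f::field) vec"
  assumes two: "(2 :: 'f) \<noteq> 0" and s: "s \<in> lists S" "a \<in> S" and gkm: "gkm TYPE('f) D (evals D s)"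
    and ed: "edge_divisible TYPE('f) s" and rp: "root_prime TYPE('f) s"
    and w: "w \<in> carrier W" "len (w \<otimes>\<^bsub>W\<^esub> a) < len w"
    and \<beta>: "\<beta> \<in> R" "len (refl_of D \<beta> \<otimes>\<^bsub>W\<^esub> w) < len w"
      "len (refl_of D \<beta> \<otimes>\<^bsub>W\<^esub> (w \<otimes>\<^bsub>W\<^esub> a)) < len (w \<otimes>\<^bsub>W\<^esub> a)"
    and neq: "refl_of D \<beta> \<otimes>\<^bsub>W\<^esub> w \<noteq> w \<otimes>\<^bsub>W\<^esub> a"
    and g: "g \<in> Xmod D s" "\<And>\<sigma>. \<sigma> \<in> fibre s (refl_of D \<beta> \<otimes>\<^bsub>W\<^esub> w) \<Longrightarrow> g \<sigma> = 0"
      "\<And>\<sigma>. \<sigma> \<in> fibre s (refl_of D \<beta> \<otimes>\<^bsub>W\<^esub> (w \<otimes>\<^bsub>W\<^esub> a)) \<Longrightarrow> g \<sigma> = 0"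
  obtains h where "h \<in> Xmod D s"
    "\<And>\<sigma>. \<sigma> \<in> fibre s w \<union> fibre s (w \<otimes>\<^bsub>W\<^esub> a) \<Longrightarrow> g \<sigma> = bar D \<beta> * h \<sigma>"
proof -
  let ?u = "w \<otimes>\<^bsub>W\<^esub> a" and ?\<delta> = "act D w (root_of D a)"
  let ?d = "bar D ?\<delta> :: ('i, 'f) sym_alg" and ?b = "bar D \<beta> :: ('i, 'f) sym_alg"
  have u: "?u \<in> carrier W" using w s by simp
  have \<delta>: "?\<delta> \<in> R" "refl_of D ?\<delta> \<otimes>\<^bsub>W\<^esub> w = ?u" using w s mult_simple_eq by simp_all
  obtain h1 where h1: "h1 \<in> Xmod D s" "\<And>\<sigma>. \<sigma> \<in> fibre s ?u \<Longrightarrow> g \<sigma> = ?b * h1 \<sigma>"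
    by (rule edge_divisibleD [OF ed \<beta>(1) u \<beta>(3) g(1,3)]) (use that in blast)+
  obtain h2 where h2: "h2 \<in> Xmod D s" "\<And>\<sigma>. \<sigma> \<in> fibre s w \<Longrightarrow> g \<sigma> = ?b * h2 \<sigma>"
    by (rule edge_divisibleD [OF ed \<beta>(1) w(1) \<beta>(2) g(1,2)]) (use that in blast)+
  show ?thesis
  proof (cases "w \<in> evals D s")
    \<comment> \<open>An empty upper fibre imposes no condition, so h1 suffices. Otherwise w is a
      vertex of the graph, as required to use GKM.\<close>
    case False
    then show ?thesis using h1 that fibre_nonempty by blast
  next
    case True
    have np: "\<not> proportional ?b ?d"
      using gkm_nonproportional [OF gkm s(1) True \<beta>(1,2) \<delta>(1)] w(2) neq \<delta>(2) by simp
    have "g - vscale ?b h1 \<in> Xmod D s" by (intro Xmod_diff Xmod_vscale g h1)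
    then obtain n where n: "n \<in> Xmod D s" "\<And>\<sigma>. \<sigma> \<in> fibre s w \<Longrightarrow> (g - vscale ?b h1) \<sigma> = ?d * n \<sigma>"
      by (rule edge_divisible_simple [OF ed s(2) w]) (use h1 in \<open>auto simp: vscale_def\<close>)
    have "h2 - h1 \<in> Xmod D s" by (intro Xmod_diff h1 h2)
    then obtain m where m: "m \<in> Xmod D s" "\<And>\<sigma>. \<sigma> \<in> fibre s w \<Longrightarrow> n \<sigma> = ?b * m \<sigma>"
      by (rule root_primeD [OF rp \<beta>(1) w(1) np n(1)])
        (use n(2) h2(2) in \<open>auto simp: vscale_def algebra_simps\<close>)
    show ?thesis
    proof (rule that)
      show "h1 + bump a w m \<in> Xmod D s" by (intro Xmod_add Xmod_bump two s h1 m)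
      fix \<sigma> assume "\<sigma> \<in> fibre s w \<union> fibre s ?u"
      then show "g \<sigma> = ?b * (h1 + bump a w m) \<sigma>"
      proof
        assume \<sigma>: "\<sigma> \<in> fibre s w"
        have "g \<sigma> = ?b * h1 \<sigma> + (g - vscale ?b h1) \<sigma>" by (simp add: vscale_def)
        then show ?thesis using n(2) [OF \<sigma>] m(2) [OF \<sigma>] bump_upper [OF two \<sigma>, of a m]
          by (simp add: algebra_simps)
      next
        assume \<sigma>: "\<sigma> \<in> fibre s ?u"
        then show ?thesis using h1(2) [OF \<sigma>] bump_lower [OF s(2) w(1) \<sigma>, of m] by simp
      qed
    qed
  qed
qed

lemma len_mult_S_cases:
  assumes "x \<in> carrier W" "a \<in> S"
  shows "len (x \<otimes>\<^bsub>W\<^esub> a) < len x \<or> len x < len (x \<otimes>\<^bsub>W\<^esub> a)"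
  using len_refl_neq [of "act D x (root_of D a)" x] mult_simple_eq [OF assms] assms
  by (auto simp: neq_iff)

text \<open>Over v the longer word gives the shorter one restricted to two fibres, so the claim is
  the gluing at the longer of v and va.\<close>

lemma root_prime_step:
  assumes two: "(2 :: 'f::field) \<noteq> 0" and s: "s \<in> lists S" "a \<in> S"
    and ed: "edge_divisible TYPE('f) s" and rp: "root_prime TYPE('f) s"
  shows "root_prime TYPE('f) (s @ [a])"
  unfolding root_prime_def
proof (intro allI impI)
  fix \<beta> \<gamma> v and h k :: "('v, 'i, 'f) vec"
  let ?b = "bar D \<beta> :: ('i, 'f) sym_alg" and ?g = "bar D \<gamma> :: ('i, 'f) sym_alg"
  assume \<beta>: "\<beta> \<in> R" and v: "v \<in> carrier W" and np: "\<not> proportional ?b ?g"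
    and hk: "h \<in> Xmod D (s @ [a])" "k \<in> Xmod D (s @ [a])"
    and eq: "\<forall>\<sigma>\<in>fibre (s @ [a]) v. ?g * h \<sigma> = ?b * k \<sigma>"
  obtain h' where h': "h' \<in> Xmod D s" "\<And>\<sigma>. \<sigma> \<in> fibre (s @ [a]) v \<Longrightarrow> h \<sigma> = h' (butlast \<sigma>)"
    by (rule Xmod_fibre_exists [OF s v hk(1)]) (use that in blast)
  obtain k' where k': "k' \<in> Xmod D s" "\<And>\<sigma>. \<sigma> \<in> fibre (s @ [a]) v \<Longrightarrow> k \<sigma> = k' (butlast \<sigma>)"
    by (rule Xmod_fibre_exists [OF s v hk(2)]) (use that in blast)
  have eq': "?g * h' \<tau> = ?b * k' \<tau>" if t: "\<tau> \<in> fibre s v \<union> fibre s (v \<otimes>\<^bsub>W\<^esub> a)" for \<tau>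
  proof -
    obtain \<sigma> where "\<sigma> \<in> fibre (s @ [a]) v" "butlast \<sigma> = \<tau>" by (rule fibre_butlast_surj [OF s v t])
    then show ?thesis using eq h'(2) k'(2) by metis
  qed
  have va: "v \<otimes>\<^bsub>W\<^esub> a \<in> carrier W" "v \<otimes>\<^bsub>W\<^esub> a \<otimes>\<^bsub>W\<^esub> a = v" using v s by (simp_all add: mult_S_S)
  obtain m where m: "m \<in> Xmod D s" "\<And>\<tau>. \<tau> \<in> fibre s v \<union> fibre s (v \<otimes>\<^bsub>W\<^esub> a) \<Longrightarrow> h' \<tau> = ?b * m \<tau>"
  proof (cases "len (v \<otimes>\<^bsub>W\<^esub> a) < len v")
    case True
    show ?thesis by (rule root_prime_pair [OF two s ed rp v True \<beta> np h'(1) k'(1) eq']) (use that in auto)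
  next
    case False
    then have less: "len (v \<otimes>\<^bsub>W\<^esub> a \<otimes>\<^bsub>W\<^esub> a) < len (v \<otimes>\<^bsub>W\<^esub> a)" using len_mult_S_cases [OF v s(2)] va by simp
    show ?thesis by (rule root_prime_pair [OF two s ed rp va(1) less \<beta> np h'(1) k'(1)])
      (use eq' that in \<open>auto simp: va(2)\<close>)
  qed
  show "\<exists>m\<in>Xmod D (s @ [a]). \<forall>\<sigma>\<in>fibre (s @ [a]) v. h \<sigma> = ?b * m \<sigma>"
  proof (intro bexI ballI)
    fix \<sigma> assume \<sigma>: "\<sigma> \<in> fibre (s @ [a]) v"
    show "h \<sigma> = ?b * diag (s @ [a]) m \<sigma>"
      using h'(2) [OF \<sigma>] m(2) [OF butlast_fibre [OF s v \<sigma>]] diag_fibre [OF \<sigma>, of m] by simp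
  qed (rule Xmod_diag [OF m(1)])
qed

lemma edge_divisible_step:
  assumes two: "(2 :: 'f::field) \<noteq> 0" and s: "s \<in> lists S" "a \<in> S" and gkm: "gkm TYPE('f) D (evals D s)"
    and ed: "edge_divisible TYPE('f) s" and rp: "root_prime TYPE('f) s"
  shows "edge_divisible TYPE('f) (s @ [a])"
  unfolding edge_divisible_def
proof (intro allI impI)
  fix \<beta> z and f :: "('v, 'i, 'f) vec"
  let ?b = "bar D \<beta> :: ('i, 'f) sym_alg" and ?\<alpha> = "root_of D a" and ?y = "refl_of D \<beta> \<otimes>\<^bsub>W\<^esub> z"
  assume \<beta>: "\<beta> \<in> R" and z: "z \<in> carrier W" and less: "len ?y < len z"
    and f: "f \<in> Xmod D (s @ [a])" "\<forall>\<sigma>\<in>fibre (s @ [a]) ?y. f \<sigma> = 0"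
  have y: "?y \<in> carrier W" using \<beta> z by simp
  have \<alpha>: "?\<alpha> \<in> R" using s by simp
  obtain p q where pq: "p \<in> Xmod D s" "q \<in> Xmod D s"
    "f = diag (s @ [a]) p + cmul D ?\<alpha> (diag (s @ [a]) q)"
    using f(1) unfolding Xmod_snoc by blast
  \<comment> \<open>Replacing c^\<alpha> by its scalar over \<open>?y\<close> gives an element that
    represents f there; over z it differs from f by a multiple of \<beta>.\<close>
  define g where "g = p + vscale (bar D (act D ?y ?\<alpha>)) q"
  have g: "g \<in> Xmod D s" unfolding g_def by (intro Xmod_add Xmod_vscale pq)
  have g0: "g \<tau> = 0" if t: "\<tau> \<in> fibre s ?y \<union> fibre s (?y \<otimes>\<^bsub>W\<^esub> a)" for \<tau>
  proof -
    obtain \<sigma> where "\<sigma> \<in> fibre (s @ [a]) ?y" "butlast \<sigma> = \<tau>" by (rule fibre_butlast_surj [OF s y t])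
    then show ?thesis using f(2) Xmod_fibre [OF s y pq, of \<sigma>] by (simp add: g_def vscale_def)
  qed
  have za: "z \<otimes>\<^bsub>W\<^esub> a \<in> carrier W" "z \<otimes>\<^bsub>W\<^esub> a \<otimes>\<^bsub>W\<^esub> a = z" using z s by (simp_all add: mult_S_S)
  have yz: "refl_of D \<beta> \<otimes>\<^bsub>W\<^esub> ?y = z" using \<beta> z by (rule refl_mult_cancel)
  have yza: "refl_of D \<beta> \<otimes>\<^bsub>W\<^esub> (z \<otimes>\<^bsub>W\<^esub> a) = ?y \<otimes>\<^bsub>W\<^esub> a" "refl_of D \<beta> \<otimes>\<^bsub>W\<^esub> (?y \<otimes>\<^bsub>W\<^esub> a) = z \<otimes>\<^bsub>W\<^esub> a"
    using \<beta> z s yz by (simp_all flip: W.m_assoc)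
  obtain h where h: "h \<in> Xmod D s" "\<And>\<tau>. \<tau> \<in> fibre s z \<union> fibre s (z \<otimes>\<^bsub>W\<^esub> a) \<Longrightarrow> g \<tau> = ?b * h \<tau>"
  proof (cases "z = ?y \<otimes>\<^bsub>W\<^esub> a")
    case True
    \<comment> \<open>The edge joins the two fibres that the last letter merges, so g vanishes over
      both of them.\<close>
    then have "z \<otimes>\<^bsub>W\<^esub> a = ?y" using mult_S_S [OF s(2) y] by simp
    then have "g \<tau> = 0" if "\<tau> \<in> fibre s z \<union> fibre s (z \<otimes>\<^bsub>W\<^esub> a)" for \<tau>
      using g0 [of \<tau>] True that by auto
    then show ?thesis using that [OF Xmod_zero] by simp
  next
    case False
    \<comment> \<open>Lifting makes the second edge descend as well, so the gluing applies at the
      longer of z and za.\<close>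
    have lessa: "len (?y \<otimes>\<^bsub>W\<^esub> a) < len (z \<otimes>\<^bsub>W\<^esub> a)"
      using len_lift [OF \<beta> y s(2)] less False unfolding yz yza by blast
    show ?thesis
    proof (cases "len (z \<otimes>\<^bsub>W\<^esub> a) < len z")
      case True
      have neq: "?y \<noteq> z \<otimes>\<^bsub>W\<^esub> a" using False za(2) by auto
      show ?thesis
        by (rule edge_divisible_pair [OF two s gkm ed rp z True \<beta> less _ neq g])
          (use lessa g0 that in \<open>auto simp: yza\<close>)
    next
      case False2: False
      then have lz: "len (z \<otimes>\<^bsub>W\<^esub> a \<otimes>\<^bsub>W\<^esub> a) < len (z \<otimes>\<^bsub>W\<^esub> a)" using len_mult_S_cases [OF z s(2)] za by simp
      show ?thesis
        by (rule edge_divisible_pair [OF two s gkm ed rp za(1) lz \<beta> _ _ _ g])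
          (use lessa less g0 that False in \<open>auto simp: yza(1) za(2)\<close>)
    qed
  qed
  \<comment> \<open>This integer measures the difference of the scalars of c^\<alpha> over z and
    \<open>?y\<close>, which is -m\<beta>.\<close>
  obtain m where m: "coroot D (fst \<beta>) (fst (act D ?y ?\<alpha>)) = of_int m"
    using coroot_int [of "fst \<beta>" "fst (act D ?y ?\<alpha>)"] \<beta> act_roots [OF y \<alpha>]
    by (auto simp: aff_roots_def mem_Times_iff elim: Ints_cases)
  have "z = refl_of D \<beta> \<otimes>\<^bsub>W\<^esub> ?y" using yz by simp
  then have "act D z ?\<alpha> = lin_refl D \<beta> (act D ?y ?\<alpha>)"
    using act_mult [OF refl_carrier [OF \<beta>] y] act_refl [OF \<beta>] by metis
  also have "\<dots> = act D ?y ?\<alpha> + aff_scale D (of_int (- m)) \<beta>"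
    by (simp add: lin_refl_def m aff_scale_def prod_eq_iff)
  finally have "(bar D (act D z ?\<alpha>) :: ('i, 'f) sym_alg) = bar D (act D ?y ?\<alpha>) + const (of_int (- m)) * ?b"
    using y \<alpha> \<beta> by (simp only: bar_add bar_scale R_subset_aff_weights act_roots aff_weights_scale)
  then have bz: "(bar D (act D z ?\<alpha>) :: ('i, 'f) sym_alg) = bar D (act D ?y ?\<alpha>) - const (of_int m) * ?b"
    by (simp add: const_uminus)
  show "\<exists>h\<in>Xmod D (s @ [a]). \<forall>\<sigma>\<in>fibre (s @ [a]) z. f \<sigma> = ?b * h \<sigma>"
  proof (intro bexI ballI)
    fix \<sigma> assume \<sigma>: "\<sigma> \<in> fibre (s @ [a]) z"
    have "f \<sigma> = g (butlast \<sigma>) - const (of_int m) * ?b * q (butlast \<sigma>)"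
      using Xmod_fibre [OF s z pq \<sigma>] by (simp add: bz g_def vscale_def algebra_simps)
    then show "f \<sigma> = ?b * diag (s @ [a]) (h - vscale (const (of_int m)) q) \<sigma>"
      using h(2) [OF butlast_fibre [OF s z \<sigma>]] by (simp add: diag_fibre [OF \<sigma>] vscale_def algebra_simps)
  qed (intro Xmod_diag Xmod_diff Xmod_vscale h pq)
qed

lemma evals_butlast: "evals D s \<subseteq> evals D (s @ [a])"
proof
  fix x assume "x \<in> evals D s"
  then obtain \<tau> where "\<tau> \<in> subseqs_of s" "x = ev D (\<tau> @ [None])" by (auto simp: evals_def)
  then show "x \<in> evals D (s @ [a])" unfolding evals_def
    by (intro image_eqI [of _ _ "\<tau> @ [None]"]) (auto simp: subseqs_of_snoc)
qed

lemma len_one: "len \<one>\<^bsub>W\<^esub> = 0"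
  using len_le [of "[]"] by simp

lemma fibre_Nil: "\<sigma> \<in> fibre [] x \<longleftrightarrow> \<sigma> = [] \<and> x = \<one>\<^bsub>W\<^esub>"
  by (auto simp: subseqs_at_def)

lemma edge_divisible_root_prime:
  assumes two: "(2 :: 'f::field) \<noteq> 0" and "s \<in> lists S" and "gkm TYPE('f) D (evals D s)"
  shows "edge_divisible TYPE('f) s \<and> root_prime TYPE('f) s"
  using assms(2-)
proof (induction s rule: rev_induct)
  case Nil
  have "edge_divisible TYPE('f) []"
    unfolding edge_divisible_def fibre_Nil
  proof (intro allI impI)
    fix \<beta> z and f :: "('v, 'i, 'f) vec"
    assume "len (refl_of D \<beta> \<otimes>\<^bsub>W\<^esub> z) < len z" "f \<in> Xmod D []"
    \<comment> \<open>The only nonempty fibre lies over the unit, which has length 0 and hence no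
      descending edge.\<close>
    then have "z \<noteq> \<one>\<^bsub>W\<^esub>" using len_one by auto
    then show "\<exists>h\<in>Xmod D []. \<forall>\<sigma>\<in>fibre [] z. f \<sigma> = bar D \<beta> * h \<sigma>"
      by (intro bexI [of _ 0]) (auto simp: fibre_Nil Xmod_zero)
  qed
  moreover have "root_prime TYPE('f) []"
    unfolding root_prime_def
  proof (intro allI impI)
    fix \<beta> \<gamma> v and h k :: "('v, 'i, 'f) vec"
    let ?b = "bar D \<beta> :: ('i, 'f) sym_alg" and ?g = "bar D \<gamma> :: ('i, 'f) sym_alg"
    assume \<beta>: "\<beta> \<in> R" and np: "\<not> proportional ?b ?g" and eq: "\<forall>\<sigma>\<in>fibre [] v. ?g * h \<sigma> = ?b * k \<sigma>"
    show "\<exists>m\<in>Xmod D []. \<forall>\<sigma>\<in>fibre [] v. h \<sigma> = ?b * m \<sigma>"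
    proof (cases "v = \<one>\<^bsub>W\<^esub>")
      case True
      then have "?g * h [] = ?b * k []" using eq by (auto simp: fibre_Nil)
      then obtain r where "h [] = ?b * r" using bar_prime [OF \<beta> two _ np] by blast
      then show ?thesis
        by (intro bexI [of _ "\<lambda>\<sigma>. if \<sigma> = [] then r else 0"]) (auto simp: fibre_Nil Xmod_Nil)
    next
      case False
      then show ?thesis by (intro bexI [of _ 0]) (auto simp: fibre_Nil Xmod_zero)
    qed
  qed
  ultimately show ?case ..
next
  case (snoc a s)
  have s: "s \<in> lists S" "a \<in> S" using snoc.prems by auto
  have gkm: "gkm TYPE('f) D (evals D s)"
    using snoc.prems(2) by (rule gkm_mono) (rule evals_butlast)
  then show ?case using snoc.IH s edge_divisible_step [OF two s gkm] root_prime_step [OF two s] by blast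
qed

end

section \<open>Bases over a fibre\<close>

text \<open>Lists turn the joining of subtrees into concatenation and keep the order of the leaves.
  Because of \<open>zip\<close>, surplus entries of the longer list are ignored.\<close>

definition lin_comb :: "('i, 'f::field) sym_alg list \<Rightarrow> ('v, 'i, 'f) vec list \<Rightarrow> ('v, 'i, 'f) vec" where
  "lin_comb cs bs \<sigma> = (\<Sum>(c, b)\<leftarrow>zip cs bs. c * b \<sigma>)"

lemma lin_comb_append:
  "length cs = length bs \<Longrightarrow> lin_comb (cs @ ds) (bs @ es) \<sigma> = lin_comb cs bs \<sigma> + lin_comb ds es \<sigma>"
  by (simp add: lin_comb_def)

lemma lin_comb_Nil [simp]: "lin_comb cs [] \<sigma> = 0" "lin_comb [] bs \<sigma> = 0"
  and lin_comb_Cons [simp]: "lin_comb (c # cs) (b # bs) \<sigma> = c * b \<sigma> + lin_comb cs bs \<sigma>"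
  by (simp_all add: lin_comb_def)

lemma lin_comb_map_cong:
  "(\<And>b. b \<in> set bs \<Longrightarrow> F b \<sigma> = p * b \<tau>) \<Longrightarrow> lin_comb cs (map F bs) \<sigma> = p * lin_comb cs bs \<tau>"
proof (induction cs arbitrary: bs)
  case (Cons c cs)
  then show ?case by (cases bs) (auto simp: algebra_simps)
qed simp

lemma lin_comb_map_map:
  "lin_comb (map f xs) (map g xs) \<sigma> = (\<Sum>x\<leftarrow>xs. f x * g x \<sigma>)"
  by (induction xs) auto

lemma Xmod_lin_comb: "set bs \<subseteq> Xmod D s \<Longrightarrow> lin_comb cs bs \<in> Xmod D s"
proof (induction cs arbitrary: bs)
  case Nil
  have "lin_comb [] bs = 0" by (simp add: fun_eq_iff)
  then show ?case using Xmod_zero by metis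
next
  case (Cons c cs)
  show ?case
  proof (cases bs)
    case Nil
    have "lin_comb (c # cs) [] = 0" by (simp add: fun_eq_iff)
    then show ?thesis using Nil Xmod_zero by metis
  next
    case (Cons b bs')
    have "lin_comb (c # cs) bs = vscale c b + lin_comb cs bs'"
      by (simp add: Cons fun_eq_iff vscale_def)
    moreover have "b \<in> Xmod D s" "lin_comb cs bs' \<in> Xmod D s"
      using Cons Cons.IH [of bs'] Cons.prems by auto
    ultimately show ?thesis by (simp only: Xmod_add Xmod_vscale)
  qed
qed

section \<open>Path vectors and their dependence on prefixes\<close>

lemma path_seq_butlast:
  "length \<pi> = length s \<Longrightarrow> path_seq (s @ [a]) (\<pi> @ [e]) = path_seq s \<pi> @ [if colour e \<noteq> 0 then Some a else None]"
  by (simp add: path_seq_def)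

lemma path_seq_prefix: "length \<pi> \<le> length s \<Longrightarrow> path_seq (s @ t) \<pi> = path_seq s \<pi>"
  by (simp add: path_seq_def)

lemma path_vec_Nil: "path_vec D s [] = (\<lambda>\<sigma>. if \<sigma> = [] then 1 else 0)"
  by (subst path_vec.simps) simp

lemma path_vec_snoc:
  "path_vec D s (\<pi> @ [e]) = diag (take (Suc (length \<pi>)) s)
     (if tilt e = Left_Tilted
      then vscale (const (1 / 2)) (cmul D (root_label e) (path_vec D s \<pi>)
             + vscale (bar D (act D (ev D (path_seq s \<pi>)) (root_label e))) (path_vec D s \<pi>))
      else path_vec D s \<pi>)"
  by (subst path_vec.simps) (simp add: Let_def)

text \<open>Reconciles \<open>path_vec\<close>, which is given the full sequence, with the induction
  on the sequence.\<close>

lemma path_vec_prefix: "length \<pi> \<le> length s \<Longrightarrow> path_vec D (s @ t) \<pi> = path_vec D s \<pi>"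
  by (induction \<pi> rule: rev_induct) (simp_all add: path_vec_Nil path_vec_snoc path_seq_prefix)

lemma sum_vec_apply: "(\<Sum>x\<in>A. f x) \<sigma> = (\<Sum>x\<in>A. (f x :: ('v, 'i, 'f::field) vec) \<sigma>)"
  by (induction A rule: infinite_finite_induct) auto

lemma module_vscale: "module (vscale :: ('i, 'f::field) sym_alg \<Rightarrow> ('v, 'i, 'f) vec \<Rightarrow> ('v, 'i, 'f) vec)"
  by unfold_locales (auto simp: vscale_def fun_eq_iff algebra_simps)

context affine_setting
begin

text \<open>The vectors stay elements of the whole module and are only compared on the fibre, so
  that \<open>bump\<close> and \<open>diag\<close> can be applied to them.\<close>

definition fibre_basis :: "'v aff list \<Rightarrow> 'v aff \<Rightarrow> ('v, 'i, 'f::field) vec list \<Rightarrow> bool" where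
  "fibre_basis s x bs \<longleftrightarrow> set bs \<subseteq> Xmod D s
     \<and> (\<forall>f\<in>Xmod D s. \<exists>cs. length cs = length bs \<and> (\<forall>\<sigma>\<in>fibre s x. f \<sigma> = lin_comb cs bs \<sigma>))
     \<and> (\<forall>cs. length cs = length bs \<longrightarrow> (\<forall>\<sigma>\<in>fibre s x. lin_comb cs bs \<sigma> = 0) \<longrightarrow> set cs \<subseteq> {0})"

lemma fibre_basis_span:
  assumes "fibre_basis s x bs" "f \<in> Xmod D s"
  obtains cs where "length cs = length bs" "\<And>\<sigma>. \<sigma> \<in> fibre s x \<Longrightarrow> f \<sigma> = lin_comb cs bs \<sigma>"
  using assms unfolding fibre_basis_def by metis

lemma fibre_basis_indep:
  "fibre_basis s x bs \<Longrightarrow> length cs = length bs \<Longrightarrow> (\<And>\<sigma>. \<sigma> \<in> fibre s x \<Longrightarrow> lin_comb cs bs \<sigma> = 0) \<Longrightarrow> set cs \<subseteq> {0}"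
  unfolding fibre_basis_def by blast

lemma fibre_basis_subset: "fibre_basis s x bs \<Longrightarrow> set bs \<subseteq> Xmod D s"
  unfolding fibre_basis_def by blast

lemma lin_comb_diag:
  "\<sigma> \<in> fibre s x \<Longrightarrow> lin_comb cs (map (diag s) bs) \<sigma> = lin_comb cs bs (butlast \<sigma>)"
  using lin_comb_map_cong [of bs "diag s" \<sigma> 1 "butlast \<sigma>" cs] by (simp add: diag_fibre)

text \<open>Dropping the last entry maps the fibre over x onto the union of two shorter fibres, and
  there every restriction comes from the shorter word; so spanning and independence carry
  over.\<close>

lemma fibre_basis_diag:
  fixes bs :: "('v, 'i, 'f::field) vec list"
  assumes s: "s \<in> lists S" "a \<in> S" and x: "x \<in> carrier W"
    and sub: "set bs \<subseteq> Xmod D s"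
    and span: "\<And>f. f \<in> Xmod D s \<Longrightarrow> \<exists>cs. length cs = length bs \<and>
      (\<forall>\<tau>\<in>fibre s x \<union> fibre s (x \<otimes>\<^bsub>W\<^esub> a). f \<tau> = lin_comb cs bs \<tau>)"
    and indep: "\<And>cs. length cs = length bs \<Longrightarrow>
      (\<And>\<tau>. \<tau> \<in> fibre s x \<union> fibre s (x \<otimes>\<^bsub>W\<^esub> a) \<Longrightarrow> lin_comb cs bs \<tau> = 0) \<Longrightarrow> set cs \<subseteq> {0}"
  shows "fibre_basis (s @ [a]) x (map (diag (s @ [a])) bs)"
  unfolding fibre_basis_def
proof (intro conjI ballI allI impI)
  show "set (map (diag (s @ [a])) bs) \<subseteq> Xmod D (s @ [a])" using sub by (auto intro: Xmod_diag)
next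
  fix f :: "('v, 'i, 'f) vec" assume f: "f \<in> Xmod D (s @ [a])"
  obtain g where g: "g \<in> Xmod D s" "\<And>\<sigma>. \<sigma> \<in> fibre (s @ [a]) x \<Longrightarrow> f \<sigma> = g (butlast \<sigma>)"
    by (rule Xmod_fibre_exists [OF s x f]) (use that in blast)
  obtain cs where "length cs = length bs"
    "\<forall>\<tau>\<in>fibre s x \<union> fibre s (x \<otimes>\<^bsub>W\<^esub> a). g \<tau> = lin_comb cs bs \<tau>" using span [OF g(1)] by blast
  then show "\<exists>cs. length cs = length (map (diag (s @ [a])) bs) \<and>
      (\<forall>\<sigma>\<in>fibre (s @ [a]) x. f \<sigma> = lin_comb cs (map (diag (s @ [a])) bs) \<sigma>)"
    using g(2) butlast_fibre [OF s x] by (intro exI [of _ cs]) (auto simp: lin_comb_diag)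
next
  fix cs :: "('i, 'f) sym_alg list"
  assume cs: "length cs = length (map (diag (s @ [a])) bs)"
    "\<forall>\<sigma>\<in>fibre (s @ [a]) x. lin_comb cs (map (diag (s @ [a])) bs) \<sigma> = 0"
  show "set cs \<subseteq> {0}"
  proof (rule indep)
    fix \<tau> assume "\<tau> \<in> fibre s x \<union> fibre s (x \<otimes>\<^bsub>W\<^esub> a)"
    then obtain \<sigma> where "\<sigma> \<in> fibre (s @ [a]) x" "butlast \<sigma> = \<tau>" by (rule fibre_butlast_surj [OF s x])
    then show "lin_comb cs bs \<tau> = 0" using cs(2) lin_comb_diag by metis
  qed (use cs in simp)
qed

text \<open>The system is triangular. \<open>bump\<close> vanishes over the lower fibre, so the
  coefficients of \<open>bs\<close> are read off there; the remainder over w is divisible by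
  w(\<alpha>), and its quotient is expanded in \<open>es\<close>.\<close>

lemma fibre_pair_basis:
  fixes bs es :: "('v, 'i, 'f::field) vec list"
  assumes two: "(2 :: 'f) \<noteq> 0" and s: "s \<in> lists S" "a \<in> S" and ed: "edge_divisible TYPE('f) s"
    and w: "w \<in> carrier W" "len (w \<otimes>\<^bsub>W\<^esub> a) < len w"
    and bs: "fibre_basis s (w \<otimes>\<^bsub>W\<^esub> a) bs" and es: "fibre_basis s w es"
  defines "B \<equiv> bs @ map (bump a w) es"
  shows "set B \<subseteq> Xmod D s"
    and "f \<in> Xmod D s \<Longrightarrow> \<exists>cs. length cs = length B \<and>
      (\<forall>\<tau>\<in>fibre s w \<union> fibre s (w \<otimes>\<^bsub>W\<^esub> a). f \<tau> = lin_comb cs B \<tau>)"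
    and "length cs = length B \<Longrightarrow>
      (\<And>\<tau>. \<tau> \<in> fibre s w \<union> fibre s (w \<otimes>\<^bsub>W\<^esub> a) \<Longrightarrow> lin_comb cs B \<tau> = 0) \<Longrightarrow> set cs \<subseteq> {0}"
proof -
  let ?u = "w \<otimes>\<^bsub>W\<^esub> a" and ?\<delta> = "act D w (root_of D a)"
  let ?d = "bar D ?\<delta> :: ('i, 'f) sym_alg"
  have \<delta>: "?\<delta> \<in> R" using w s by simp
  have up: "lin_comb ds (map (bump a w) es) \<tau> = ?d * lin_comb ds es \<tau>" if "\<tau> \<in> fibre s w" for ds \<tau>
    by (rule lin_comb_map_cong) (rule bump_upper [OF two that])
  have low: "lin_comb ds (map (bump a w) es) \<tau> = 0" if "\<tau> \<in> fibre s ?u" for ds \<tau>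
  proof -
    have "lin_comb ds (map (bump a w) es) \<tau> = 0 * lin_comb ds es \<tau>"
      by (rule lin_comb_map_cong) (simp only: mult_zero_left bump_lower [OF s(2) w(1) that])
    then show ?thesis by simp
  qed
  show "set B \<subseteq> Xmod D s"
    using fibre_basis_subset [OF bs] fibre_basis_subset [OF es] Xmod_bump [OF two s] by (auto simp: B_def)
  show "\<exists>cs. length cs = length B \<and> (\<forall>\<tau>\<in>fibre s w \<union> fibre s ?u. f \<tau> = lin_comb cs B \<tau>)"
    if f: "f \<in> Xmod D s"
  proof -
    obtain cs where cs: "length cs = length bs" "\<And>\<sigma>. \<sigma> \<in> fibre s ?u \<Longrightarrow> f \<sigma> = lin_comb cs bs \<sigma>"
      by (rule fibre_basis_span [OF bs f]) (use that in blast)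
    have "f - lin_comb cs bs \<in> Xmod D s"
      using f Xmod_lin_comb [OF fibre_basis_subset [OF bs]] by (rule Xmod_diff)
    then obtain h where h: "h \<in> Xmod D s" "\<And>\<sigma>. \<sigma> \<in> fibre s w \<Longrightarrow> (f - lin_comb cs bs) \<sigma> = ?d * h \<sigma>"
      by (rule edge_divisible_simple [OF ed s(2) w]) (use cs in auto)
    obtain ds where ds: "length ds = length es" "\<And>\<sigma>. \<sigma> \<in> fibre s w \<Longrightarrow> h \<sigma> = lin_comb ds es \<sigma>"
      by (rule fibre_basis_span [OF es h(1)]) (use that in blast)
    have "f \<tau> = lin_comb (cs @ ds) B \<tau>" if "\<tau> \<in> fibre s w \<union> fibre s ?u" for \<tau>
      using that
    proof
      assume \<tau>: "\<tau> \<in> fibre s w"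
      have "f \<tau> = lin_comb cs bs \<tau> + (f - lin_comb cs bs) \<tau>" by simp
      then show ?thesis unfolding B_def lin_comb_append [OF cs(1)] up [OF \<tau>] h(2) [OF \<tau>] ds(2) [OF \<tau>] .
    next
      assume \<tau>: "\<tau> \<in> fibre s ?u"
      show ?thesis unfolding B_def lin_comb_append [OF cs(1)] low [OF \<tau>] cs(2) [OF \<tau>] by simp
    qed
    then show ?thesis using cs(1) ds(1) by (intro exI [of _ "cs @ ds"]) (simp add: B_def)
  qed
  show "set cs \<subseteq> {0}" if len: "length cs = length B"
    and 0: "\<And>\<tau>. \<tau> \<in> fibre s w \<union> fibre s ?u \<Longrightarrow> lin_comb cs B \<tau> = 0"
  proof -
    define c1 c2 where "c1 = take (length bs) cs" and "c2 = drop (length bs) cs"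
    have c: "cs = c1 @ c2" "length c1 = length bs" "length c2 = length es"
      using len by (simp_all add: c1_def c2_def B_def)
    have split: "lin_comb cs B \<tau> = lin_comb c1 bs \<tau> + lin_comb c2 (map (bump a w) es) \<tau>" for \<tau>
      unfolding B_def c(1) by (rule lin_comb_append [OF c(2)])
    have "lin_comb c1 bs \<tau> = 0" if "\<tau> \<in> fibre s ?u" for \<tau>
      using 0 [of \<tau>] split low [OF that] that by simp
    then have c1: "set c1 \<subseteq> {0}" by (rule fibre_basis_indep [OF bs c(2)])
    then have z: "lin_comb c1 bs \<tau> = 0" for \<tau>
      using c(2)
    proof (induction c1 arbitrary: bs)
      case (Cons c c1)
      then show ?case by (cases bs) auto
    qed simp
    have "lin_comb c2 es \<tau> = 0" if \<tau>: "\<tau> \<in> fibre s w" for \<tau>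
    proof -
      have "?d * lin_comb c2 es \<tau> = 0" using 0 [of \<tau>] split z up [OF \<tau>] \<tau> by simp
      then show ?thesis using bar_cancel [OF \<delta> two] by blast
    qed
    then have "set c2 \<subseteq> {0}" by (rule fibre_basis_indep [OF es c(3)])
    then show ?thesis using c1 c(1) by auto
  qed
qed

section \<open>Trees and paths\<close>

lemma tree_Nil: "tree D [] x = (if x = \<one>\<^bsub>W\<^esub> then Some (Vertex []) else None)"
  by (subst tree.simps) simp

lemma tree_snoc:
  assumes "x \<in> carrier W" "a \<in> S"
  defines "xa \<equiv> x \<otimes>\<^bsub>W\<^esub> a"
  defines "y \<equiv> (if len x < len xa then x else xa)" and "z \<equiv> (if len x < len xa then xa else x)"
  shows "tree D (s @ [a]) x =
    (if fibre s y \<noteq> {} \<and> fibre s z \<noteq> {} then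
       Some (Vertex
         [(Edge Right_Tilted (if x = z then 1 else 0) (root_of D a), the (tree D s y)),
          (Edge Left_Tilted (if x = z then 0 else - 1) (root_of D a), the (tree D s z))])
     else if fibre s y \<noteq> {} then
       Some (Vertex [(Edge Vertical (if x = y then 0 else 1) (root_of D a), the (tree D s y))])
     else None)"
proof -
  have "aff_less D x xa \<longleftrightarrow> len x < len xa"
    using aff_less_iff [of x "act D x (root_of D a)"] mult_simple_eq [OF assms(1,2)] assms(1,2)
    by (simp add: xa_def)
  then show ?thesis
    by (subst tree.simps) (simp add: Let_def y_def z_def flip: xa_def)
qed

text \<open>Rules out an empty lower fibre with a nonempty upper one, so the last branch of
  \<open>tree\<close> really means that both are empty.\<close>

lemma fibre_downward:
  assumes "s \<in> lists S" "a \<in> S" "w \<in> carrier W" "len (w \<otimes>\<^bsub>W\<^esub> a) < len w" "fibre s w \<noteq> {}"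
  shows "fibre s (w \<otimes>\<^bsub>W\<^esub> a) \<noteq> {}"
proof -
  have "w \<in> evals D s" using assms(5) fibre_nonempty by blast
  then have "w \<otimes>\<^bsub>W\<^esub> a \<in> evals D s"
    using evals_downward [OF assms(1), of w "act D w (root_of D a)"] assms mult_simple_eq [OF assms(3,2)]
    by simp
  then show ?thesis by (auto simp: evals_def subseqs_at_def)
qed

text \<open>The three cases of the recursive definition of the tree, with \<open>w\<close> the larger of \<open>x\<close> and \<open>xs\<^sub>l\<close>.\<close>

lemma tree_cases:
  assumes s: "s \<in> lists S" "a \<in> S" and x: "x \<in> carrier W"
  obtains w where "w \<in> carrier W" "len (w \<otimes>\<^bsub>W\<^esub> a) < len w"
    "x = w \<and> x \<otimes>\<^bsub>W\<^esub> a = w \<otimes>\<^bsub>W\<^esub> a \<or> x = w \<otimes>\<^bsub>W\<^esub> a \<and> x \<otimes>\<^bsub>W\<^esub> a = w" "w \<noteq> w \<otimes>\<^bsub>W\<^esub> a"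
    "fibre s (w \<otimes>\<^bsub>W\<^esub> a) \<noteq> {} \<Longrightarrow> fibre s w \<noteq> {} \<Longrightarrow> tree D (s @ [a]) x = Some (Vertex
         [(Edge Right_Tilted (if x = w then 1 else 0) (root_of D a), the (tree D s (w \<otimes>\<^bsub>W\<^esub> a))),
          (Edge Left_Tilted (if x = w then 0 else - 1) (root_of D a), the (tree D s w))])"
    "fibre s (w \<otimes>\<^bsub>W\<^esub> a) \<noteq> {} \<Longrightarrow> fibre s w = {} \<Longrightarrow> tree D (s @ [a]) x = Some (Vertex
         [(Edge Vertical (if x = w \<otimes>\<^bsub>W\<^esub> a then 0 else 1) (root_of D a), the (tree D s (w \<otimes>\<^bsub>W\<^esub> a)))])"
    "fibre s (w \<otimes>\<^bsub>W\<^esub> a) = {} \<Longrightarrow> fibre s w = {} \<and> tree D (s @ [a]) x = None"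
proof -
  define w where "w = (if len x < len (x \<otimes>\<^bsub>W\<^esub> a) then x \<otimes>\<^bsub>W\<^esub> a else x)"
  have w: "w \<in> carrier W" using x s by (simp add: w_def)
  have xaa: "x \<otimes>\<^bsub>W\<^esub> a \<otimes>\<^bsub>W\<^esub> a = x" by (rule mult_S_S [OF s(2) x])
  have wa: "w \<otimes>\<^bsub>W\<^esub> a = (if len x < len (x \<otimes>\<^bsub>W\<^esub> a) then x else x \<otimes>\<^bsub>W\<^esub> a)"
    by (simp add: w_def xaa)
  have less: "len (w \<otimes>\<^bsub>W\<^esub> a) < len w" using len_mult_S_cases [OF x s(2)] by (auto simp: w_def xaa)
  note t = tree_snoc [OF x s(2), of s, folded w_def wa]
  show ?thesis
  proof (rule that [OF w less])
    show "x = w \<and> x \<otimes>\<^bsub>W\<^esub> a = w \<otimes>\<^bsub>W\<^esub> a \<or> x = w \<otimes>\<^bsub>W\<^esub> a \<and> x \<otimes>\<^bsub>W\<^esub> a = w"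
      by (simp add: w_def xaa)
    show "fibre s w = {} \<and> tree D (s @ [a]) x = None" if "fibre s (w \<otimes>\<^bsub>W\<^esub> a) = {}"
      using that t fibre_downward [OF s w less] by auto
    show "w \<noteq> w \<otimes>\<^bsub>W\<^esub> a" using less by auto
  qed (simp_all add: t)
qed

lemma fibre_snoc_empty:
  assumes "s \<in> lists S" "a \<in> S" "x \<in> carrier W"
  shows "fibre (s @ [a]) x = {} \<longleftrightarrow> fibre s x \<union> fibre s (x \<otimes>\<^bsub>W\<^esub> a) = {}"
  using fibre_snoc [OF assms] by blast

lemma tree_None_iff:
  assumes "s \<in> lists S" "x \<in> carrier W"
  shows "tree D s x = None \<longleftrightarrow> fibre s x = {}"
  using assms
proof (induction s arbitrary: x rule: rev_induct)
  case Nil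
  then show ?case using fibre_Nil by (auto simp: tree_Nil)
next
  case (snoc a s)
  have s: "s \<in> lists S" "a \<in> S" using snoc.prems by auto
  show ?case
    by (rule tree_cases [OF s snoc.prems(2)]) (use fibre_snoc_empty [OF s snoc.prems(2)] in \<open>metis option.distinct(1) Un_empty\<close>)
qed

lemma max_paths_the_tree:
  assumes "s \<in> lists S" "x \<in> carrier W" "fibre s x \<noteq> {}"
  shows "leaf_paths (the (tree D s x)) = max_paths (tree D s x)"
  using tree_None_iff [OF assms(1,2)] assms(3) by (auto simp: max_paths_def)

text \<open>The condition on the fibre fixes \<open>ev\<close> of the path, and with it the scalar
  that \<open>path_vec\<close> uses at a following left tilted edge.\<close>

definition good_path :: "'f::field itself \<Rightarrow> 'v aff list \<Rightarrow> 'v aff \<Rightarrow> ('v \<times> rat) path \<Rightarrow> bool" where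
  "good_path F s x \<pi> \<longleftrightarrow> length \<pi> = length s \<and> path_seq s \<pi> \<in> fibre s x
     \<and> homogeneous_vec (path_vec D s \<pi> :: ('v, 'i, 'f) vec)"

lemma homogeneous_diag: "homogeneous_vec f \<Longrightarrow> homogeneous_vec (diag s f)"
  unfolding homogeneous_vec_def diag_def by (metis homogeneous_zero)

lemma homogeneous_bump: "homogeneous_vec f \<Longrightarrow> homogeneous_vec (bump a w f)"
proof -
  assume "homogeneous_vec f"
  then obtain d where d: "\<And>\<sigma>. homogeneous d (f \<sigma>)" by (auto simp: homogeneous_vec_def)
  have "homogeneous (0 + (2 + d)) (bump a w f \<sigma>)" for \<sigma>
    unfolding bump_def vscale_def cmul_def plus_fun_apply
    by (intro homogeneous_mult homogeneous_add homogeneous_const homogeneous_bar d)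
  then show ?thesis unfolding homogeneous_vec_def by blast
qed

lemma path_vec_snoc_eq:
  assumes "length \<pi> = length s" "root_label e = root_of D a"
  shows "path_vec D (s @ [a]) (\<pi> @ [e]) = diag (s @ [a])
    (if tilt e = Left_Tilted then bump a (ev D (path_seq s \<pi>)) (path_vec D s \<pi>) else path_vec D s \<pi>)"
  unfolding path_vec_snoc using assms
  by (simp add: path_vec_prefix path_seq_prefix bump_def)

text \<open>Colour 0 contributes a blank and any other colour contributes a, so y is the element
  whose tree the new edge comes from.\<close>

lemma good_path_snoc:
  assumes s: "s \<in> lists S" "a \<in> S" and x: "x \<in> carrier W" and y: "y = (if colour e = 0 then x else x \<otimes>\<^bsub>W\<^esub> a)"
    and \<pi>: "good_path TYPE('f::field) s y \<pi>" and e: "root_label e = root_of D a"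
  shows "good_path TYPE('f) (s @ [a]) x (\<pi> @ [e])"
    and "path_vec D (s @ [a]) (\<pi> @ [e]) = diag (s @ [a])
      (if tilt e = Left_Tilted then bump a y (path_vec D s \<pi> :: ('v, 'i, 'f) vec) else path_vec D s \<pi>)"
proof -
  have l: "length \<pi> = length s" and f: "path_seq s \<pi> \<in> fibre s y"
    and h: "homogeneous_vec (path_vec D s \<pi> :: ('v, 'i, 'f) vec)"
    using \<pi> by (auto simp: good_path_def)
  show pv: "path_vec D (s @ [a]) (\<pi> @ [e]) = diag (s @ [a])
      (if tilt e = Left_Tilted then bump a y (path_vec D s \<pi> :: ('v, 'i, 'f) vec) else path_vec D s \<pi>)"
    by (simp only: path_vec_snoc_eq [OF l e] fibreD(2) [OF f])
  have "path_seq (s @ [a]) (\<pi> @ [e]) \<in> fibre (s @ [a]) x"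
    unfolding path_seq_butlast [OF l] using f by (auto simp: fibre_snoc [OF s x] y split: if_splits)
  then show "good_path TYPE('f) (s @ [a]) x (\<pi> @ [e])"
    unfolding good_path_def using l by (simp add: pv h homogeneous_bump homogeneous_diag)
qed

text \<open>Goodness of the paths goes through the same induction because it identifies the operator
  at a left tilted edge with \<open>bump a w\<close>.\<close>

lemma path_basis:
  assumes two: "(2 :: 'f::field) \<noteq> 0" and "s \<in> lists S" "gkm TYPE('f) D (evals D s)" "x \<in> carrier W"
  shows "(\<forall>\<pi>\<in>set (max_paths (tree D s x)). good_path TYPE('f) s x \<pi>)
    \<and> fibre_basis s x (map (path_vec D s :: _ \<Rightarrow> ('v, 'i, 'f) vec) (max_paths (tree D s x)))"
  using assms(2-)
proof (induction s arbitrary: x rule: rev_induct)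
  case Nil
  show ?case
  proof (cases "x = \<one>\<^bsub>W\<^esub>")
    case True
    have "good_path TYPE('f) [] x []"
      using homogeneous_one [where ?'f = 'f and ?'i = 'i] homogeneous_zero
      unfolding good_path_def homogeneous_vec_def path_vec_Nil
      by (auto simp: fibre_Nil True path_seq_def intro!: exI [of _ 0])
    moreover have "fibre_basis [] x [path_vec D [] [] :: ('v, 'i, 'f) vec]"
      unfolding fibre_basis_def path_vec_Nil
    proof (intro conjI ballI allI impI)
      fix f :: "('v, 'i, 'f) vec"
      show "\<exists>cs. length cs = length [\<lambda>\<sigma>. if \<sigma> = [] then 1 else (0 :: ('i, 'f) sym_alg)] \<and>
          (\<forall>\<sigma>\<in>fibre [] x. f \<sigma> = lin_comb cs [\<lambda>\<sigma>. if \<sigma> = [] then 1 else 0] \<sigma>)"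
        by (intro exI [of _ "[f []]"]) (auto simp: fibre_Nil)
    next
      fix cs :: "('i, 'f) sym_alg list"
      assume "length cs = length [\<lambda>\<sigma>::'v subseq. if \<sigma> = [] then 1 else (0 :: ('i, 'f) sym_alg)]"
        and 0: "\<forall>\<sigma>\<in>fibre [] x. lin_comb cs [\<lambda>\<sigma>. if \<sigma> = [] then 1 else 0] \<sigma> = 0"
      then obtain c where "cs = [c]" by (auto simp: length_Suc_conv)
      then show "set cs \<subseteq> {0}" using 0 by (auto simp: fibre_Nil True)
    qed (auto simp: Xmod_Nil)
    ultimately show ?thesis by (simp add: tree_Nil True max_paths_def)
  next
    case False
    then show ?thesis by (auto simp: tree_Nil max_paths_def fibre_basis_def fibre_Nil)
  qed
next
  case (snoc a s)
  let ?pv = "path_vec D s :: _ \<Rightarrow> ('v, 'i, 'f) vec"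
  let ?ps = "\<lambda>x. max_paths (tree D s x)" and ?qs = "max_paths (tree D (s @ [a]) x)"
  have s: "s \<in> lists S" "a \<in> S" and x: "x \<in> carrier W" using snoc.prems by auto
  have gkm: "gkm TYPE('f) D (evals D s)"
    using snoc.prems(2) by (rule gkm_mono) (rule evals_butlast)
  have ed: "edge_divisible TYPE('f) s" using edge_divisible_root_prime [OF two s(1) gkm] by blast
  note IH = snoc.IH [OF s(1) gkm]
  obtain w where w: "w \<in> carrier W" "len (w \<otimes>\<^bsub>W\<^esub> a) < len w"
    and xw: "x = w \<and> x \<otimes>\<^bsub>W\<^esub> a = w \<otimes>\<^bsub>W\<^esub> a \<or> x = w \<otimes>\<^bsub>W\<^esub> a \<and> x \<otimes>\<^bsub>W\<^esub> a = w" and ne: "w \<noteq> w \<otimes>\<^bsub>W\<^esub> a"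
    and both: "fibre s (w \<otimes>\<^bsub>W\<^esub> a) \<noteq> {} \<Longrightarrow> fibre s w \<noteq> {} \<Longrightarrow> tree D (s @ [a]) x = Some (Vertex
         [(Edge Right_Tilted (if x = w then 1 else 0) (root_of D a), the (tree D s (w \<otimes>\<^bsub>W\<^esub> a))),
          (Edge Left_Tilted (if x = w then 0 else - 1) (root_of D a), the (tree D s w))])"
    and one: "fibre s (w \<otimes>\<^bsub>W\<^esub> a) \<noteq> {} \<Longrightarrow> fibre s w = {} \<Longrightarrow> tree D (s @ [a]) x = Some (Vertex
         [(Edge Vertical (if x = w \<otimes>\<^bsub>W\<^esub> a then 0 else 1) (root_of D a), the (tree D s (w \<otimes>\<^bsub>W\<^esub> a)))])"
    and none: "fibre s (w \<otimes>\<^bsub>W\<^esub> a) = {} \<Longrightarrow> fibre s w = {} \<and> tree D (s @ [a]) x = None"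
    by (rule tree_cases [OF s x]) (use that in blast)
  let ?u = "w \<otimes>\<^bsub>W\<^esub> a"
  have u: "?u \<in> carrier W" using w s by simp
  \<comment> \<open>Only the colours depend on which of the two elements is x; the pair of fibres
    does not.\<close>
  have un: "fibre s x \<union> fibre s (x \<otimes>\<^bsub>W\<^esub> a) = fibre s w \<union> fibre s ?u" using xw by auto
  have gu: "good_path TYPE('f) s ?u \<pi>" if "\<pi> \<in> set (?ps ?u)" for \<pi> using IH [OF u] that by blast
  have gw: "good_path TYPE('f) s w \<pi>" if "\<pi> \<in> set (?ps w)" for \<pi> using IH [OF w(1)] that by blast
  have bu: "fibre_basis s ?u (map ?pv (?ps ?u))" using IH [OF u] by blast
  have bw: "fibre_basis s w (map ?pv (?ps w))" using IH [OF w(1)] by blast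
  consider "fibre s ?u = {}" | "fibre s ?u \<noteq> {}" "fibre s w = {}" | "fibre s ?u \<noteq> {}" "fibre s w \<noteq> {}" by blast
  then show ?case
  proof cases
    case 1
    then have "?qs = []" "fibre s w = {}" using none by (auto simp: max_paths_def)
    moreover have "fibre (s @ [a]) x = {}" using un 1 \<open>fibre s w = {}\<close> by (simp add: fibre_snoc_empty [OF s x])
    ultimately show ?thesis by (simp add: fibre_basis_def)
  next
    case 2
    \<comment> \<open>With an empty upper fibre, the basis over the lower one is already a basis
      over the union.\<close>
    define e where "e = Edge Vertical (if x = ?u then 0 else 1) (root_of D a)"
    have qs: "?qs = map (\<lambda>\<pi>. \<pi> @ [e]) (?ps ?u)"
      unfolding one [OF 2] e_def [symmetric]
      by (simp add: max_paths_def [where T = "Some t" for t] max_paths_the_tree [OF s(1) u 2(1)])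
    have e: "?u = (if colour e = 0 then x else x \<otimes>\<^bsub>W\<^esub> a)" "root_label e = root_of D a" "tilt e \<noteq> Left_Tilted"
      using xw ne by (auto simp: e_def)
    have good: "good_path TYPE('f) (s @ [a]) x \<pi>" if "\<pi> \<in> set ?qs" for \<pi>
      using that good_path_snoc(1) [where ?'f = 'f, OF s x e(1) _ e(2)] gu unfolding qs by auto
    have "map (path_vec D (s @ [a])) ?qs = map (diag (s @ [a])) (map ?pv (?ps ?u))"
      unfolding qs using good_path_snoc(2) [where ?'f = 'f, OF s x e(1) _ e(2)] gu e(3) by simp
    moreover have "fibre_basis (s @ [a]) x (map (diag (s @ [a])) (map ?pv (?ps ?u)))"
      by (rule fibre_basis_diag [OF s x])
        (use bu 2(2) in \<open>auto simp: un fibre_basis_def\<close>)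
    ultimately show ?thesis using good by simp
  next
    case 3
    define e1 where "e1 = Edge Right_Tilted (if x = w then 1 else 0) (root_of D a)"
    define e2 where "e2 = Edge Left_Tilted (if x = w then 0 else - 1) (root_of D a)"
    \<comment> \<open>The right tilted edge comes from the left subtree, so the leaf order agrees
      with the order in \<open>fibre_pair_basis\<close>.\<close>
    have qs: "?qs = map (\<lambda>\<pi>. \<pi> @ [e1]) (?ps ?u) @ map (\<lambda>\<pi>. \<pi> @ [e2]) (?ps w)"
      unfolding both [OF 3] e1_def [symmetric] e2_def [symmetric]
      by (simp add: max_paths_def [where T = "Some t" for t]
          max_paths_the_tree [OF s(1) u 3(1)] max_paths_the_tree [OF s(1) w(1) 3(2)])
    have e1: "?u = (if colour e1 = 0 then x else x \<otimes>\<^bsub>W\<^esub> a)" "root_label e1 = root_of D a" "tilt e1 \<noteq> Left_Tilted"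
      using xw ne by (auto simp: e1_def)
    have e2: "w = (if colour e2 = 0 then x else x \<otimes>\<^bsub>W\<^esub> a)" "root_label e2 = root_of D a" "tilt e2 = Left_Tilted"
      using xw ne by (auto simp: e2_def)
    have good: "good_path TYPE('f) (s @ [a]) x \<pi>" if "\<pi> \<in> set ?qs" for \<pi>
      using that good_path_snoc(1) [where ?'f = 'f, OF s x e1(1) _ e1(2)] good_path_snoc(1) [where ?'f = 'f, OF s x e2(1) _ e2(2)] gu gw
      unfolding qs by auto
    have "map (path_vec D (s @ [a])) ?qs
        = map (diag (s @ [a])) (map ?pv (?ps ?u) @ map (bump a w) (map ?pv (?ps w)))"
      unfolding qs using good_path_snoc(2) [where ?'f = 'f, OF s x e1(1) _ e1(2)] good_path_snoc(2) [where ?'f = 'f, OF s x e2(1) _ e2(2)] gu gw e1(3) e2(3)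
      by simp
    moreover note pair = fibre_pair_basis [OF two s ed w bu bw]
    have "fibre_basis (s @ [a]) x (map (diag (s @ [a])) (map ?pv (?ps ?u) @ map (bump a w) (map ?pv (?ps w))))"
      by (rule fibre_basis_diag [OF s x]; (unfold un)?) (use pair in blast)+
    ultimately show ?thesis using good by simp
  qed
qed

text \<open>Translates \<open>path_basis\<close> from coefficient lists into span and dependence of
  the set of restricted vectors.\<close>

lemma homogeneous_basis_paths:
  fixes \<pi> :: "nat \<Rightarrow> ('v \<times> rat) path"
  assumes two: "(2 :: 'f::field) \<noteq> 0" and s: "s \<in> lists S" and gkm: "gkm TYPE('f) D (evals D s)"
    and x: "x \<in> carrier W" and \<pi>: "map \<pi> [0..<n] = max_paths (tree D s x)"
  shows "\<exists>v :: nat \<Rightarrow> ('v, 'i, 'f) vec. homogeneous_basis n v (Xmod_at D s x)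
      \<and> (\<forall>i<n. \<forall>j<n. v i (path_seq s (\<pi> j)) = path_prod D s (\<pi> i) (\<pi> j))"
proof -
  let ?r = "\<lambda>f \<sigma>. if \<sigma> \<in> fibre s x then (f :: ('v, 'i, 'f) vec) \<sigma> else 0"
  let ?b = "\<lambda>i. path_vec D s (\<pi> i) :: ('v, 'i, 'f) vec"
  define v where "v i = ?r (?b i)" for i
  have good: "good_path TYPE('f) s x (\<pi> i)" if "i < n" for i
    using path_basis [OF two s gkm x] that unfolding \<pi> [symmetric] by auto
  have basis: "fibre_basis s x (map ?b [0..<n])"
    using path_basis [OF two s gkm x] unfolding \<pi> [symmetric] by (simp add: comp_def)
  have comb: "lin_comb (map c [0..<n]) (map ?b [0..<n]) \<sigma> = (\<Sum>i<n. c i * ?b i \<sigma>)" for c \<sigma>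
    by (simp add: lin_comb_map_map interv_sum_list_conv_sum_set_nat atLeast0LessThan)
  have span: "\<exists>c. \<forall>\<sigma>\<in>fibre s x. f \<sigma> = (\<Sum>i<n. c i * ?b i \<sigma>)" if f: "f \<in> Xmod D s" for f
  proof -
    obtain cs where cs: "length cs = length (map ?b [0..<n])" "\<And>\<sigma>. \<sigma> \<in> fibre s x \<Longrightarrow> f \<sigma> = lin_comb cs (map ?b [0..<n]) \<sigma>"
      by (rule fibre_basis_span [OF basis f]) (use that in blast)
    have "cs = map (nth cs) [0..<n]" using cs(1) map_nth [of cs] by simp
    then show ?thesis using cs(2) comb [of "nth cs"] by (intro exI [of _ "nth cs"]) metis
  qed
  have indep: "c i = 0" if "\<And>\<sigma>. \<sigma> \<in> fibre s x \<Longrightarrow> (\<Sum>i<n. c i * ?b i \<sigma>) = 0" "i < n" for c i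
  proof -
    have "set (map c [0..<n]) \<subseteq> {0}"
      by (rule fibre_basis_indep [OF basis]) (simp_all add: comb that(1))
    then show ?thesis using that(2) by (auto simp: image_subset_iff)
  qed
  have inj: "inj_on v {..<n}"
  proof (rule inj_onI, rule ccontr)
    fix i j assume ij: "i \<in> {..<n}" "j \<in> {..<n}" "v i = v j" "i \<noteq> j"
    \<comment> \<open>If two of the vectors coincided, their difference would be a relation with
      coefficient 1 at i.\<close>
    define c :: "nat \<Rightarrow> ('i, 'f) sym_alg" where "c k = (if k = i then 1 else 0) - (if k = j then 1 else 0)" for k
    have "c k * ?b k \<sigma> = (if k = i then ?b k \<sigma> else 0) - (if k = j then ?b k \<sigma> else 0)" for k \<sigma>
      using ij(4) by (auto simp: c_def)
    then have "(\<Sum>k<n. c k * ?b k \<sigma>) = ?b i \<sigma> - ?b j \<sigma>" for \<sigma>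
      using ij(1,2) by (simp add: sum_subtractf sum.delta)
    moreover have "?b i \<sigma> = ?b j \<sigma>" if "\<sigma> \<in> fibre s x" for \<sigma>
      using fun_cong [OF ij(3), of \<sigma>] that by (simp add: v_def)
    ultimately have "c i = 0" using ij(1) indep [of c i] by simp
    then show False using ij(4) by (simp add: c_def)
  qed
  interpret M: module "vscale :: ('i, 'f) sym_alg \<Rightarrow> ('v, 'i, 'f) vec \<Rightarrow> ('v, 'i, 'f) vec"
    by (rule module_vscale)
  have sum_v: "(\<Sum>w\<in>v ` {..<n}. vscale (u w) w) = ?r (\<lambda>\<sigma>. \<Sum>i<n. u (v i) * ?b i \<sigma>)" for u
  proof
    fix \<sigma>
    show "(\<Sum>w\<in>v ` {..<n}. vscale (u w) w) \<sigma> = ?r (\<lambda>\<sigma>. \<Sum>i<n. u (v i) * ?b i \<sigma>) \<sigma>"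
      unfolding sum_vec_apply sum.reindex [OF inj] by (simp add: vscale_def v_def)
  qed
  have "\<not> M.dependent (v ` {..<n})"
  proof
    assume "M.dependent (v ` {..<n})"
    then obtain u i where u: "i < n" "u (v i) \<noteq> 0" "(\<Sum>w\<in>v ` {..<n}. vscale (u w) w) = 0"
      by (auto simp: M.dependent_finite)
    have "u (v i) = 0"
    proof (rule indep [OF _ u(1)])
      fix \<sigma> assume "\<sigma> \<in> fibre s x"
      then show "(\<Sum>i<n. u (v i) * ?b i \<sigma>) = 0"
        using fun_cong [OF u(3), of \<sigma>] unfolding sum_v by simp
    qed
    then show False using u(2) by simp
  qed
  moreover have "M.span (v ` {..<n}) = Xmod_at D s x"
  proof -
    have "M.span (v ` {..<n}) = range (\<lambda>u. ?r (\<lambda>\<sigma>. \<Sum>i<n. u (v i) * ?b i \<sigma>))"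
      by (simp add: M.span_finite sum_v)
    also have "\<dots> = ?r ` Xmod D s"
    proof (intro equalityI subsetI)
      fix f assume "f \<in> range (\<lambda>u. ?r (\<lambda>\<sigma>. \<Sum>i<n. u (v i) * ?b i \<sigma>))"
      then obtain u where f: "f = ?r (\<lambda>\<sigma>. \<Sum>i<n. u (v i) * ?b i \<sigma>)" by blast
      have "(\<lambda>\<sigma>. \<Sum>i<n. u (v i) * ?b i \<sigma>) = lin_comb (map (u \<circ> v) [0..<n]) (map ?b [0..<n])"
        by (rule ext) (simp add: comb)
      also have "\<dots> \<in> Xmod D s" by (rule Xmod_lin_comb [OF fibre_basis_subset [OF basis]])
      finally show "f \<in> ?r ` Xmod D s" unfolding f by (rule imageI)
    next
      fix f assume "f \<in> ?r ` Xmod D s"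
      then obtain g where g: "g \<in> Xmod D s" "f = ?r g" by blast
      obtain c where c: "\<forall>\<sigma>\<in>fibre s x. g \<sigma> = (\<Sum>i<n. c i * ?b i \<sigma>)" using span [OF g(1)] by blast
      \<comment> \<open>\<open>span\<close> attaches coefficients to vectors; injectivity of v
        allows coefficients indexed by numbers to be moved there.\<close>
      have "f = ?r (\<lambda>\<sigma>. \<Sum>i<n. (c \<circ> the_inv_into {..<n} v) (v i) * ?b i \<sigma>)"
        using c by (auto simp: g(2) fun_eq_iff the_inv_into_f_f [OF inj])
      then show "f \<in> range (\<lambda>u. ?r (\<lambda>\<sigma>. \<Sum>i<n. u (v i) * ?b i \<sigma>))"
        by (rule range_eqI [where x = "c \<circ> the_inv_into {..<n} v"])
    qed
    also have "\<dots> = Xmod_at D s x" by (simp add: Xmod_at_def)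
    finally show ?thesis .
  qed
  moreover have "homogeneous_vec (v i)" if "i < n" for i
    using good [OF that] unfolding good_path_def homogeneous_vec_def v_def by (metis homogeneous_zero)
  ultimately have "homogeneous_basis n v (Xmod_at D s x)"
    using inj by (simp add: homogeneous_basis_def)
  moreover have "v i (path_seq s (\<pi> j)) = path_prod D s (\<pi> i) (\<pi> j)" if "i < n" "j < n" for i j
    using good [OF that(2)] by (simp add: v_def path_prod_def good_path_def)
  ultimately show ?thesis by blast
qed

end

theorem corollary4p8p2:
  fixes D :: "('v::ab_group_add, 'i::finite) affine_datum"
    and s :: "'v aff list"
    and x :: "'v aff"
    and \<pi> :: "nat \<Rightarrow> ('v \<times> rat) path"
    and n :: nat
  assumes "affine_setting D"
    and "(2 :: 'f::field) \<noteq> 0"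
    and "s \<in> lists (simple_refls D)"
    and "gkm TYPE('f) D (evals D s)"
    and "x \<in> carrier (aff_weyl D)"
    and "map \<pi> [0..<n] = max_paths (tree D s x)"
  shows "\<exists>v :: nat \<Rightarrow> ('v, 'i, 'f) vec.
      homogeneous_basis n v (Xmod_at D s x)
      \<and> (\<forall>i<n. \<forall>j<n. v i (path_seq s (\<pi> j)) = path_prod D s (\<pi> i) (\<pi> j))"
proof -
  interpret affine_setting D by fact
  show ?thesis by (rule homogeneous_basis_paths [OF assms(2-6)])
qed

end
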